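(* Let $M$ be a compact topological manifold of dimension at least $2$. There exists a residual subset $\mathfrak{R}$ of $\mathrm{Homeo}(M)$ such that for every $f\in\mathfrak{R}$, every continuous roof function $r:M\to(0,\infty)$ and every continuous $\alpha:\overline M\to[0,\infty)$ such that $\alpha^{-1}(0)$ is compact and countable, the pseudo-singular suspension flow $\psi$ of $f$ with roof $r$ and brake $\alpha$ satisfies $h_{top}(\psi)>0$.
   Context: A subset of $\mathrm{Homeo}(M)$ is residual if it is a countable intersection of open and dense sets. $\mathrm{Homeo}(M)$ is the set of homeomorphisms of $M$ with the $C^0$ topology, i.e. the topology of the metric $\tilde d(f,g)=\sup_x d(f(x),g(x))+\sup_x d(f^{-1}(x),g^{-1}(x))$, where $d$ is a metric compatible with the topology of $M$. Suspension flow. Let $f:M\to M$ be a homeomorphism and $r:M\to(0,\infty)$ continuous (the roof function). Put $\overline M=\{(t,x):x\in M,\ 0\le t\le r(x)\}/\sim$, where $(r(x),x)\sim(0,f(x))$; this is a compact metrizable space. The suspension flow $\phi=(\phi^t)_{t\in\mathbb{R}}$ of $f$ with roof $r$ is the continuous flow on $\overline M$ that moves at unit speed in the $t$-coordinate: for $t+s\ge 0$, $\phi^t([(s,x)])=[(s',f^n(x))]$ where $n\ge0$ is an integer, $\sum_{j=0}^{n-1}r(f^j(x))+s'=t+s$ and $0\le s'\le r(f^n(x))$, and similarly for negative times. Pseudo-singular suspension flow. Let $\alpha:\overline M\to[0,\infty)$ be continuous (the brake) with $S:=\alpha^{-1}(0)$ nonempty, compact and countable. For $z\in\overline M$, $t\in\mathbb{R}$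 define $\theta(t,z)=\int_0^t\alpha(\phi^s(z))^{-1}ds$ (with $1/0=+\infty$, values in $[-\infty,\infty]$) and $\tau(t,z)=\sup\{s:\theta(s,z)\le t\}$. The pseudo-singular suspension flow of $f$ with roof $r$ and brake $\alpha$ is $\psi=(\psi^t)_{t\in\mathbb{R}}$, $\psi^t(z)=\phi^{\tau(t,z)}(z)$. The topological entropy of a flow $\psi$ is $h_{top}(\psi):=h_{top}(\psi^1)$. *)

theory Defs
  imports "HOL-Analysis.Analysis"
begin

section \<open>Manifolds, homeomorphisms and residual sets\<close>

text \<open>Manifolds have no boundary; they need not be connected.\<close>

definition topological_manifold :: "nat \<Rightarrow> 'a topology \<Rightarrow> bool" where
  "topological_manifold n X \<longleftrightarrow>
     Hausdorff_space X \<and> second_countable X \<and>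
     (\<forall>x\<in>topspace X. \<exists>U V. openin X U \<and> x \<in> U \<and> openin (Euclidean_space n) V \<and>
        subtopology X U homeomorphic_space subtopology (Euclidean_space n) V)"

text \<open>Maps are made extensional so that two homeomorphisms that agree on the space are equal.\<close>

definition Homeo :: "'a topology \<Rightarrow> ('a \<Rightarrow> 'a) set" where
  "Homeo X = {f \<in> extensional (topspace X). homeomorphic_map X X f}"

text \<open>The value 0 outside the set of homeomorphisms is needed because the locale
  \<^locale>\<open>Metric_space\<close> requires nonnegativity and symmetry everywhere.\<close>

definition C0_dist :: "'a topology \<Rightarrow> ('a \<Rightarrow> 'a \<Rightarrow> real) \<Rightarrow> ('a \<Rightarrow> 'a) \<Rightarrow> ('a \<Rightarrow> 'a) \<Rightarrow> real" where
  "C0_dist X d f g =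
     (if f \<in> Homeo X \<and> g \<in> Homeo X \<and> topspace X \<noteq> {}
      then (SUP x\<in>topspace X. d (f x) (g x)) +
           (SUP x\<in>topspace X. d (inv_into (topspace X) f x) (inv_into (topspace X) g x))
      else 0)"

definition C0_topology :: "'a topology \<Rightarrow> ('a \<Rightarrow> 'a \<Rightarrow> real) \<Rightarrow> ('a \<Rightarrow> 'a) topology" where
  "C0_topology X d = Metric_space.mtopology (Homeo X) (C0_dist X d)"

definition residual_in :: "'a topology \<Rightarrow> 'a set \<Rightarrow> bool" where
  "residual_in Y R \<longleftrightarrow>
     (\<exists>U :: nat \<Rightarrow> 'a set.
        (\<forall>k. openin Y (U k) \<and> Y closure_of (U k) = topspace Y) \<and> R = (\<Inter>k. U k))"


section \<open>The suspension space\<close>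

definition roof_function :: "'a topology \<Rightarrow> ('a \<Rightarrow> real) \<Rightarrow> bool" where
  "roof_function X r \<longleftrightarrow> continuous_map X euclideanreal r \<and> (\<forall>x\<in>topspace X. 0 < r x)"

definition under_roof :: "'a topology \<Rightarrow> ('a \<Rightarrow> real) \<Rightarrow> (real \<times> 'a) set" where
  "under_roof X r = {(t, x). x \<in> topspace X \<and> 0 \<le> t \<and> t \<le> r x}"

definition susp_glue :: "'a topology \<Rightarrow> ('a \<Rightarrow> 'a) \<Rightarrow> ('a \<Rightarrow> real) \<Rightarrow> ((real \<times> 'a) \<times> (real \<times> 'a)) set" where
  "susp_glue X f r = {((r x, x), (0, f x)) |x. x \<in> topspace X}"

text \<open>The equivalence relation on \<^term>\<open>under_roof X r\<close> generated by the gluing.\<close>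

definition susp_rel :: "'a topology \<Rightarrow> ('a \<Rightarrow> 'a) \<Rightarrow> ('a \<Rightarrow> real) \<Rightarrow> ((real \<times> 'a) \<times> (real \<times> 'a)) set" where
  "susp_rel X f r =
     rtrancl (susp_glue X f r \<union> converse (susp_glue X f r)) \<inter> under_roof X r \<times> under_roof X r"

definition susp_class :: "'a topology \<Rightarrow> ('a \<Rightarrow> 'a) \<Rightarrow> ('a \<Rightarrow> real) \<Rightarrow> real \<times> 'a \<Rightarrow> (real \<times> 'a) set" where
  "susp_class X f r p = susp_rel X f r `` {p}"

definition quotient_topology :: "'a topology \<Rightarrow> ('a \<Rightarrow> 'b) \<Rightarrow> 'b topology" where
  "quotient_topology Y q =
     topology (\<lambda>U. U \<subseteq> q ` topspace Y \<and> openin Y {y \<in> topspace Y. q y \<in> U})"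

definition susp_space :: "'a topology \<Rightarrow> ('a \<Rightarrow> 'a) \<Rightarrow> ('a \<Rightarrow> real) \<Rightarrow> (real \<times> 'a) set topology" where
  "susp_space X f r =
     quotient_topology (subtopology (prod_topology euclideanreal X) (under_roof X r)) (susp_class X f r)"


section \<open>The suspension flow\<close>

definition int_iter :: "'a topology \<Rightarrow> ('a \<Rightarrow> 'a) \<Rightarrow> int \<Rightarrow> 'a \<Rightarrow> 'a" where
  "int_iter X f n x =
     (if 0 \<le> n then (f ^^ nat n) x else ((inv_into (topspace X) f) ^^ nat (- n)) x)"

text \<open>For negative \<^term>\<open>n\<close> this is minus the sum of \<^term>\<open>r\<close> over the iterates
  number \<^term>\<open>n\<close> to \<open>-1\<close>: the time that the flow needs to get
  from \<open>[(0,x)]\<close> to \<open>[(0,f\<^sup>n(x))]\<close>, with sign.\<close>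

definition roof_sum :: "'a topology \<Rightarrow> ('a \<Rightarrow> 'a) \<Rightarrow> ('a \<Rightarrow> real) \<Rightarrow> int \<Rightarrow> 'a \<Rightarrow> real" where
  "roof_sum X f r n x =
     (if 0 \<le> n then \<Sum>j\<in>{0..<n}. r (int_iter X f j x) else - (\<Sum>j\<in>{n..<0}. r (int_iter X f j x)))"

text \<open>One formula covers both signs of time; see \<open>susp_flow_ex1\<close> below for well-definedness.\<close>

definition susp_flow ::
  "'a topology \<Rightarrow> ('a \<Rightarrow> 'a) \<Rightarrow> ('a \<Rightarrow> real) \<Rightarrow> real \<Rightarrow> (real \<times> 'a) set \<Rightarrow> (real \<times> 'a) set" where
  "susp_flow X f r t z =
     (THE w. \<exists>s x n s'. (s, x) \<in> under_roof X r \<and> z = susp_class X f r (s, x) \<and>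
        roof_sum X f r n x + s' = t + s \<and> 0 \<le> s' \<and> s' \<le> r (int_iter X f n x) \<and>
        w = susp_class X f r (s', int_iter X f n x))"


section \<open>Pseudo-singular suspension flows\<close>

definition brake ::
  "'a topology \<Rightarrow> ('a \<Rightarrow> 'a) \<Rightarrow> ('a \<Rightarrow> real) \<Rightarrow> ((real \<times> 'a) set \<Rightarrow> real) \<Rightarrow> bool" where
  "brake X f r \<alpha> \<longleftrightarrow>
     continuous_map (susp_space X f r) euclideanreal \<alpha> \<and>
     (\<forall>z\<in>topspace (susp_space X f r). 0 \<le> \<alpha> z) \<and>
     (let S = {z \<in> topspace (susp_space X f r). \<alpha> z = 0}
      in S \<noteq> {} \<and> compactin (susp_space X f r) S \<and> countable S)"

text \<open>In \<^typ>\<open>ennreal\<close> the inverse of 0 is \<open>\<infinity>\<close>.\<close>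

definition brake_time ::
  "'a topology \<Rightarrow> ('a \<Rightarrow> 'a) \<Rightarrow> ('a \<Rightarrow> real) \<Rightarrow> ((real \<times> 'a) set \<Rightarrow> real) \<Rightarrow>
   real \<Rightarrow> (real \<times> 'a) set \<Rightarrow> ereal" where
  "brake_time X f r \<alpha> t z =
     (if 0 \<le> t
      then enn2ereal (\<integral>\<^sup>+ s\<in>{0..t}. inverse (ennreal (\<alpha> (susp_flow X f r s z))) \<partial>lborel)
      else - enn2ereal (\<integral>\<^sup>+ s\<in>{t..0}. inverse (ennreal (\<alpha> (susp_flow X f r s z))) \<partial>lborel))"

text \<open>On a compact space the brake is bounded, by some \<open>A > 0\<close>, so that \<open>\<bar>\<theta>(s,z)\<bar> \<ge> \<bar>s\<bar>/A\<close>.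
  Hence the supremum is that of a nonempty set of reals that is bounded above.\<close>

definition brake_clock ::
  "'a topology \<Rightarrow> ('a \<Rightarrow> 'a) \<Rightarrow> ('a \<Rightarrow> real) \<Rightarrow> ((real \<times> 'a) set \<Rightarrow> real) \<Rightarrow>
   real \<Rightarrow> (real \<times> 'a) set \<Rightarrow> real" where
  "brake_clock X f r \<alpha> t z = Sup {s. brake_time X f r \<alpha> s z \<le> ereal t}"

definition pseudo_singular_flow ::
  "'a topology \<Rightarrow> ('a \<Rightarrow> 'a) \<Rightarrow> ('a \<Rightarrow> real) \<Rightarrow> ((real \<times> 'a) set \<Rightarrow> real) \<Rightarrow>
   real \<Rightarrow> (real \<times> 'a) set \<Rightarrow> (real \<times> 'a) set" where
  "pseudo_singular_flow X f r \<alpha> t z = susp_flow X f r (brake_clock X f r \<alpha> t z) z"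


section \<open>Topological entropy\<close>

text \<open>The definition of Adler, Konheim and McAndrew by open covers. It needs no choice of a metric.\<close>

definition open_cover :: "'a topology \<Rightarrow> 'a set set \<Rightarrow> bool" where
  "open_cover Y \<U> \<longleftrightarrow> (\<forall>U\<in>\<U>. openin Y U) \<and> topspace Y \<subseteq> \<Union>\<U>"

definition min_subcover :: "'a topology \<Rightarrow> 'a set set \<Rightarrow> nat" where
  "min_subcover Y \<U> = Inf {card \<V> |\<V>. \<V> \<subseteq> \<U> \<and> finite \<V> \<and> topspace Y \<subseteq> \<Union>\<V>}"

text \<open>The common refinement of the preimages of the cover under the first \<^term>\<open>n\<close> iterates
  of \<^term>\<open>T\<close>, starting with the identity.\<close>

definition iterated_cover :: "'a topology \<Rightarrow> ('a \<Rightarrow> 'a) \<Rightarrow> 'a set set \<Rightarrow> nat \<Rightarrow> 'a set set" where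
  "iterated_cover Y T \<U> n =
     {{y \<in> topspace Y. \<forall>i<n. (T ^^ i) y \<in> A i} |A. \<forall>i<n. A i \<in> \<U>}"

definition topological_entropy :: "'a topology \<Rightarrow> ('a \<Rightarrow> 'a) \<Rightarrow> ereal" where
  "topological_entropy Y T =
     (SUP \<U>\<in>Collect (open_cover Y).
        limsup (\<lambda>n. ereal (ln (real (min_subcover Y (iterated_cover Y T \<U> n))) / real n)))"

definition flow_entropy :: "'a topology \<Rightarrow> (real \<Rightarrow> 'a \<Rightarrow> 'a) \<Rightarrow> ereal" where
  "flow_entropy Y \<psi> = topological_entropy Y (\<psi> 1)"


section \<open>Well-definedness\<close>

lemma istopology_quotient:
  "istopology (\<lambda>U. U \<subseteq> q ` topspace Y \<and> openin Y {y \<in> topspace Y. q y \<in> U})"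
proof -
  have 1: "{y \<in> topspace Y. q y \<in> S \<inter> T} = {y \<in> topspace Y. q y \<in> S} \<inter> {y \<in> topspace Y. q y \<in> T}" for S T
    by auto
  have 2: "{y \<in> topspace Y. q y \<in> \<Union>\<K>} = (\<Union>S\<in>\<K>. {y \<in> topspace Y. q y \<in> S})" for \<K>
    by auto
  show ?thesis
    unfolding istopology_def 1 2 by (auto intro!: openin_Int openin_Union)
qed

lemma openin_quotient_topology:
  "openin (quotient_topology Y q) U \<longleftrightarrow>
     U \<subseteq> q ` topspace Y \<and> openin Y {y \<in> topspace Y. q y \<in> U}"
  unfolding quotient_topology_def using istopology_quotient[of q Y]
  by (simp add: topology_inverse')

lemma topspace_quotient_topology: "topspace (quotient_topology Y q) = q ` topspace Y"
proof
  show "topspace (quotient_topology Y q) \<subseteq> q ` topspace Y"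
    using openin_quotient_topology[of Y q "topspace (quotient_topology Y q)"] by simp
  have "{y \<in> topspace Y. q y \<in> q ` topspace Y} = topspace Y" by auto
  then have "openin (quotient_topology Y q) (q ` topspace Y)"
    by (simp add: openin_quotient_topology)
  then show "q ` topspace Y \<subseteq> topspace (quotient_topology Y q)"
    by (rule openin_subset)
qed

lemma quotient_map_quotient_topology: "quotient_map Y (quotient_topology Y q) q"
  unfolding quotient_map_def
  by (auto simp: topspace_quotient_topology openin_quotient_topology)

lemma topspace_susp_space:
  "topspace (susp_space X f r) = susp_class X f r ` under_roof X r"
  unfolding susp_space_def topspace_quotient_topology
  by (auto simp: under_roof_def)

lemma equiv_susp_rel: "equiv (under_roof X r) (susp_rel X f r)"
proof (rule equivI)
  have "sym (under_roof X r \<times> under_roof X r)"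
    by (auto intro: symI)
  then show "sym (susp_rel X f r)"
    unfolding susp_rel_def by (intro sym_Int sym_rtrancl sym_Un_converse)
  show "trans (susp_rel X f r)"
    unfolding susp_rel_def by (auto intro!: transI intro: rtrancl_trans)
qed (auto simp: susp_rel_def refl_on_def)

lemma Metric_space_C0_dist:
  assumes d: "Metric_space (topspace X) d" "Metric_space.mtopology (topspace X) d = X"
    and cpt: "compact_space X"
  shows "Metric_space (Homeo X) (C0_dist X d)"
proof (cases "topspace X = {}")
  case True
  then show ?thesis
    by (auto simp: Metric_space_def C0_dist_def Homeo_def)
next
  case False
  let ?M = "topspace X"
  interpret D: Metric_space ?M d by fact
  have "D.mbounded ?M"
    using cpt d(2) by (metis D.compactin_imp_mbounded compact_space_def)
  then obtain B where B: "\<And>x y. x \<in> ?M \<Longrightarrow> y \<in> ?M \<Longrightarrow> d x y \<le> B"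
    by (metis D.mbounded_alt)
  have bij: "bij_betw f ?M ?M" if "f \<in> Homeo X" for f
    using that by (simp add: Homeo_def bij_betw_def homeomorphic_eq_everything_map)
  have in1: "f x \<in> ?M" if "f \<in> Homeo X" "x \<in> ?M" for f x
    using bij[OF that(1)] that(2) by (auto simp: bij_betw_def)
  have in2: "inv_into ?M f x \<in> ?M" if "f \<in> Homeo X" "x \<in> ?M" for f x
    using bij[OF that(1)] that(2) by (auto simp: bij_betw_def intro: inv_into_into)
  have le: "d (u x) (v x) \<le> (SUP x\<in>?M. d (u x) (v x))"
    if "x \<in> ?M" "u \<in> ?M \<rightarrow> ?M" "v \<in> ?M \<rightarrow> ?M" for u v x
    using that by (intro cSUP_upper bdd_aboveI2[where M=B] B) auto
  have ge: "(SUP x\<in>?M. d (u x) (v x)) \<ge> 0"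
    if "u \<in> ?M \<rightarrow> ?M" "v \<in> ?M \<rightarrow> ?M" for u v
    using le[OF _ that] False D.nonneg by (meson equals0I order_trans)
  have tri: "(SUP x\<in>?M. d (u x) (w x)) \<le> (SUP x\<in>?M. d (u x) (v x)) + (SUP x\<in>?M. d (v x) (w x))"
    if "u \<in> ?M \<rightarrow> ?M" "v \<in> ?M \<rightarrow> ?M" "w \<in> ?M \<rightarrow> ?M" for u v w
  proof (rule cSUP_least[OF False])
    fix x assume x: "x \<in> ?M"
    have "d (u x) (w x) \<le> d (u x) (v x) + d (v x) (w x)"
      using that x by (intro D.triangle) auto
    then show "d (u x) (w x) \<le> (SUP x\<in>?M. d (u x) (v x)) + (SUP x\<in>?M. d (v x) (w x))"
      using le[OF x that(1,2)] le[OF x that(2,3)] by linarith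
  qed
  have F: "f \<in> ?M \<rightarrow> ?M" "inv_into ?M f \<in> ?M \<rightarrow> ?M" if "f \<in> Homeo X" for f
    using that in1 in2 by auto
  show ?thesis
  proof
    fix f g
    show "0 \<le> C0_dist X d f g"
      unfolding C0_dist_def by (auto intro!: add_nonneg_nonneg ge dest: F in1 in2)
    show "C0_dist X d f g = C0_dist X d g f"
      by (simp add: C0_dist_def D.commute)
  next
    fix f g assume fg: "f \<in> Homeo X" "g \<in> Homeo X"
    show "C0_dist X d f g = 0 \<longleftrightarrow> f = g"
    proof
      assume "C0_dist X d f g = 0"
      then have "(SUP x\<in>?M. d (f x) (g x)) \<le> 0"
        using fg False ge[OF F(2)[OF fg(1)] F(2)[OF fg(2)]] by (simp add: C0_dist_def)
      then have "d (f x) (g x) = 0" if "x \<in> ?M" for x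
        using le[OF that F(1)[OF fg(1)] F(1)[OF fg(2)]] D.nonneg[of "f x" "g x"] by linarith
      then have "f x = g x" if "x \<in> ?M" for x
        using that fg in1 by auto
      then show "f = g"
        using fg by (auto simp: Homeo_def intro: extensionalityI)
    next
      assume "f = g"
      have "(SUP x\<in>?M. d (g x) (g x)) = (SUP x\<in>?M. (0::real))"
        using fg in1 by (intro SUP_cong) auto
      moreover have "(SUP x\<in>?M. d (inv_into ?M g x) (inv_into ?M g x)) = (SUP x\<in>?M. (0::real))"
        using fg in2 by (intro SUP_cong) auto
      ultimately show "C0_dist X d f g = 0"
        using fg False \<open>f = g\<close> by (simp add: C0_dist_def)
    qed
  next
    fix f g h assume fgh: "f \<in> Homeo X" "g \<in> Homeo X" "h \<in> Homeo X"
    show "C0_dist X d f h \<le> C0_dist X d f g + C0_dist X d g h"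
      using fgh False tri[OF F(1) F(1) F(1), OF fgh] tri[OF F(2) F(2) F(2), OF fgh]
      by (simp add: C0_dist_def)
  qed
qed

lemma int_iter_props:
  assumes "f \<in> Homeo X" "x \<in> topspace X"
  shows int_iter_in: "int_iter X f n x \<in> topspace X"
    and int_iter_succ: "int_iter X f (n + 1) x = f (int_iter X f n x)"
    and int_iter_shift: "int_iter X f n (f x) = int_iter X f (n + 1) x"
proof -
  let ?M = "topspace X"
  let ?g = "inv_into ?M f"
  have inj: "inj_on f ?M" and im: "f ` ?M = ?M"
    using assms(1) by (auto simp: Homeo_def homeomorphic_eq_everything_map)
  have g: "?g y \<in> ?M" "f (?g y) = y" "?g (f y) = y" "f y \<in> ?M" if "y \<in> ?M" for y
    using that inj im by (auto intro: inv_into_into f_inv_into_f)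
  have f_in: "(f ^^ k) y \<in> ?M" and g_in: "(?g ^^ k) y \<in> ?M" if "y \<in> ?M" for k y
    using that g by (induction k) auto
  show "int_iter X f n x \<in> ?M"
    using assms(2) f_in g_in by (simp add: int_iter_def)
  show "int_iter X f (n + 1) x = f (int_iter X f n x)"
  proof (cases "0 \<le> n")
    case True
    then show ?thesis by (simp add: int_iter_def nat_add_distrib)
  next
    case False
    define m where "m = nat (- n) - 1"
    have m: "n = - int (Suc m)" using False by (simp add: m_def)
    have "f (?g ((?g ^^ m) x)) = (?g ^^ m) x" using g g_in assms(2) by blast
    then show ?thesis using m by (cases m) (auto simp: int_iter_def nat_add_distrib)
  qed
  show "int_iter X f n (f x) = int_iter X f (n + 1) x"
  proof (cases "0 \<le> n")
    case True
    then show ?thesis by (simp add: int_iter_def nat_add_distrib funpow_swap1)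
  next
    case False
    define m where "m = nat (- n) - 1"
    have m: "n = - int (Suc m)" using False by (simp add: m_def)
    have "(?g ^^ Suc m) (f x) = (?g ^^ m) x"
      using g(3)[OF assms(2)] by (simp only: funpow_Suc_right o_apply)
    moreover have "int_iter X f n (f x) = (?g ^^ Suc m) (f x)"
      using m by (simp add: int_iter_def nat_add_distrib del: funpow.simps)
    moreover have "int_iter X f (n + 1) x = (?g ^^ m) x"
      using m by (cases m) (auto simp: int_iter_def nat_add_distrib)
    ultimately show ?thesis by simp
  qed
qed

lemma roof_sum_succ: "roof_sum X f r (n + 1) x = roof_sum X f r n x + r (int_iter X f n x)"
proof (cases "0 \<le> n")
  case True
  then have "{0..<n + 1} = insert n {0..<n}" by auto
  then show ?thesis using True by (simp add: roof_sum_def)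
next
  case False
  then have "{n..<0} = insert n {n + 1..<0}" by auto
  then show ?thesis using False by (cases "n = -1") (auto simp: roof_sum_def)
qed

lemma roof_sum_shift:
  assumes "f \<in> Homeo X" "x \<in> topspace X"
  shows "roof_sum X f r n (f x) = roof_sum X f r (n + 1) x - r x"
proof (induction n rule: int_induct[where k=0])
  case base
  then show ?case using roof_sum_succ[of X f r 0 x] by (simp add: roof_sum_def int_iter_def)
next
  case (step1 i)
  then show ?case
    using assms roof_sum_succ[of X f r i "f x"] roof_sum_succ[of X f r "i + 1" x]
    by (simp add: int_iter_shift)
next
  case (step2 i)
  then show ?case
    using assms roof_sum_succ[of X f r "i - 1" "f x"] roof_sum_succ[of X f r i x]
    by (simp add: int_iter_shift)
qed

lemma susp_flow_ex1:
  assumes cpt: "compact_space X" and f: "f \<in> Homeo X" and r: "roof_function X r"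
    and z: "z \<in> topspace (susp_space X f r)"
  shows "\<exists>!w. \<exists>s x n s'. (s, x) \<in> under_roof X r \<and> z = susp_class X f r (s, x) \<and>
        roof_sum X f r n x + s' = t + s \<and> 0 \<le> s' \<and> s' \<le> r (int_iter X f n x) \<and>
        w = susp_class X f r (s', int_iter X f n x)"
proof -
  let ?M = "topspace X"
  let ?cl = "susp_class X f r"
  let ?S = "roof_sum X f r"
  let ?i = "int_iter X f"
  define W where "W = (\<lambda>(s, x). {w. \<exists>n s'. ?S n x + s' = t + s \<and> 0 \<le> s' \<and> s' \<le> r (?i n x) \<and>
        w = ?cl (s', ?i n x)})"
  have rpos: "0 < r x" if "x \<in> ?M" for x
    using r that by (simp add: roof_function_def)
  obtain c where c: "c > 0" "\<And>x. x \<in> ?M \<Longrightarrow> c \<le> r x"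
  proof (cases "?M = {}")
    case False
    have "compact (r ` ?M)"
      using image_compactin[of X ?M euclideanreal r] cpt r
      by (simp add: compact_space_def roof_function_def)
    then obtain y where "y \<in> r ` ?M" "\<And>u. u \<in> r ` ?M \<Longrightarrow> y \<le> u"
      using compact_attains_inf[of "r ` ?M"] False by auto
    then show ?thesis using rpos that[of y] by auto
  qed (use that[of 1] in auto)
  have growth: "?S m x + of_int (n - m) * c \<le> ?S n x" if "m \<le> n" "x \<in> ?M" for m n x
    using that(1)
  proof (induction n rule: int_ge_induct)
    case (step i)
    then show ?case
      using c(2)[OF int_iter_in[OF f that(2), of i]] roof_sum_succ[of X f r i x]
      by (simp add: algebra_simps)
  qed simp
  have ex: "\<exists>n. ?S n x \<le> u \<and> u < ?S (n + 1) x" if x: "x \<in> ?M" for u x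
  proof -
    define N where "N = \<lceil>\<bar>u\<bar> / c\<rceil> + 1"
    have "\<bar>u\<bar> / c < of_int N" unfolding N_def by linarith
    then have N: "\<bar>u\<bar> < of_int N * c" using c(1) by (simp add: field_simps)
    then have N0: "0 < N" using c(1) by (smt (verit) mult_nonpos_nonneg of_int_le_0_iff)
    have S0: "?S 0 x = 0" by (simp add: roof_sum_def)
    have hi: "u < ?S N x" using growth[of 0 N x] N0 N S0 x by simp
    have lo: "?S (- N) x \<le> u" using growth[of "- N" 0 x] N0 N S0 x by simp
    define k where "k = (LEAST k. u < ?S (- N + int k) x)"
    have ku: "u < ?S (- N + int (nat (2 * N))) x" using hi N0 by simp
    have k: "u < ?S (- N + int k) x" unfolding k_def by (rule LeastI, rule ku)
    have "k \<noteq> 0" using k lo by (intro notI) simp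
    then obtain j where j: "k = Suc j" by (cases k) auto
    have "\<not> u < ?S (- N + int j) x" 
      by (rule not_less_Least) (use j in \<open>simp add: k_def\<close>)
    then show ?thesis using k j by (intro exI[of _ "- N + int j"]) (simp add: algebra_simps)
  qed
  have glue: "?cl (r y, y) = ?cl (0, f y)" if y: "y \<in> ?M" for y
  proof -
    have "f y \<in> ?M" using int_iter_in[OF f y, of 1] by (simp add: int_iter_def)
    then have "((r y, y), (0, f y)) \<in> susp_rel X f r"
      using y rpos[OF y] rpos[of "f y"] by (auto simp: susp_rel_def susp_glue_def under_roof_def)
    then show ?thesis
      unfolding susp_class_def by (rule equiv_class_eq[OF equiv_susp_rel])
  qed
  have uniq: "?cl (a, ?i m x) = ?cl (b, ?i n x)"
    if x: "x \<in> ?M" and mn: "m \<le> n" and eq: "?S m x + a = ?S n x + b"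
      and ab: "0 \<le> a" "a \<le> r (?i m x)" "0 \<le> b" "b \<le> r (?i n x)" for a b m n x
  proof (cases "m = n")
    case False
    have "?S (m + 1) x + of_int (n - (m + 1)) * c \<le> ?S n x"
      using growth[of "m + 1" n x] mn False x by simp
    moreover have "?S n x + b \<le> ?S (m + 1) x" using eq ab by (simp add: roof_sum_succ)
    ultimately have "of_int (n - (m + 1)) * c \<le> 0" using ab by linarith
    then have n: "n = m + 1" using c(1) mn False by (simp add: mult_le_0_iff)
    have "a = r (?i m x)" "b = 0"
      using eq ab n by (simp_all add: roof_sum_succ)
    then show ?thesis
      using glue[OF int_iter_in[OF f x]] n by (simp add: int_iter_succ[OF f x])
  qed (use eq in auto)
  have W1: "\<exists>w. W (s, x) = {w}" if x: "x \<in> ?M" for s x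
  proof -
    obtain n where n: "?S n x \<le> t + s" "t + s < ?S (n + 1) x" using ex[OF x] by blast
    then have "?cl (t + s - ?S n x, ?i n x) \<in> W (s, x)"
      unfolding W_def by (auto simp: roof_sum_succ intro!: exI[of _ n] exI[of _ "t + s - ?S n x"])
    moreover have "w = w'" if ww: "w \<in> W (s, x)" "w' \<in> W (s, x)" for w w'
    proof -
      obtain m a where m: "?S m x + a = t + s" "0 \<le> a" "a \<le> r (?i m x)" "w = ?cl (a, ?i m x)"
        using ww(1) unfolding W_def by auto
      obtain k b where k: "?S k x + b = t + s" "0 \<le> b" "b \<le> r (?i k x)" "w' = ?cl (b, ?i k x)"
        using ww(2) unfolding W_def by auto
      show ?thesis
        using uniq[OF x, of m k a b] uniq[OF x, of k m b a] m k by (cases "m \<le> k") auto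
    qed
    ultimately show ?thesis by blast
  qed
  have Wglue: "W (r x, x) = W (0, f x)" if x: "x \<in> ?M" for x
  proof -
    have "w \<in> W (r x, x)" if w: "w \<in> W (0, f x)" for w
    proof -
      obtain n s' where "?S n (f x) + s' = t" "0 \<le> s'" "s' \<le> r (?i n (f x))" "w = ?cl (s', ?i n (f x))"
        using w unfolding W_def by auto
      then have "?S (n + 1) x + s' = t + r x \<and> 0 \<le> s' \<and> s' \<le> r (?i (n + 1) x) \<and>
          w = ?cl (s', ?i (n + 1) x)"
        by (simp add: roof_sum_shift[OF f x] int_iter_shift[OF f x])
      then show ?thesis unfolding W_def by blast
    qed
    then have "W (0, f x) \<subseteq> W (r x, x)" by blast
    moreover have "f x \<in> ?M" using int_iter_in[OF f x, of 1] by (simp add: int_iter_def)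
    ultimately show ?thesis using W1[OF x, of "r x"] W1[of "f x" 0] by auto
  qed
  have Wrel: "W p = W q" if "(p, q) \<in> susp_rel X f r" for p q
  proof -
    have "(p, q) \<in> rtrancl (susp_glue X f r \<union> converse (susp_glue X f r))"
      using that by (simp add: susp_rel_def)
    then show ?thesis
    proof (induction rule: rtrancl_induct)
      case (step y u)
      then show ?case using Wglue by (auto simp: susp_glue_def)
    qed simp
  qed
  obtain s0 x0 where p0: "(s0, x0) \<in> under_roof X r" "z = ?cl (s0, x0)"
    using z by (auto simp: topspace_susp_space)
  have "x0 \<in> ?M" using p0(1) by (simp add: under_roof_def)
  then obtain w0 where w0: "W (s0, x0) = {w0}" using W1 by blast
  have "(\<exists>s x n s'. (s, x) \<in> under_roof X r \<and> z = ?cl (s, x) \<and>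
        ?S n x + s' = t + s \<and> 0 \<le> s' \<and> s' \<le> r (?i n x) \<and> w = ?cl (s', ?i n x)) \<longleftrightarrow> w = w0" for w
  proof -
    have "W (s, x) = {w0}" if "(s, x) \<in> under_roof X r" "z = ?cl (s, x)" for s x
    proof -
      have "((s, x), (s0, x0)) \<in> susp_rel X f r"
        using that p0 by (intro eq_equiv_class[OF _ equiv_susp_rel]) (simp_all add: susp_class_def)
      then show ?thesis using Wrel w0 by simp
    qed
    then have "(\<exists>s x n s'. (s, x) \<in> under_roof X r \<and> z = ?cl (s, x) \<and>
        ?S n x + s' = t + s \<and> 0 \<le> s' \<and> s' \<le> r (?i n x) \<and> w = ?cl (s', ?i n x))
      \<longleftrightarrow> (\<exists>s x. (s, x) \<in> under_roof X r \<and> z = ?cl (s, x) \<and> w \<in> W (s, x))"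
      unfolding W_def by auto
    also have "\<dots> \<longleftrightarrow> w = w0"
      using p0 w0 \<open>\<And>s x. (s, x) \<in> under_roof X r \<Longrightarrow> z = ?cl (s, x) \<Longrightarrow> W (s, x) = {w0}\<close> by blast
    finally show ?thesis .
  qed
  then show ?thesis by simp
qed

end

theory Submission
  imports Defs
begin

text \<open>A residual set that works is the set of all homeomorphisms that have a topological horseshoe for
  some iterate. It is even open and dense.

  The horseshoe is one with a single expanding direction: an iterate \<open>G = f^k\<close> folds a compact set
  \<open>Q\<close> so that every path across \<open>Q\<close> has an image that crosses \<open>Q\<close> twice. By the intermediate
  value theorem all sequences of two symbols are then realised by orbits of \<open>G\<close>
  (\<open>itinerary_exists\<close>). Everything that is demanded of \<open>G\<close> has the form that a compact set is
  mapped into an open set, so such maps form an open set (\<open>openin_horseshoe_maps\<close>).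

  They are dense (\<open>horseshoe_maps_dense\<close>). By compactness some orbit returns to a small chart, and then
  \<open>f\<close> is composed with a homeomorphism supported in the chart. The first return map is an arbitrary
  embedding near the starting point, so nothing can be said about the image of a box. But if
  the box is first squeezed to a thin tube around a short segment, then the fold only prescribes where small
  neighbourhoods of three points of the segment go, and three points can be pushed where they have to be
  (\<open>fold_embedding\<close>). This takes two dimensions.

  Now let \<open>f\<close> have a horseshoe. If the symbols at even times are those of a word in which one symbol has
  frequency \<open>\<theta>\<close> uniformly over all intervals, while the symbols at odd times are free, then the
  points with such itineraries form closed sets, invariant under \<open>G \<circ> G\<close>, that are pairwise disjoint for different
  \<open>\<theta>\<close>. The zeros of the brake lie on countably many orbits, so for some \<open>\<theta>\<close> these orbits miss the set, and
  the brake has a positive minimum over all forward flow lines that start in it. On these flow lines the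
  pseudo-singular flow is a time change by a factor between two positive constants.

  It remains to see that the free symbols produce entropy at the integer times of the new clock. Two
  flow lines that visit the same members of a fine cover at the times \<open>0, \<dots>, n - 1\<close> cross the roof
  equally often up to each of these times, because their clocks are compared afresh at each visit and errors
  do not add up (\<open>synchronised_counts\<close>). Hence their symbols agree for a number of crossings
  proportional to \<open>n\<close>, and the itineraries give exponentially many points that no iterated cover
  can join (\<open>horseshoe_imp_flow_entropy_pos\<close>).\<close>


section \<open>Topological horseshoes\<close>

lemma crossing_subinterval:
  fixes h :: "real \<Rightarrow> real"
  assumes h: "continuous_on {s..t} h" and st: "s \<le> t" and cd: "c \<le> d"
    and ends: "h s \<le> c \<and> d \<le> h t \<or> d \<le> h s \<and> h t \<le> c"
  obtains s' t' where "s \<le> s'" "s' \<le> t'" "t' \<le> t"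
    "h s' = c \<and> h t' = d \<or> h s' = d \<and> h t' = c"
    "\<And>u. u \<in> {s'..t'} \<Longrightarrow> c \<le> h u \<and> h u \<le> d"
proof -
  have up: "\<exists>s' t'. s \<le> s' \<and> s' \<le> t' \<and> t' \<le> t \<and> k s' = c \<and> k t' = d \<and> (\<forall>u\<in>{s'..t'}. c \<le> k u \<and> k u \<le> d)"
    if k: "continuous_on {s..t} k" "k s \<le> c" "d \<le> k t" "c \<le> d" for k :: "real \<Rightarrow> real" and c d
  proof -
    \<comment> \<open>The first time at height \<open>d\<close>, and before it the last time at height \<open>c\<close>.\<close>
    have "compact ({s..t} \<inter> k -` {d})"
      unfolding compact_eq_bounded_closed using k(1)
      by (auto intro: continuous_closed_preimage bounded_subset[OF bounded_closed_interval])
    moreover have "{s..t} \<inter> k -` {d} \<noteq> {}"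
      using IVT'[of k s d t] k st by auto
    ultimately obtain t' where t': "t' \<in> {s..t}" "k t' = d" "\<And>u. u \<in> {s..t} \<Longrightarrow> k u = d \<Longrightarrow> t' \<le> u"
      using compact_attains_inf[of "{s..t} \<inter> k -` {d}"] by (metis IntI Int_iff singletonD vimage_eq singletonI)
    have kt': "continuous_on {s..t'} k"
      using k(1) t'(1) by (auto intro: continuous_on_subset)
    have le: "k u \<le> d" if u: "u \<in> {s..t'}" for u
    proof (rule ccontr)
      assume "\<not> k u \<le> d"
      moreover have "continuous_on {s..u} k" using kt' u by (auto intro: continuous_on_subset)
      ultimately obtain v where "s \<le> v" "v \<le> u" "k v = d"
        using IVT'[of k s d u] k u by auto
      moreover from this have "t' \<le> v" using t' u by auto
      ultimately have "u = v" using u by auto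
      then show False using \<open>k v = d\<close> \<open>\<not> k u \<le> d\<close> by simp
    qed
    have "compact ({s..t'} \<inter> k -` {c})"
      unfolding compact_eq_bounded_closed using kt'
      by (auto intro: continuous_closed_preimage bounded_subset[OF bounded_closed_interval])
    moreover have "{s..t'} \<inter> k -` {c} \<noteq> {}"
      using IVT'[of k s c t'] k t' kt' by auto
    ultimately obtain s' where s': "s' \<in> {s..t'}" "k s' = c" "\<And>u. u \<in> {s..t'} \<Longrightarrow> k u = c \<Longrightarrow> u \<le> s'"
      using compact_attains_sup[of "{s..t'} \<inter> k -` {c}"] by (metis IntI Int_iff singletonD vimage_eq singletonI)
    have ge: "c \<le> k u" if u: "u \<in> {s'..t'}" for u
    proof (rule ccontr)
      assume "\<not> c \<le> k u"
      moreover have "continuous_on {u..t'} k" using kt' u s' by (auto intro: continuous_on_subset)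
      ultimately obtain v where "u \<le> v" "v \<le> t'" "k v = c"
        using IVT'[of k u c t'] k u t' by auto
      moreover from this have "v \<le> s'" using s' u by auto
      ultimately have "u = v" using u by auto
      then show False using \<open>k v = c\<close> \<open>\<not> c \<le> k u\<close> by simp
    qed
    show ?thesis using s' t' le ge by (intro exI[of _ s'] exI[of _ t']) auto
  qed
  show thesis
    using ends
  proof
    assume "h s \<le> c \<and> d \<le> h t"
    then show thesis using up[of h c d] h cd that by blast
  next
    assume "d \<le> h s \<and> h t \<le> c"
    then obtain s' t' where "s \<le> s' \<and> s' \<le> t' \<and> t' \<le> t \<and> - h s' = - d \<and> - h t' = - c"
        "\<forall>u\<in>{s'..t'}. - d \<le> - h u \<and> - h u \<le> - c"
      using up[of "\<lambda>u. - h u" "- d" "- c"] h cd by (auto intro: continuous_on_minus)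
    then show thesis by (intro that[of s' t']) auto
  qed
qed

lemma continuous_map_funpow:
  assumes "continuous_map X X G"
  shows "continuous_map X X (G ^^ i)"
  by (induction i) (auto simp: o_def intro: continuous_map_compose[OF _ assms, unfolded o_def])

text \<open>The height \<open>p\<close> measures the single expanding direction. The band between the heights \<open>a\<close> and \<open>b\<close> in the open
  set \<open>W\<close> lies in \<open>Q\<close>, so a path in \<open>W\<close> that crosses the band runs through \<open>Q\<close> while it does so. The image
  of \<open>Q\<close> is folded at the level \<open>m\<close>.\<close>

locale horseshoe =
  fixes X :: "'a topology" and G :: "'a \<Rightarrow> 'a" and Q W :: "'a set"
    and p :: "'a \<Rightarrow> real" and a m b :: real
  assumes closed_Q: "closedin X Q"
    and open_W: "openin X W"
    and height: "continuous_map X euclideanreal p"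
    and levels: "a < m" "m < b"
    and Q_between: "x \<in> Q \<Longrightarrow> a \<le> p x \<and> p x \<le> b"
    and band: "x \<in> W \<Longrightarrow> a \<le> p x \<Longrightarrow> p x \<le> b \<Longrightarrow> x \<in> Q"
    and into_W: "x \<in> Q \<Longrightarrow> G x \<in> W"
    and at_bottom: "x \<in> Q \<Longrightarrow> p x = a \<Longrightarrow> p (G x) < a"
    and at_middle: "x \<in> Q \<Longrightarrow> p x = m \<Longrightarrow> b < p (G x)"
    and at_top: "x \<in> Q \<Longrightarrow> p x = b \<Longrightarrow> p (G x) < a"
    and crossing: "\<exists>\<gamma>. continuous_map (top_of_set {0..1::real}) X \<gamma> \<and> \<gamma> ` {0..1} \<subseteq> Q \<and>
                       p (\<gamma> 0) = a \<and> p (\<gamma> 1) = b"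
begin

text \<open>The two halves of \<open>Q\<close>, restricted to points with image in \<open>Q\<close>. This restriction separates them: the
  image of the common level \<open>m\<close> lies above the band.\<close>

definition strip :: "bool \<Rightarrow> 'a set" where
  "strip \<sigma> = {x \<in> Q. G x \<in> Q \<and> (if \<sigma> then m \<le> p x else p x \<le> m)}"

lemma strip_disjoint: "strip True \<inter> strip False = {}"
  using at_middle Q_between by (fastforce simp: strip_def)

lemma closedin_strip:
  assumes "continuous_map X X G"
  shows "closedin X (strip \<sigma>)"
proof -
  have QX: "Q \<subseteq> topspace X" using closed_Q closedin_subset by blast
  have "closedin X {x \<in> topspace X. p x \<in> (if \<sigma> then {m..} else {..m})}"
    using height by (rule closedin_continuous_map_preimage) auto
  moreover have "closedin X {x \<in> topspace X. G x \<in> Q}"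
    using assms closed_Q by (rule closedin_continuous_map_preimage)
  ultimately have "closedin X (Q \<inter> {x \<in> topspace X. G x \<in> Q} \<inter> {x \<in> topspace X. p x \<in> (if \<sigma> then {m..} else {..m})})"
    using closed_Q by blast
  moreover have "\<dots> = strip \<sigma>"
    using QX by (auto simp: strip_def)
  ultimately show ?thesis by simp
qed

text \<open>Along a path across the band the height of the image takes a value beyond one end of
  the band at the middle level and values beyond the other end at the two outer levels.
  So on either side of the middle level some piece of the path has an image that crosses the band.\<close>

lemma crossing_step:
  fixes s t :: real
  assumes G: "continuous_map X X G"
    and st: "s \<le> t"
    and \<gamma>: "continuous_map (top_of_set {s..t}) X \<gamma>" "\<gamma> ` {s..t} \<subseteq> Q"
    and ends: "p (\<gamma> s) = a \<and> p (\<gamma> t) = b \<or> p (\<gamma> s) = b \<and> p (\<gamma> t) = a"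
  obtains s' t' where "s \<le> s'" "s' \<le> t'" "t' \<le> t" "\<gamma> ` {s'..t'} \<subseteq> strip \<sigma>"
    "p (G (\<gamma> s')) = a \<and> p (G (\<gamma> t')) = b \<or> p (G (\<gamma> s')) = b \<and> p (G (\<gamma> t')) = a"
proof -
  have c1: "continuous_on {s..t} (\<lambda>u. p (\<gamma> u))"
    using continuous_map_compose[OF \<gamma>(1) height] by (simp add: o_def)
  have c2: "continuous_on {s..t} (\<lambda>u. p (G (\<gamma> u)))"
    using continuous_map_compose[OF continuous_map_compose[OF \<gamma>(1) G] height] by (simp add: o_def)
  define c d where "c = (if \<sigma> then m else a)" and "d = (if \<sigma> then b else m)"
  have "c \<le> d" "p (\<gamma> s) \<le> c \<and> d \<le> p (\<gamma> t) \<or> d \<le> p (\<gamma> s) \<and> p (\<gamma> t) \<le> c"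
    using levels ends by (auto simp: c_def d_def)
  from crossing_subinterval[of s t "\<lambda>u. p (\<gamma> u)" c d, OF c1 st this]
  obtain s1 t1 where 1: "s \<le> s1" "s1 \<le> t1" "t1 \<le> t"
      "p (\<gamma> s1) = c \<and> p (\<gamma> t1) = d \<or> p (\<gamma> s1) = d \<and> p (\<gamma> t1) = c"
      "\<And>u. u \<in> {s1..t1} \<Longrightarrow> c \<le> p (\<gamma> u) \<and> p (\<gamma> u) \<le> d"
    by metis
  have Q1: "\<gamma> u \<in> Q" if "u \<in> {s1..t1}" for u using that 1 \<gamma>(2) by auto
  have "p (G (\<gamma> s1)) \<le> a \<and> b \<le> p (G (\<gamma> t1)) \<or> b \<le> p (G (\<gamma> s1)) \<and> p (G (\<gamma> t1)) \<le> a"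
    using 1(2,4) Q1[of s1] Q1[of t1] at_bottom[of "\<gamma> s1"] at_bottom[of "\<gamma> t1"] at_middle[of "\<gamma> s1"]
      at_middle[of "\<gamma> t1"] at_top[of "\<gamma> s1"] at_top[of "\<gamma> t1"]
    by (auto simp: c_def d_def less_imp_le split: if_splits)
  moreover have "continuous_on {s1..t1} (\<lambda>u. p (G (\<gamma> u)))" "a \<le> b"
    using c2 1 levels by (auto intro: continuous_on_subset)
  ultimately obtain s' t' where 2: "s1 \<le> s'" "s' \<le> t'" "t' \<le> t1"
      "p (G (\<gamma> s')) = a \<and> p (G (\<gamma> t')) = b \<or> p (G (\<gamma> s')) = b \<and> p (G (\<gamma> t')) = a"
      "\<And>u. u \<in> {s'..t'} \<Longrightarrow> a \<le> p (G (\<gamma> u)) \<and> p (G (\<gamma> u)) \<le> b"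
    using crossing_subinterval[of s1 t1 "\<lambda>u. p (G (\<gamma> u))" a b] 1(2) by metis
  have "\<gamma> u \<in> strip \<sigma>" if u: "u \<in> {s'..t'}" for u
  proof -
    have "u \<in> {s1..t1}" using u 2 by auto
    then have "G (\<gamma> u) \<in> Q" using Q1 into_W band 2(5)[OF u] by blast
    then show ?thesis
      using Q1 1(5) \<open>u \<in> {s1..t1}\<close> by (auto simp: strip_def c_def d_def split: if_splits)
  qed
  then have "\<gamma> ` {s'..t'} \<subseteq> strip \<sigma>" by blast
  moreover have "s \<le> s'" "t' \<le> t" using 1 2 by auto
  ultimately show thesis using 2(2,4) that[of s' t'] by blast
qed

lemma finite_itinerary:
  assumes G: "continuous_map X X G"
  shows "\<exists>x\<in>topspace X. \<forall>i<N. (G ^^ i) x \<in> strip (\<omega> i)"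
proof -
  obtain \<gamma> where \<gamma>: "continuous_map (top_of_set {0..1::real}) X \<gamma>" "\<gamma> ` {0..1} \<subseteq> Q"
      "p (\<gamma> 0) = a" "p (\<gamma> 1) = b"
    using crossing by blast
  have Gi: "continuous_map X X (G ^^ i)" for i
    using G by (rule continuous_map_funpow)
  have "\<exists>s t. 0 \<le> s \<and> s \<le> t \<and> t \<le> 1 \<and> (\<forall>u\<in>{s..t}. \<forall>i<N. (G ^^ i) (\<gamma> u) \<in> strip (\<omega> i)) \<and>
      (\<forall>u\<in>{s..t}. (G ^^ N) (\<gamma> u) \<in> Q) \<and>
      (p ((G ^^ N) (\<gamma> s)) = a \<and> p ((G ^^ N) (\<gamma> t)) = b \<or> p ((G ^^ N) (\<gamma> s)) = b \<and> p ((G ^^ N) (\<gamma> t)) = a)"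
  proof (induction N)
    case 0
    show ?case using \<gamma> by (intro exI[of _ 0] exI[of _ 1]) auto
  next
    case (Suc N)
    then obtain s t where st: "0 \<le> s" "s \<le> t" "t \<le> 1" "\<And>u i. u \<in> {s..t} \<Longrightarrow> i < N \<Longrightarrow> (G ^^ i) (\<gamma> u) \<in> strip (\<omega> i)"
        "\<And>u. u \<in> {s..t} \<Longrightarrow> (G ^^ N) (\<gamma> u) \<in> Q"
        "p ((G ^^ N) (\<gamma> s)) = a \<and> p ((G ^^ N) (\<gamma> t)) = b \<or> p ((G ^^ N) (\<gamma> s)) = b \<and> p ((G ^^ N) (\<gamma> t)) = a"
      by blast
    let ?\<gamma> = "\<lambda>u. (G ^^ N) (\<gamma> u)"
    have "continuous_map (top_of_set {s..t}) X \<gamma>"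
      using st continuous_map_from_subtopology_mono[OF \<gamma>(1), of "{s..t}"] by auto
    then have "continuous_map (top_of_set {s..t}) X ?\<gamma>"
      using continuous_map_compose[OF _ Gi] by (fastforce simp: o_def)
    moreover have "?\<gamma> ` {s..t} \<subseteq> Q" using st(5) by auto
    ultimately obtain s' t' where "s \<le> s'" "s' \<le> t'" "t' \<le> t" "?\<gamma> ` {s'..t'} \<subseteq> strip (\<omega> N)"
      "p (G (?\<gamma> s')) = a \<and> p (G (?\<gamma> t')) = b \<or> p (G (?\<gamma> s')) = b \<and> p (G (?\<gamma> t')) = a"
      using crossing_step[OF G st(2) _ _ st(6), of "\<omega> N"] by blast
    then show ?case
      using st by (intro exI[of _ s'] exI[of _ t'])
        (auto simp: less_Suc_eq strip_def image_subset_iff)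
  qed
  then obtain s where "0 \<le> s" "s \<le> 1" "\<forall>i<N. (G ^^ i) (\<gamma> s) \<in> strip (\<omega> i)"
    by (meson atLeastAtMost_iff order.refl order.trans)
  moreover have "\<gamma> s \<in> topspace X"
    using \<gamma>(1) \<open>0 \<le> s\<close> \<open>s \<le> 1\<close> by (auto simp: continuous_map_def)
  ultimately show ?thesis by blast
qed

lemma itinerary_exists:
  assumes G: "continuous_map X X G" and cpt: "compact_space X"
  shows "\<exists>x\<in>topspace X. \<forall>i. (G ^^ i) x \<in> strip (\<omega> i)"
proof -
  define C where "C N = {x \<in> topspace X. \<forall>i<N. (G ^^ i) x \<in> strip (\<omega> i)}" for N
  have Gi: "continuous_map X X (G ^^ i)" for i
    using G by (rule continuous_map_funpow)
  have "closedin X (C N)" for N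
  proof -
    have "C N = topspace X \<inter> (\<Inter>i\<in>{..<N}. {x \<in> topspace X. (G ^^ i) x \<in> strip (\<omega> i)})"
      by (auto simp: C_def)
    moreover have "closedin X {x \<in> topspace X. (G ^^ i) x \<in> strip (\<omega> i)}" for i
      using Gi closedin_strip[OF G] by (rule closedin_continuous_map_preimage)
    ultimately show ?thesis
      by (cases "N = 0") (auto intro!: closedin_Int closedin_Inter)
  qed
  moreover have "C N \<noteq> {}" for N using finite_itinerary[OF G, of N \<omega>] by (auto simp: C_def)
  moreover have "decseq C" by (auto simp: decseq_def C_def)
  ultimately obtain x where "x \<in> (\<Inter>N. C N)"
    using compact_space_imp_nest[OF cpt, of C] by blast
  then have "x \<in> C (Suc i)" for i by blast
  then show ?thesis by (auto simp: C_def intro!: bexI[of _ x])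
qed

end

section \<open>The suspension space as a quotient of a product\<close>

locale suspension =
  fixes X :: "'a topology" and f :: "'a \<Rightarrow> 'a" and r :: "'a \<Rightarrow> real"
  assumes compact_X: "compact_space X"
    and homeo: "f \<in> Homeo X"
    and roof: "roof_function X r"
begin

abbreviation M where "M \<equiv> topspace X"
abbreviation it where "it \<equiv> int_iter X f"
abbreviation S where "S \<equiv> roof_sum X f r"
abbreviation Y where "Y \<equiv> susp_space X f r"
abbreviation cl where "cl \<equiv> susp_class X f r"
abbreviation \<phi> where "\<phi> \<equiv> susp_flow X f r"
abbreviation RX where "RX \<equiv> prod_topology euclideanreal X"

lemma it_in [simp]: "x \<in> M \<Longrightarrow> it n x \<in> M"
  by (rule int_iter_in[OF homeo])

lemma it_0 [simp]: "it 0 x = x" by (simp add: int_iter_def)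

lemma S_0 [simp]: "S 0 x = 0" by (simp add: roof_sum_def)

lemma it_nat: "it (int n) x = (f ^^ n) x" by (simp add: int_iter_def)

lemma it_add:
  assumes "x \<in> M"
  shows "it m (it n x) = it (m + n) x"
proof (induction m rule: int_induct[where k=0])
  case (step1 i)
  then show ?case
    using int_iter_succ[OF homeo, of "it n x" i] int_iter_succ[OF homeo, of x "i + n"] assms
    by (simp add: algebra_simps)
next
  case (step2 i)
  have inj: "inj_on f M"
    using homeo by (auto simp: Homeo_def homeomorphic_eq_everything_map)
  have "f (it (i - 1) (it n x)) = f (it (i - 1 + n) x)"
    using step2 int_iter_succ[OF homeo, of "it n x" "i - 1"]
      int_iter_succ[OF homeo, of x "i - 1 + n"] assms
    by (simp add: algebra_simps)
  then show ?case using inj assms by (auto dest: inj_onD)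
qed simp

lemma S_add:
  assumes "x \<in> M"
  shows "S m (it n x) = S (m + n) x - S n x"
proof (induction m rule: int_induct[where k=0])
  case (step1 i)
  then show ?case
    using roof_sum_succ[of X f r i "it n x"] roof_sum_succ[of X f r "i + n" x] it_add[OF assms, of i n]
    by (simp add: algebra_simps)
next
  case (step2 i)
  then show ?case
    using roof_sum_succ[of X f r "i - 1" "it n x"] roof_sum_succ[of X f r "i - 1 + n" x]
      it_add[OF assms, of "i - 1" n]
    by (simp add: algebra_simps)
qed simp

lemma r_cont: "continuous_map X euclideanreal r" and r_pos: "x \<in> M \<Longrightarrow> 0 < r x"
  using roof by (auto simp: roof_function_def)

lemma r_bounds:
  obtains c C where "0 < c" "\<And>x. x \<in> M \<Longrightarrow> c \<le> r x" "\<And>x. x \<in> M \<Longrightarrow> r x \<le> C"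
proof (cases "M = {}")
  case False
  have "compact (r ` M)"
    using image_compactin[of X M euclideanreal r] compact_X r_cont
    by (simp add: compact_space_def)
  moreover have "r ` M \<noteq> {}" using False by simp
  ultimately obtain y z where "y \<in> r ` M" "\<And>u. u \<in> r ` M \<Longrightarrow> y \<le> u" "\<And>u. u \<in> r ` M \<Longrightarrow> u \<le> z"
    using compact_attains_inf[of "r ` M"] compact_attains_sup[of "r ` M"] by blast
  then show ?thesis using r_pos by (intro that[of y z]) auto
qed (use that[of 1 1] in auto)

lemma S_growth:
  assumes c: "\<And>x. x \<in> M \<Longrightarrow> c \<le> r x" and x: "x \<in> M" and mn: "m \<le> n"
  shows "S m x + of_int (n - m) * c \<le> S n x"
  using mn
proof (induction n rule: int_ge_induct)
  case (step i)
  then show ?case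
    using c[OF it_in[OF x, of i]] roof_sum_succ[of X f r i x] by (simp add: algebra_simps)
qed simp

lemma S_mono: "x \<in> M \<Longrightarrow> m \<le> n \<Longrightarrow> S m x \<le> S n x"
  using S_growth[of 0 x m n] r_pos by (simp add: less_imp_le)

lemma S_bracket:
  assumes x: "x \<in> M"
  obtains n where "S n x \<le> u" "u < S (n + 1) x"
proof -
  obtain c C where c: "0 < c" "\<And>x. x \<in> M \<Longrightarrow> c \<le> r x" "\<And>x. x \<in> M \<Longrightarrow> r x \<le> C"
    by (fact r_bounds)
  define N where "N = \<lceil>\<bar>u\<bar> / c\<rceil> + 1"
  have "\<bar>u\<bar> / c < of_int N" unfolding N_def by linarith
  then have N: "\<bar>u\<bar> < of_int N * c" using c(1) by (simp add: field_simps)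
  then have N0: "0 < N" using c(1) by (smt (verit) mult_nonpos_nonneg of_int_le_0_iff)
  have hi: "u < S N x" using S_growth[of c x 0 N] c(2) N0 N x by simp
  have lo: "S (- N) x \<le> u" using S_growth[of c x "- N" 0] c(2) N0 N x by simp
  define k where "k = (LEAST k. u < S (- N + int k) x)"
  have ku: "u < S (- N + int (nat (2 * N))) x" using hi N0 by simp
  have k: "u < S (- N + int k) x" unfolding k_def by (rule LeastI, rule ku)
  have "k \<noteq> 0" using k lo by (intro notI) simp
  then obtain j where j: "k = Suc j" by (cases k) auto
  have "\<not> u < S (- N + int j) x"
    by (rule not_less_Least) (use j in \<open>simp add: k_def\<close>)
  then show ?thesis using k j by (intro that[of "- N + int j"]) (simp_all add: algebra_simps)
qed

lemma cont_it: "continuous_map X X (it n)"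
proof -
  have f: "continuous_map X X f" and inj: "inj_on f M" and im: "f ` M = M"
    using homeo by (auto simp: Homeo_def homeomorphic_eq_everything_map)
  obtain g where g: "homeomorphic_maps X X f g"
    using homeo by (auto simp: Homeo_def homeomorphic_map_maps)
  have "g y = inv_into M f y" if "y \<in> M" for y
  proof -
    have "g y \<in> M" "f (g y) = y"
      using g that by (auto simp: homeomorphic_maps_def continuous_map_def)
    then show ?thesis using inj by (metis inv_into_f_f)
  qed
  moreover have "continuous_map X X g" using g by (simp add: homeomorphic_maps_def)
  ultimately have "continuous_map X X (inv_into M f)"
    using continuous_map_eq by blast
  then have "continuous_map X X ((f ^^ k))" "continuous_map X X ((inv_into M f) ^^ k)" for k
    using f by (induction k) (auto simp: o_def intro: continuous_map_compose[unfolded o_def])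
  then show ?thesis unfolding int_iter_def by auto
qed

lemma cont_S: "continuous_map X euclideanreal (S n)"
proof (induction n rule: int_induct[where k=0])
  case base
  then show ?case by (simp add: roof_sum_def)
next
  have ri: "continuous_map X euclideanreal (\<lambda>x. r (it i x))" for i
    using continuous_map_compose[OF cont_it r_cont] by (simp add: o_def)
  {
    case (step1 i)
    then show ?case using ri by (simp add: roof_sum_succ continuous_map_add)
  next
    case (step2 i)
    have "S (i - 1) = (\<lambda>x. S i x - r (it (i - 1) x))"
      using roof_sum_succ[of X f r "i - 1"] by (auto simp: fun_eq_iff)
    then show ?case using ri step2 by (simp add: continuous_map_diff)
  }
qed

text \<open>The point that the flow reaches at time \<open>u\<close> from \<open>[(0,x)]\<close>. The suspension space is
  the quotient of \<open>\<real> \<times> M\<close> by the free action \<open>(u,x) \<mapsto> (u - S n x, f\<^sup>n x)\<close> of the integers,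
  the flow being translation in the first coordinate, and this is the quotient map.\<close>

definition P :: "real \<Rightarrow> 'a \<Rightarrow> (real \<times> 'a) set" where
  "P u x = \<phi> u (cl (0, x))"

lemma under_roof_iff: "(t, x) \<in> under_roof X r \<longleftrightarrow> x \<in> M \<and> 0 \<le> t \<and> t \<le> r x"
  by (simp add: under_roof_def)

lemma susp_flow_eq:
  assumes "(s, x) \<in> under_roof X r" "0 \<le> t + s - S n x" "t + s - S n x \<le> r (it n x)"
  shows "\<phi> t (cl (s, x)) = cl (t + s - S n x, it n x)"
proof -
  have z: "cl (s, x) \<in> topspace Y" using assms(1) by (auto simp: topspace_susp_space)
  show ?thesis
    unfolding susp_flow_def
    by (rule the1_equality[OF susp_flow_ex1[OF compact_X homeo roof z]])
      (use assms in \<open>intro exI[of _ s] exI[of _ x] exI[of _ n] exI[of _ "t + s - S n x"], auto\<close>)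
qed

lemma P_eq:
  assumes "x \<in> M" "0 \<le> u - S n x" "u - S n x \<le> r (it n x)"
  shows "P u x = cl (u - S n x, it n x)"
  unfolding P_def using susp_flow_eq[of 0 x u n] assms r_pos[OF assms(1)] by (simp add: under_roof_iff)

lemma P_cl: "(s, x) \<in> under_roof X r \<Longrightarrow> P s x = cl (s, x)"
  using P_eq[of x s 0] by (simp add: under_roof_iff)

lemma P_bracket:
  assumes "x \<in> M"
  obtains n where "0 \<le> u - S n x" "u - S n x < r (it n x)"
    "P u x = cl (u - S n x, it n x)" "(u - S n x, it n x) \<in> under_roof X r"
proof -
  obtain n where n: "S n x \<le> u" "u < S (n + 1) x" by (rule S_bracket[OF assms])
  then show thesis
    using assms by (intro that[of n] P_eq) (auto simp: under_roof_iff roof_sum_succ)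
qed

lemma P_flow:
  assumes x: "x \<in> M"
  shows "\<phi> t (P u x) = P (u + t) x"
proof -
  obtain n where n: "P u x = cl (u - S n x, it n x)" "(u - S n x, it n x) \<in> under_roof X r"
    by (rule P_bracket[OF x])
  obtain k where k: "0 \<le> u + t - S k x" "u + t - S k x < r (it k x)"
    "P (u + t) x = cl (u + t - S k x, it k x)"
    by (rule P_bracket[OF x])
  have e: "it (k - n) (it n x) = it k x" "S (k - n) (it n x) = S k x - S n x"
    using it_add[OF x, of "k - n" n] S_add[OF x, of "k - n" n] by simp_all
  have "\<phi> t (cl (u - S n x, it n x)) = cl (t + (u - S n x) - S (k - n) (it n x), it (k - n) (it n x))"
    using k n by (intro susp_flow_eq) (simp_all add: e)
  also have "t + (u - S n x) - S (k - n) (it n x) = u + t - S k x" by (simp add: e)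
  finally show ?thesis using n k e by simp
qed

lemma P_deck:
  assumes x: "x \<in> M"
  shows "P (u - S n x) (it n x) = P u x"
proof -
  obtain k where k: "0 \<le> u - S k x" "u - S k x < r (it k x)" "P u x = cl (u - S k x, it k x)"
    by (rule P_bracket[OF x])
  have e: "it (k - n) (it n x) = it k x" "S (k - n) (it n x) = S k x - S n x"
    using it_add[OF x, of "k - n" n] S_add[OF x, of "k - n" n] by simp_all
  show ?thesis
    using P_eq[of "it n x" "u - S n x" "k - n"] k x by (simp add: e)
qed

lemma glue_deck:
  assumes "(p, q) \<in> rtrancl (susp_glue X f r \<union> converse (susp_glue X f r))" "snd p \<in> M"
  shows "\<exists>n. q = (fst p - S n (snd p), it n (snd p))"
  using assms(1)
proof (induction rule: rtrancl_induct)
  case base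
  then show ?case by (intro exI[of _ 0]) simp
next
  case (step y z)
  then obtain n where n: "y = (fst p - S n (snd p), it n (snd p))" by blast
  have "\<exists>k. z = (fst y - S k (snd y), it k (snd y))"
    using step(2)
  proof
    assume "(y, z) \<in> susp_glue X f r"
    then obtain x where "y = (r x, x)" "z = (0, f x)" "x \<in> M" by (auto simp: susp_glue_def)
    then show ?thesis
      using roof_sum_succ[of X f r 0 x] int_iter_succ[OF homeo, of x 0] by (intro exI[of _ 1]) simp
  next
    assume "(y, z) \<in> converse (susp_glue X f r)"
    then obtain x where "z = (r x, x)" "y = (0, f x)" "x \<in> M" by (auto simp: susp_glue_def)
    then show ?thesis
      using roof_sum_succ[of X f r 0 x] int_iter_succ[OF homeo, of x 0]
        it_add[of x "-1" 1] S_add[of x "-1" 1]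
      by (intro exI[of _ "-1"]) simp
  qed
  then obtain k where "z = (fst y - S k (snd y), it k (snd y))" by blast
  then show ?case
    using n it_add[OF assms(2), of k n] S_add[OF assms(2), of k n]
    by (intro exI[of _ "k + n"]) (simp add: algebra_simps)
qed

lemma P_eqD:
  assumes eq: "P u x = P u' x'" and x: "x \<in> M" and x': "x' \<in> M"
  obtains n where "x' = it n x" "u' = u - S n x"
proof -
  obtain k where k: "P u x = cl (u - S k x, it k x)" "(u - S k x, it k x) \<in> under_roof X r"
    by (rule P_bracket[OF x])
  obtain k' where k': "P u' x' = cl (u' - S k' x', it k' x')" "(u' - S k' x', it k' x') \<in> under_roof X r"
    by (rule P_bracket[OF x'])
  have "((u - S k x, it k x), (u' - S k' x', it k' x')) \<in> susp_rel X f r"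
    using eq k k' by (intro eq_equiv_class[OF _ equiv_susp_rel]) (simp_all add: susp_class_def)
  then obtain j where j: "it k' x' = it j (it k x)" "u' - S k' x' = u - S k x - S j (it k x)"
    using glue_deck[of "(u - S k x, it k x)" "(u' - S k' x', it k' x')"] x
    by (auto simp: susp_rel_def)
  have "x' = it (- k') (it k' x')" using it_add[OF x', of "- k'" k'] by simp
  also have "\<dots> = it (- k' + j + k) x" using j x it_add by (simp add: algebra_simps)
  finally have 1: "x' = it (- k' + j + k) x" .
  have "S k' x' = S (j + k) x - S (- k' + j + k) x"
    unfolding 1 using S_add[OF x, of k' "- k' + j + k"] by (simp add: algebra_simps)
  then have "u' = u - S (- k' + j + k) x"
    using j S_add[OF x, of j k] by simp
  with 1 show thesis by (rule that)
qed

lemma P_in: "x \<in> M \<Longrightarrow> P u x \<in> topspace Y"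
  using P_bracket[of x u] by (metis image_eqI topspace_susp_space)

lemma topspace_Y: 
  assumes "z \<in> topspace Y"
  obtains s x where "x \<in> M" "0 \<le> s" "s \<le> r x" "z = P s x"
  using assms P_cl by (auto simp: topspace_susp_space under_roof_def)

lemma cont_deck: "continuous_map RX RX (\<lambda>q. (fst q - S n (snd q), it n (snd q)))"
proof -
  have "continuous_map RX euclideanreal (\<lambda>q. S n (snd q))"
    using continuous_map_compose[OF continuous_map_snd cont_S] by (simp add: o_def)
  moreover have "continuous_map RX X (\<lambda>q. it n (snd q))"
    using continuous_map_compose[OF continuous_map_snd cont_it] by (simp add: o_def)
  ultimately show ?thesis
    by (intro continuous_map_pairedI continuous_map_diff continuous_map_fst)
qed

lemma openin_Y:
  "openin Y U \<longleftrightarrow> U \<subseteq> cl ` under_roof X r \<and>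
     openin (subtopology RX (under_roof X r)) {q \<in> under_roof X r. cl q \<in> U}"
proof -
  have "topspace (subtopology RX (under_roof X r)) = under_roof X r"
    by (auto simp: under_roof_def)
  then show ?thesis unfolding susp_space_def openin_quotient_topology by simp
qed

lemma cont_cl: "continuous_map (subtopology RX (under_roof X r)) Y cl"
  unfolding susp_space_def by (rule quotient_imp_continuous_map[OF quotient_map_quotient_topology])

lemma P_cont: "continuous_map RX Y (\<lambda>q. P (fst q) (snd q))"
proof -
  define T where "T n = {q \<in> topspace RX. fst q - S n (snd q) \<in> {0..} \<and> fst q - S (n + 1) (snd q) \<in> {..0}}" for n
  let ?d = "\<lambda>n q. (fst q - S n (snd q), it n (snd q))"
  have cd: "continuous_map RX euclideanreal (\<lambda>q. fst q - S n (snd q))" for n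
    using continuous_map_compose[OF cont_deck continuous_map_fst] by (simp add: o_def)
  have T: "?d n q \<in> under_roof X r" "P (fst q) (snd q) = cl (?d n q)" if "q \<in> T n" for n q
    using that P_eq[of "snd q" "fst q" n] by (auto simp: T_def under_roof_def roof_sum_succ)
  obtain c C where c: "0 < c" "\<And>x. x \<in> M \<Longrightarrow> c \<le> r x" "\<And>x. x \<in> M \<Longrightarrow> r x \<le> C"
    by (fact r_bounds)
  have N_of: "0 \<le> N" if N: "\<bar>fst q\<bar> + 1 \<le> of_int N * c" for q :: "real \<times> 'a" and N :: int
  proof -
    have "0 < of_int N * c" using N by linarith
    then show ?thesis using c(1) by (simp add: zero_less_mult_iff)
  qed
  \<comment> \<open>On each of the closed sets \<open>T n\<close>, which are locally finite because the roof is bounded below by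
    \<open>c\<close>, the map is given by one formula.\<close>
  show ?thesis
  proof (rule pasting_lemma_locally_finite[where I=UNIV and T=T and f="\<lambda>n q. cl (?d n q)"])
    fix q assume q: "q \<in> topspace RX"
    let ?V = "{fst q - 1<..<fst q + 1} \<times> M"
    define N where "N = \<lceil>(\<bar>fst q\<bar> + 1) / c\<rceil>"
    have N: "\<bar>fst q\<bar> + 1 \<le> of_int N * c"
      using c(1) le_of_int_ceiling[of "(\<bar>fst q\<bar> + 1) / c"] unfolding N_def
      by (simp only: pos_divide_le_eq)
    have "n \<in> {- N - 1..N}" if qq: "q' \<in> T n \<inter> ?V" for n q'
    proof -
      let ?x = "snd q'"
      have x: "?x \<in> M" "S n ?x \<le> \<bar>fst q\<bar> + 1" "- (\<bar>fst q\<bar> + 1) \<le> S (n + 1) ?x"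
        using qq by (auto simp: T_def)
      have "n \<le> N"
      proof (rule ccontr)
        assume "\<not> n \<le> N"
        then have "N + 1 \<le> n" "0 \<le> N" using N_of[OF N] by auto
        then have "0 \<le> n" by simp
        then have "of_int n * c \<le> S n ?x" using S_growth[of c ?x 0 n] c(2) x by simp
        moreover have "(of_int N + 1) * c \<le> of_int n * c"
          using \<open>N + 1 \<le> n\<close> c(1) by (intro mult_right_mono) linarith+
        ultimately show False using x N c(1) by (simp add: algebra_simps)
      qed
      moreover have "- N - 1 \<le> n"
      proof (rule ccontr)
        assume "\<not> - N - 1 \<le> n"
        then have "n + 1 \<le> - N - 1" "0 \<le> N" using N_of[OF N] by auto
        then have "n + 1 \<le> 0" by simp
        then have "of_int (- (n + 1)) * c \<le> - S (n + 1) ?x" using S_growth[of c ?x "n + 1" 0] c(2) x by simp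
        moreover have "(of_int N + 1) * c \<le> of_int (- (n + 1)) * c"
          using \<open>n + 1 \<le> - N - 1\<close> c(1) by (intro mult_right_mono) linarith+
        ultimately show False using x N c(1) by (simp add: algebra_simps)
      qed
      ultimately show ?thesis by simp
    qed
    then have "{n \<in> UNIV. T n \<inter> ?V \<noteq> {}} \<subseteq> {- N - 1..N}" by blast
    then have "finite {n \<in> UNIV. T n \<inter> ?V \<noteq> {}}" by (rule finite_subset) simp
    moreover have "openin RX ?V" by (simp add: openin_prod_Times_iff)
    moreover have "q \<in> ?V" using q by (auto simp: mem_Times_iff)
    ultimately show "\<exists>V. openin RX V \<and> q \<in> V \<and> finite {n \<in> UNIV. T n \<inter> V \<noteq> {}}" by blast
  next
    fix n
    have "T n = {q \<in> topspace RX. fst q - S n (snd q) \<in> {0..}} \<inter> {q \<in> topspace RX. fst q - S (n + 1) (snd q) \<in> {..0}}"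
      by (auto simp: T_def)
    moreover have "closedin RX {q \<in> topspace RX. fst q - S n (snd q) \<in> {0..}}"
      by (rule closedin_continuous_map_preimage[OF cd]) simp
    moreover have "closedin RX {q \<in> topspace RX. fst q - S (n + 1) (snd q) \<in> {..0}}"
      by (rule closedin_continuous_map_preimage[OF cd]) simp
    ultimately show "closedin RX (T n)" by auto
    have "continuous_map (subtopology RX (T n)) (subtopology RX (under_roof X r)) (?d n)"
      by (rule continuous_map_into_subtopology[OF continuous_map_from_subtopology[OF cont_deck]])
        (use T(1) in auto)
    from continuous_map_compose[OF this cont_cl]
    show "continuous_map (subtopology RX (T n)) Y (\<lambda>q. cl (?d n q))" by (simp add: o_def)
  next
    fix i j q assume "q \<in> topspace RX \<inter> T i \<inter> T j"
    then show "cl (?d i q) = cl (?d j q)" using T(2)[of q i] T(2)[of q j] by simp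
  next
    fix q assume q: "q \<in> topspace RX"
    then have "snd q \<in> M" by auto
    then obtain n where "S n (snd q) \<le> fst q" "fst q < S (n + 1) (snd q)"
      by (rule S_bracket)
    then have "q \<in> T n" using q by (auto simp: T_def)
    then show "\<exists>j. j \<in> UNIV \<and> q \<in> T j \<and> P (fst q) (snd q) = cl (?d j q)" using T(2) by blast
  qed
qed

text \<open>The preimage of the image of an open set in \<open>\<real> \<times> M\<close> is the union of its translates under the
  action.\<close>

lemma P_open:
  assumes U: "openin RX U"
  shows "openin Y ((\<lambda>q. P (fst q) (snd q)) ` U)"
proof -
  let ?d = "\<lambda>n q. (fst q - S n (snd q), it n (snd q))"
  let ?PU = "(\<lambda>q. P (fst q) (snd q)) ` U"
  have UR: "U \<subseteq> topspace RX" using U openin_subset by blast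
  have "{q \<in> under_roof X r. cl q \<in> ?PU} = under_roof X r \<inter> (\<Union>n. {q \<in> topspace RX. ?d n q \<in> U})"
  proof (intro equalityI subsetI)
    fix q assume q: "q \<in> {q \<in> under_roof X r. cl q \<in> ?PU}"
    then obtain v where v: "v \<in> U" "P (fst q) (snd q) = P (fst v) (snd v)"
      using P_cl[of "fst q" "snd q"] by auto
    moreover have "snd q \<in> M" "snd v \<in> M" using q v(1) UR by (auto simp: under_roof_def)
    ultimately obtain n where "snd v = it n (snd q)" "fst v = fst q - S n (snd q)"
      using P_eqD by metis
    then have "?d n q = v" by (simp add: prod_eq_iff)
    then show "q \<in> under_roof X r \<inter> (\<Union>n. {q \<in> topspace RX. ?d n q \<in> U})"
      using q v by (auto simp: under_roof_def intro!: exI[of _ n])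
  next
    fix q assume q: "q \<in> under_roof X r \<inter> (\<Union>n. {q \<in> topspace RX. ?d n q \<in> U})"
    then obtain n where "?d n q \<in> U" by blast
    then have "P (fst q - S n (snd q)) (it n (snd q)) \<in> ?PU" by force
    moreover have "snd q \<in> M" using q by (auto simp: under_roof_def)
    ultimately have "P (fst q) (snd q) \<in> ?PU" using P_deck by simp
    then show "q \<in> {q \<in> under_roof X r. cl q \<in> ?PU}"
      using q P_cl[of "fst q" "snd q"] by simp
  qed
  moreover have "openin RX {q \<in> topspace RX. ?d n q \<in> U}" for n
    by (rule openin_continuous_map_preimage[OF cont_deck U])
  then have "openin RX (\<Union>n. {q \<in> topspace RX. ?d n q \<in> U})"
    by blast
  moreover have "?PU \<subseteq> cl ` under_roof X r"
    using UR P_in by (auto simp: topspace_susp_space[symmetric])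
  ultimately show ?thesis
    unfolding openin_Y by (simp add: openin_subtopology_Int2)
qed

lemma compact_P_image:
  assumes "compactin X K"
  shows "compactin Y ((\<lambda>q. P (fst q) (snd q)) ` ({u..v} \<times> K))"
  using assms by (intro image_compactin[OF _ P_cont]) (simp add: compactin_Times)

lemma compact_Y: "compact_space Y"
proof -
  obtain c C where C: "0 < c" "\<And>x. x \<in> M \<Longrightarrow> c \<le> r x" "\<And>x. x \<in> M \<Longrightarrow> r x \<le> C"
    by (fact r_bounds)
  have "topspace Y = (\<lambda>q. P (fst q) (snd q)) ` ({0..C} \<times> M)"
  proof (intro equalityI subsetI)
    fix z assume "z \<in> topspace Y"
    then obtain s x where "x \<in> M" "0 \<le> s" "s \<le> r x" "z = P s x" by (rule topspace_Y)
    then show "z \<in> (\<lambda>q. P (fst q) (snd q)) ` ({0..C} \<times> M)"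
      using C(3)[of x] by (intro image_eqI[of _ _ "(s, x)"]) auto
  qed (auto intro: P_in)
  then show ?thesis
    using compact_P_image[of M 0 C] compact_X by (simp add: compact_space_def)
qed

end

section \<open>Time change of the suspension flow\<close>

lemma continuous_map_realI:
  fixes h :: "'a \<Rightarrow> real"
  assumes "\<And>x e. x \<in> topspace Z \<Longrightarrow> 0 < e \<Longrightarrow> \<exists>U. openin Z U \<and> x \<in> U \<and> (\<forall>y\<in>U. \<bar>h y - h x\<bar> < e)"
  shows "continuous_map Z euclideanreal h"
  unfolding continuous_map_def
proof (intro conjI allI impI)
  fix V :: "real set" assume V: "openin euclideanreal V"
  show "openin Z {x \<in> topspace Z. h x \<in> V}"
  proof (subst openin_subopen, clarify)
    fix x assume x: "x \<in> topspace Z" "h x \<in> V"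
    then obtain e where e: "e > 0" "\<And>t. \<bar>t - h x\<bar> < e \<Longrightarrow> t \<in> V"
      using V by (auto simp: open_dist dist_real_def)
    obtain U where "openin Z U" "x \<in> U" "\<forall>y\<in>U. \<bar>h y - h x\<bar> < e"
      using assms[OF x(1) e(1)] by blast
    then show "\<exists>T. openin Z T \<and> x \<in> T \<and> T \<subseteq> {x \<in> topspace Z. h x \<in> V}"
      using e(2) by (intro exI[of _ U]) (auto dest: openin_subset)
  qed
qed simp

text \<open>A time change of the suspension flow with a speed \<open>\<beta>\<close> between two positive constants. A brake satisfies this
  only after it has been cut off from below.\<close>

locale time_change = suspension +
  fixes \<beta> :: "(real \<times> 'a) set \<Rightarrow> real" and c A :: real
  assumes \<beta>_cont: "continuous_map (susp_space X f r) euclideanreal \<beta>"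
    and c_pos: "0 < c"
    and \<beta>_bounds: "z \<in> topspace (susp_space X f r) \<Longrightarrow> c \<le> \<beta> z \<and> \<beta> z \<le> A"
begin

definition g where "g u x = 1 / \<beta> (P u x)"

text \<open>The new clock along the flow line of \<open>x\<close>, with its zero at \<open>P 0 x\<close>.\<close>

definition \<Theta> where
  "\<Theta> u x = (if 0 \<le> u then integral {0..u} (\<lambda>v. g v x) else - integral {u..0} (\<lambda>v. g v x))"

lemma g_bounds:
  assumes "x \<in> M"
  shows "0 < A" "1 / A \<le> g u x" "g u x \<le> 1 / c" "0 < g u x"
proof -
  have "c \<le> \<beta> (P u x)" "\<beta> (P u x) \<le> A" using \<beta>_bounds[OF P_in[OF assms]] by auto
  then show "0 < A" "1 / A \<le> g u x" "g u x \<le> 1 / c" "0 < g u x"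
    using c_pos by (auto simp: g_def frac_le)
qed

lemma g_cont: "continuous_map RX euclideanreal (\<lambda>q. g (fst q) (snd q))"
proof -
  have "continuous_map RX euclideanreal (\<lambda>q. \<beta> (P (fst q) (snd q)))"
    using continuous_map_compose[OF P_cont \<beta>_cont] by (simp add: o_def)
  moreover have "\<beta> (P (fst q) (snd q)) \<noteq> 0" if "q \<in> topspace RX" for q
  proof -
    have "snd q \<in> M" using that by auto
    from \<beta>_bounds[OF P_in[OF this]] c_pos show ?thesis by (metis less_le_not_le)
  qed
  ultimately have "continuous_map RX euclideanreal (\<lambda>q. 1 / \<beta> (P (fst q) (snd q)))"
    by (intro continuous_map_real_divide) auto
  then show ?thesis by (simp add: g_def)
qed

lemma g_cont_time:
  assumes "x \<in> M"
  shows "continuous_on U (\<lambda>v. g v x)"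
proof -
  have "continuous_map euclideanreal RX (\<lambda>v. (v, x))"
    using assms by (intro continuous_map_pairedI) auto
  from continuous_map_compose[OF this g_cont] have "continuous_on UNIV (\<lambda>v. g v x)"
    by (simp add: o_def)
  then show ?thesis by (rule continuous_on_subset) simp
qed

lemma Theta_0 [simp]: "\<Theta> 0 x = 0" by (simp add: \<Theta>_def)

lemma Theta_deriv:
  assumes x: "x \<in> M"
  shows "((\<lambda>u. \<Theta> u x) has_real_derivative g u x) (at u)"
proof -
  define b where "b = \<bar>u\<bar> + 1"
  let ?F = "\<lambda>w. integral {- b..w} (\<lambda>v. g v x) - integral {- b..0} (\<lambda>v. g v x)"
  have int: "(\<lambda>v. g v x) integrable_on {s..t}" for s t
    by (rule integrable_continuous_real[OF g_cont_time[OF x]])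
  have "((\<lambda>w. integral {- b..w} (\<lambda>v. g v x)) has_real_derivative g u x) (at u within {- b..b})"
    by (rule integral_has_real_derivative[OF g_cont_time[OF x]]) (auto simp: b_def)
  then have "((\<lambda>w. integral {- b..w} (\<lambda>v. g v x)) has_real_derivative g u x) (at u)"
    by (subst (asm) at_within_interior) (auto simp: b_def interior_cbox[unfolded box_real])
  then have F: "(?F has_real_derivative g u x) (at u)"
    by (auto intro!: derivative_eq_intros)
  have b0: "- b \<le> 0" by (simp add: b_def)
  have "?F w = \<Theta> w x" if "w \<in> {- b<..<b}" for w
  proof (cases "0 \<le> w")
    case True
    then show ?thesis
      using Henstock_Kurzweil_Integration.integral_combine[OF b0 True int] by (simp add: \<Theta>_def)
  next
    case False
    then show ?thesis
      using Henstock_Kurzweil_Integration.integral_combine[OF _ _ int, of "- b" w 0] that by (simp add: \<Theta>_def)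
  qed
  then have "\<forall>\<^sub>F w in nhds u. ?F w = \<Theta> w x"
    by (intro eventually_nhds_in_open[of "{- b<..<b}", THEN eventually_mono]) (auto simp: b_def)
  from DERIV_cong_ev[OF refl this refl] show ?thesis using F by blast
qed

lemma Theta_mvt:
  assumes x: "x \<in> M" and uv: "u \<le> v"
  shows "(v - u) / A \<le> \<Theta> v x - \<Theta> u x" "\<Theta> v x - \<Theta> u x \<le> (v - u) / c"
proof -
  have "(v - u) / A \<le> \<Theta> v x - \<Theta> u x \<and> \<Theta> v x - \<Theta> u x \<le> (v - u) / c"
  proof (cases "u < v")
    case True
    then obtain z where "\<Theta> v x - \<Theta> u x = (v - u) * g z x"
      using MVT2[of u v "\<lambda>u. \<Theta> u x" "\<lambda>u. g u x"] Theta_deriv[OF x] by blast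
    then show ?thesis
      using g_bounds(2,3)[OF x, of z] True mult_left_mono[of "1 / A" "g z x" "v - u"]
        mult_left_mono[of "g z x" "1 / c" "v - u"] by simp
  qed (use uv in simp)
  then show "(v - u) / A \<le> \<Theta> v x - \<Theta> u x" "\<Theta> v x - \<Theta> u x \<le> (v - u) / c" by auto
qed

lemma Theta_less_iff:
  assumes x: "x \<in> M"
  shows "\<Theta> u x < \<Theta> v x \<longleftrightarrow> u < v"
proof -
  have "\<Theta> u x < \<Theta> v x" if "u < v" for u v
    using Theta_mvt(1)[OF x, of u v] that g_bounds(1)[OF x] by (smt (verit) divide_pos_pos)
  then show ?thesis by (metis linorder_less_linear order_less_asym)
qed

lemma Theta_le_iff: "x \<in> M \<Longrightarrow> \<Theta> u x \<le> \<Theta> v x \<longleftrightarrow> u \<le> v"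
  using Theta_less_iff[of x v u] by (simp add: linorder_not_less[symmetric])

lemma Theta_deck:
  assumes x: "x \<in> M"
  shows "\<Theta> (u - S n x) (it n x) = \<Theta> u x - \<Theta> (S n x) x"
proof -
  let ?D = "\<lambda>u. \<Theta> (u - S n x) (it n x) - \<Theta> u x"
  have "(?D has_real_derivative 0) (at u)" for u
  proof -
    have "((\<lambda>u. \<Theta> (u - S n x) (it n x)) has_real_derivative g (u - S n x) (it n x) * 1) (at u)"
      by (rule DERIV_chain2[OF Theta_deriv[OF it_in[OF x]]]) (auto intro!: derivative_eq_intros)
    moreover have "g (u - S n x) (it n x) = g u x"
      by (simp add: g_def P_deck[OF x])
    ultimately show ?thesis
      using DERIV_diff[OF _ Theta_deriv[OF x]] by fastforce
  qed
  then have "?D u = ?D (S n x)" by (intro DERIV_isconst_all) blast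
  then show ?thesis by simp
qed

text \<open>In the time direction the clock is Lipschitz; in the space direction its derivatives for two nearby
  points are uniformly close on a compact interval of times, by the tube lemma.\<close>

lemma Theta_cont: "continuous_map RX euclideanreal (\<lambda>q. \<Theta> (fst q) (snd q))"
proof (rule continuous_map_realI)
  fix q :: "real \<times> 'a" and e :: real assume q: "q \<in> topspace RX" and e: "0 < e"
  define u x where "u = fst q" and "x = snd q"
  have x: "x \<in> M" using q by (auto simp: x_def)
  define e' where "e' = e / (2 * (\<bar>u\<bar> + 1))"
  have e': "0 < e'" using e by (simp add: e'_def)
  have "continuous_map RX euclideanreal (\<lambda>q. g (fst q) x)"
    using continuous_map_compose[OF continuous_map_fst[of euclideanreal X], where g="\<lambda>v. g v x" and X''=euclideanreal]
      g_cont_time[OF x] by (simp add: o_def)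
  then have "continuous_map RX euclideanreal (\<lambda>q. \<bar>g (fst q) (snd q) - g (fst q) x\<bar>)"
    using g_cont by (intro continuous_map_real_abs continuous_map_diff)
  then have ope: "openin RX {q \<in> topspace RX. \<bar>g (fst q) (snd q) - g (fst q) x\<bar> \<in> {..<e'}}" (is "openin RX ?W")
    by (rule openin_continuous_map_preimage) simp
  have sub: "{- \<bar>u\<bar>..\<bar>u\<bar>} \<times> {x} \<subseteq> ?W"
    using x e' by auto
  have "compactin euclideanreal {- \<bar>u\<bar>..\<bar>u\<bar>}" by simp
  from tube_lemma_left[OF ope this x sub]
  obtain U' V where UV: "{- \<bar>u\<bar>..\<bar>u\<bar>} \<subseteq> U'" "U' \<times> V \<subseteq> ?W" and V: "openin X V" "x \<in> V"
    by (elim exE conjE)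
  have gV: "\<bar>g v y - g v x\<bar> < e'" if "v \<in> {- \<bar>u\<bar>..\<bar>u\<bar>}" "y \<in> V" for v y
  proof -
    have "(v, y) \<in> ?W" using UV that by blast
    then show ?thesis by simp
  qed
  have VM: "V \<subseteq> M" using V(1) openin_subset by blast
  have 1: "\<bar>\<Theta> u y - \<Theta> u x\<bar> < e / 2" if y: "y \<in> V" for y
  proof -
    have yM: "y \<in> M" using y VM by auto
    have d: "((\<lambda>v. \<Theta> v y - \<Theta> v x) has_real_derivative g v y - g v x) (at v)" for v
      by (intro DERIV_diff Theta_deriv x yM)
    have gb: "\<bar>g v y - g v x\<bar> < e'" if "v \<in> {- \<bar>u\<bar>..\<bar>u\<bar>}" for v
      using gV y that by blast
    have "\<bar>\<Theta> u y - \<Theta> u x\<bar> \<le> \<bar>u\<bar> * e'"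
    proof (cases u "0 :: real" rule: linorder_cases)
      case less
      then obtain z where "u < z" "z < 0" "(\<Theta> 0 y - \<Theta> 0 x) - (\<Theta> u y - \<Theta> u x) = (0 - u) * (g z y - g z x)"
        using MVT2[of u 0 "\<lambda>v. \<Theta> v y - \<Theta> v x" "\<lambda>v. g v y - g v x"] d by blast
      moreover from this have "\<Theta> u y - \<Theta> u x = u * (g z y - g z x)" by simp
      then have "\<bar>\<Theta> u y - \<Theta> u x\<bar> = \<bar>u\<bar> * \<bar>g z y - g z x\<bar>" by (simp only: abs_mult)
      moreover have "\<bar>u\<bar> * \<bar>g z y - g z x\<bar> \<le> \<bar>u\<bar> * e'"
        using gb[of z] calculation by (intro mult_left_mono) auto
      ultimately show ?thesis by simp
    next
      case greater
      then obtain z where "0 < z" "z < u" "(\<Theta> u y - \<Theta> u x) - (\<Theta> 0 y - \<Theta> 0 x) = (u - 0) * (g z y - g z x)"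
        using MVT2[of 0 u "\<lambda>v. \<Theta> v y - \<Theta> v x" "\<lambda>v. g v y - g v x"] d by blast
      moreover from this have "\<bar>u\<bar> * \<bar>g z y - g z x\<bar> \<le> \<bar>u\<bar> * e'"
        using gb[of z] by (intro mult_left_mono) auto
      ultimately show ?thesis by (simp add: abs_mult)
    qed simp
    also have "\<dots> < e / 2"
    proof -
      have "\<bar>u\<bar> * e' < (\<bar>u\<bar> + 1) * e'" using e' by simp
      also have "\<dots> = e / 2" by (simp add: e'_def field_simps)
      finally show ?thesis .
    qed
    finally show ?thesis .
  qed
  define \<delta> where "\<delta> = c * e / 2"
  have d: "0 < \<delta>" using c_pos e by (simp add: \<delta>_def)
  have 2: "\<bar>\<Theta> v y - \<Theta> u y\<bar> < e / 2" if "\<bar>v - u\<bar> < \<delta>" "y \<in> M" for v y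
  proof -
    have A: "0 < A" using g_bounds(1)[OF that(2)] .
    have "\<bar>\<Theta> v y - \<Theta> u y\<bar> \<le> \<bar>v - u\<bar> / c"
    proof (cases "u \<le> v")
      case True
      moreover have "0 \<le> (v - u) / A" using A True by simp
      ultimately show ?thesis using Theta_mvt[OF that(2) True] by simp
    next
      case False
      then have vu: "v \<le> u" by simp
      moreover have "0 \<le> (u - v) / A" using A vu by simp
      ultimately show ?thesis using Theta_mvt[OF that(2) vu] False by simp
    qed
    also have "\<dots> < e / 2" using that(1) c_pos by (simp add: \<delta>_def field_simps)
    finally show ?thesis .
  qed
  let ?U = "{u - \<delta><..<u + \<delta>} \<times> V"
  have "\<bar>\<Theta> (fst q') (snd q') - \<Theta> (fst q) (snd q)\<bar> < e" if "q' \<in> ?U" for q'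
  proof -
    have "\<bar>fst q' - u\<bar> < \<delta>" "snd q' \<in> V" using that by (auto simp: abs_less_iff)
    then have "\<bar>\<Theta> (fst q') (snd q') - \<Theta> u (snd q')\<bar> < e / 2" "\<bar>\<Theta> u (snd q') - \<Theta> u x\<bar> < e / 2"
      using 1 2 VM by auto
    then show ?thesis unfolding u_def[symmetric] x_def[symmetric] by linarith
  qed
  moreover have "openin RX ?U" using V by (simp add: openin_prod_Times_iff)
  moreover have "q \<in> ?U" using V d by (auto simp: mem_Times_iff u_def x_def)
  ultimately show "\<exists>U. openin RX U \<and> q \<in> U \<and>
      (\<forall>y\<in>U. \<bar>\<Theta> (fst y) (snd y) - \<Theta> (fst q) (snd q)\<bar> < e)" by blast
qed

lemma Theta_surj:
  assumes x: "x \<in> M"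
  shows "\<exists>u. \<Theta> u x = t"
proof -
  have A: "0 < A" by (rule g_bounds(1)[OF x])
  have "\<Theta> (- A * \<bar>t\<bar>) x \<le> t" "t \<le> \<Theta> (A * \<bar>t\<bar>) x"
    using Theta_mvt(1)[OF x, of "- A * \<bar>t\<bar>" 0] Theta_mvt(1)[OF x, of 0 "A * \<bar>t\<bar>"] A by auto
  moreover have "- A * \<bar>t\<bar> \<le> A * \<bar>t\<bar>" using A by simp
  moreover have "isCont (\<lambda>u. \<Theta> u x) u" for u
    using Theta_deriv[OF x] DERIV_isCont by blast
  ultimately show ?thesis
    using IVT[of "\<lambda>u. \<Theta> u x" "- A * \<bar>t\<bar>" t "A * \<bar>t\<bar>"] by blast
qed

definition \<sigma> where "\<sigma> t x = (SOME u. \<Theta> u x = t)"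

lemma Theta_sigma: "x \<in> M \<Longrightarrow> \<Theta> (\<sigma> t x) x = t"
  unfolding \<sigma>_def by (rule someI_ex[OF Theta_surj])

lemma sigma_Theta: "x \<in> M \<Longrightarrow> \<sigma> (\<Theta> u x) x = u"
  using Theta_sigma[of x "\<Theta> u x"] Theta_le_iff[of x] by (metis order.antisym order_refl)

lemma sigma_nonneg: "x \<in> M \<Longrightarrow> 0 \<le> t \<Longrightarrow> 0 \<le> \<sigma> t x"
  using Theta_le_iff[of x 0 "\<sigma> t x"] Theta_sigma[of x t] by simp

lemma brake_time_eq:
  assumes x: "x \<in> M" and s: "0 \<le> s"
    and eq: "\<And>v. v \<in> {0..s} \<Longrightarrow> \<alpha> (P (u + v) x) = \<beta> (P (u + v) x)"
  shows "brake_time X f r \<alpha> s (P u x) = ereal (\<Theta> (u + s) x - \<Theta> u x)"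
proof -
  have "(\<integral>\<^sup>+v\<in>{0..s}. inverse (ennreal (\<alpha> (\<phi> v (P u x)))) \<partial>lborel) =
      (\<integral>\<^sup>+v. ennreal (g (u + v) x) * indicator {0..s} v \<partial>lborel)"
  proof (rule nn_integral_cong)
    fix v
    show "inverse (ennreal (\<alpha> (\<phi> v (P u x)))) * indicator {0..s} v = ennreal (g (u + v) x) * indicator {0..s} v"
    proof (cases "v \<in> {0..s}")
      case True
      have "0 < \<beta> (P (u + v) x)" using \<beta>_bounds[OF P_in[OF x], of "u + v"] c_pos by linarith
      then have "inverse (ennreal (\<beta> (P (u + v) x))) = ennreal (g (u + v) x)"
        by (simp add: g_def inverse_ennreal divide_inverse)
      then show ?thesis using eq[OF True] P_flow[OF x] by simp
    qed simp
  qed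
  also have "\<dots> = ennreal (\<Theta> (u + s) x - \<Theta> (u + 0) x)"
  proof (rule nn_integral_FTC_Icc)
    have "continuous_on UNIV (\<lambda>v. g v x)" by (rule g_cont_time[OF x])
    then have "continuous_on UNIV (\<lambda>v. g (u + v) x)"
      by (rule continuous_on_compose2) (auto intro!: continuous_intros)
    then show "(\<lambda>v. g (u + v) x) \<in> borel_measurable borel" by (rule borel_measurable_continuous_onI)
    fix v
    have "((\<lambda>v. \<Theta> (u + v) x) has_real_derivative g (u + v) x * 1) (at v)"
      by (rule DERIV_chain2[OF Theta_deriv[OF x]]) (auto intro!: derivative_eq_intros)
    then show "((\<lambda>v. \<Theta> (u + v) x) has_real_derivative g (u + v) x) (at v)"
      by simp
    show "0 \<le> g (u + v) x" using g_bounds(4)[OF x] by (simp add: less_imp_le)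
  qed (rule s)
  finally have "(\<integral>\<^sup>+v\<in>{0..s}. inverse (ennreal (\<alpha> (\<phi> v (P u x)))) \<partial>lborel) = ennreal (\<Theta> (u + s) x - \<Theta> u x)"
    by simp
  moreover have "\<Theta> u x \<le> \<Theta> (u + s) x" using s Theta_le_iff[OF x] by simp
  ultimately show ?thesis using s by (simp add: brake_time_def)
qed

text \<open>On a flow line on which \<open>\<alpha>\<close> and \<open>\<beta>\<close> agree from the time \<open>u\<close> on, the condition
  \<open>brake_time s \<le> t\<close> for \<open>s \<ge> 0\<close> reads \<open>\<Theta> (u + s) x \<le> \<Theta> u x + t\<close>.\<close>

lemma pseudo_singular_flow_eq:
  assumes x: "x \<in> M" and t: "0 \<le> t"
    and eq: "\<And>v. 0 \<le> v \<Longrightarrow> \<alpha> (P (u + v) x) = \<beta> (P (u + v) x)"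
  shows "pseudo_singular_flow X f r \<alpha> t (P u x) = P (\<sigma> (\<Theta> u x + t) x) x"
proof -
  define w where "w = \<sigma> (\<Theta> u x + t) x"
  have w: "\<Theta> w x = \<Theta> u x + t" using Theta_sigma[OF x] by (simp add: w_def)
  then have uw: "u \<le> w" using Theta_le_iff[OF x, of u w] t by simp
  have "{s. brake_time X f r \<alpha> s (P u x) \<le> ereal t} = {..w - u}"
  proof (intro set_eqI)
    fix s
    show "s \<in> {s. brake_time X f r \<alpha> s (P u x) \<le> ereal t} \<longleftrightarrow> s \<in> {..w - u}"
    proof (cases "0 \<le> s")
      case True
      have "brake_time X f r \<alpha> s (P u x) = ereal (\<Theta> (u + s) x - \<Theta> u x)"
        using x True eq by (intro brake_time_eq) auto
      then have "brake_time X f r \<alpha> s (P u x) \<le> ereal t \<longleftrightarrow> \<Theta> (u + s) x \<le> \<Theta> w x" using w by auto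
      then show ?thesis using Theta_le_iff[OF x, of "u + s" w] by auto
    next
      case False
      then have "brake_time X f r \<alpha> s (P u x) \<le> 0"
        by (simp add: brake_time_def ereal_uminus_le_reorder)
      also have "0 \<le> ereal t" using t by simp
      finally show ?thesis using False uw by simp
    qed
  qed
  then have "brake_clock X f r \<alpha> t (P u x) = w - u"
    by (simp add: brake_clock_def)
  then show ?thesis using P_flow[OF x, of "w - u" u] by (simp add: pseudo_singular_flow_def w_def)
qed

lemma pseudo_singular_iterate:
  assumes x: "x \<in> M" and eq: "\<And>v. 0 \<le> v \<Longrightarrow> \<alpha> (P v x) = \<beta> (P v x)"
  shows "((pseudo_singular_flow X f r \<alpha> 1) ^^ i) (P 0 x) = P (\<sigma> (real i) x) x"
proof (induction i)
  case 0
  then show ?case using sigma_Theta[OF x, of 0] by simp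
next
  case (Suc i)
  have "0 \<le> \<sigma> (real i) x" using sigma_nonneg[OF x] by simp
  then have "pseudo_singular_flow X f r \<alpha> 1 (P (\<sigma> (real i) x) x) = P (\<sigma> (\<Theta> (\<sigma> (real i) x) x + 1) x) x"
    using eq by (intro pseudo_singular_flow_eq[OF x]) auto
  then show ?case using Suc by (simp add: Theta_sigma[OF x] add.commute)
qed

end

section \<open>Synchronisation of flow lines\<close>

text \<open>Here \<open>s p\<close> and \<open>s' p\<close> are the clock readings of two flow lines at their crossings number \<open>p\<close>. The information at
  the time \<open>i\<close> compares a crossing \<open>q\<close> of the one with a crossing \<open>q'\<close> of the other; suppose that \<open>q = q'\<close>. Until the next integer time there
  are at most \<open>B\<close> further crossings, so there the readings with equal numbers differ by at most \<open>2 e\<close>. If the information at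
  the time \<open>i + 1\<close> compared crossings with different numbers, then two readings of \<open>s'\<close> would be closer than \<open>3 e\<close>,
  which is at most the gap \<open>R0\<close> between crossings. The bound \<open>e\<close> is thus renewed at each integer time.\<close>

lemma synchronised_counts:
  fixes s s' :: "nat \<Rightarrow> real"
  assumes zero: "s 0 = 0" "s' 0 = 0"
    and s: "\<And>p. R0 \<le> s (Suc p) - s p" "\<And>p. s (Suc p) - s p \<le> R1"
    and s': "\<And>p. R0 \<le> s' (Suc p) - s' p"
    and e: "0 < e" "3 * e \<le> R0" "e < 1" and B: "2 \<le> (real B - 1) * R0"
    and close: "\<And>i. i < n \<Longrightarrow> \<exists>q q'. \<bar>s q - s' q'\<bar> < e \<and>
        s q - e < real i \<and> real i < s (Suc q) \<and> s' q' - e < real i \<and> real i < s' (Suc q') \<and>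
        (\<forall>j\<le>B. \<bar>(s (q + j) - s q) - (s' (q' + j) - s' q')\<bar> < e) \<and>
        (q = q' \<longrightarrow> (\<forall>j\<le>B. good (q + j)))"
    and l: "(real l + 1) * R1 \<le> real n - 1"
  shows "good l"
proof -
  have R0: "0 < R0" using e by linarith
  then have R1: "0 < R1" using s[of 0] by linarith
  have grow: "s p + real j * R0 \<le> s (p + j)" "s' p + real j * R0 \<le> s' (p + j)" for p j
  proof (induction j)
    case (Suc j)
    {
      case 1
      then show ?case using Suc.IH(1) s(1)[of "p + j"] by (simp add: algebra_simps)
    next
      case 2
      then show ?case using Suc.IH(2) s'[of "p + j"] by (simp add: algebra_simps)
    }
  qed simp_all
  have mono: "s p + R0 \<le> s q" "s' p + R0 \<le> s' q" if "p < q" for p q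
  proof -
    have "1 * R0 \<le> real (q - p) * R0" using that R0 by (intro mult_right_mono) auto
    then show "s p + R0 \<le> s q" "s' p + R0 \<le> s' q"
      using grow[of p "q - p"] that by simp_all
  qed
  have le: "s p \<le> s q" "s' p \<le> s' q" if "p \<le> q" for p q
    using mono[of p q] that R0 by (cases "p = q"; simp)+
  have top: "s p \<le> real p * R1" for p
  proof (induction p)
    case (Suc p)
    then show ?case using s(2)[of p] by (simp add: algebra_simps)
  qed (simp add: zero)
  have main: "\<exists>q. \<bar>s q - s' q\<bar> < e \<and> s q - e < real i \<and> real i < s (Suc q) \<and> real i < s' (Suc q) \<and>
        (\<forall>j\<le>B. \<bar>(s (q + j) - s q) - (s' (q + j) - s' q)\<bar> < e) \<and> (\<forall>l\<le>q + B. good l)" if "i < n" for i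
    using that
  proof (induction i)
    case 0
    from close[OF this] obtain q q' where q: "\<bar>s q - s' q'\<bar> < e" "s q - e < 0" "0 < s (Suc q)"
        "s' q' - e < 0" "0 < s' (Suc q')"
        "\<And>j. j \<le> B \<Longrightarrow> \<bar>(s (q + j) - s q) - (s' (q' + j) - s' q')\<bar> < e" "q = q' \<longrightarrow> (\<forall>j\<le>B. good (q + j))"
      by auto
    have "q = 0" using mono(1)[of 0 q] q(2) e zero by (cases q) auto
    moreover have "q' = 0" using mono(2)[of 0 q'] q(4) e zero by (cases q') auto
    ultimately have "q = 0" "q' = 0" by auto
    then show ?case using q e by (intro exI[of _ 0]) simp
  next
    case (Suc i)
    then obtain q where q: "\<bar>s q - s' q\<bar> < e" "s q - e < real i" "real i < s (Suc q)" "real i < s' (Suc q)"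
        "\<And>j. j \<le> B \<Longrightarrow> \<bar>(s (q + j) - s q) - (s' (q + j) - s' q)\<bar> < e" "\<And>l. l \<le> q + B \<Longrightarrow> good l"
      by auto
    from close[OF Suc.prems] obtain p p' where p: "\<bar>s p - s' p'\<bar> < e"
        "s p - e < real i + 1" "real i + 1 < s (Suc p)"
        "s' p' - e < real i + 1" "real i + 1 < s' (Suc p')"
        "\<And>j. j \<le> B \<Longrightarrow> \<bar>(s (p + j) - s p) - (s' (p' + j) - s' p')\<bar> < e" "p = p' \<longrightarrow> (\<forall>j\<le>B. good (p + j))"
      by auto
    have qp: "q \<le> p"
    proof (rule ccontr)
      assume "\<not> q \<le> p"
      then have "s (Suc p) \<le> s q" by (intro le) simp
      then show False using p(3) q(2) e by linarith
    qed
    have pB: "p - q \<le> B"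
    proof (rule ccontr)
      assume "\<not> p - q \<le> B"
      then have "Suc q + (p - q - 1) = p" and b: "real B - 1 \<le> real (p - q - 1)" by auto
      then have "s (Suc q) + real (p - q - 1) * R0 \<le> s p" using grow(1)[of "Suc q" "p - q - 1"] by simp
      moreover have "(real B - 1) * R0 \<le> real (p - q - 1) * R0"
        using b R0 by (intro mult_right_mono) auto
      ultimately show False using q(3) p(2) B e by linarith
    qed
    have "\<bar>s p - s' p\<bar> < 2 * e" using q(5)[OF pB] qp q(1) by (simp add: abs_less_iff)
    then have pp: "\<bar>s' p - s' p'\<bar> < 3 * e" using p(1) by (simp add: abs_less_iff)
    have "p = p'"
    proof (rule ccontr)
      assume "p \<noteq> p'"
      then have "R0 \<le> \<bar>s' p - s' p'\<bar>"
        using mono(2)[of p p'] mono(2)[of p' p] by (cases "p < p'") auto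
      then show False using pp e by linarith
    qed
    moreover have "good l" if "l \<le> p + B" "p = p'" for l
    proof (cases "l \<le> p")
      case True
      then show ?thesis using pB qp by (intro q(6)) simp
    next
      case False
      then show ?thesis using p(7) that by (metis add_le_cancel_left le_add_diff_inverse nat_le_linear)
    qed
    ultimately show ?case using p by (intro exI[of _ p]) (auto simp: add.commute)
  qed
  have "0 < (real l + 1) * R1" using R1 by simp
  then have n: "n - 1 < n" "real (n - 1) = real n - 1" using l by auto
  obtain q where q: "real (n - 1) < s (Suc q)" "\<And>l. l \<le> q + B \<Longrightarrow> good l" using main[OF n(1)] by auto
  have "(real l + 1) * R1 < real (Suc q) * R1" using q(1) top[of "Suc q"] l n by linarith
  then have "real l + 1 < real (Suc q)" using R1 by simp
  then show ?thesis by (intro q(2)) simp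
qed

context time_change
begin

text \<open>The clock reading at the crossing number \<open>p\<close> of the roof.\<close>

definition \<Sigma> where "\<Sigma> p x = \<Theta> (S (int p) x) x"

lemma Sigma_0 [simp]: "\<Sigma> 0 x = 0" by (simp add: \<Sigma>_def)

lemma Sigma_add:
  assumes "x \<in> M"
  shows "\<Sigma> (q + j) x = \<Sigma> q x + \<Sigma> j (it (int q) x)"
  using Theta_deck[OF assms, of "S (int (q + j)) x" "int q"] S_add[OF assms, of "int j" "int q"]
  by (simp add: \<Sigma>_def add.commute)

lemma Sigma_Suc:
  assumes "x \<in> M"
  shows "\<Sigma> (Suc q) x = \<Sigma> q x + \<Theta> (r (it (int q) x)) (it (int q) x)"
  using Sigma_add[OF assms, of q 1] roof_sum_succ[of X f r 0 "it (int q) x"] by (simp add: \<Sigma>_def)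

lemma return_bounds:
  obtains R0 R1 where "0 < R0" "\<And>x. x \<in> M \<Longrightarrow> R0 \<le> \<Theta> (r x) x" "\<And>x. x \<in> M \<Longrightarrow> \<Theta> (r x) x \<le> R1"
proof (cases "M = {}")
  case False
  obtain c' C where r: "0 < c'" "\<And>x. x \<in> M \<Longrightarrow> c' \<le> r x" "\<And>x. x \<in> M \<Longrightarrow> r x \<le> C" by (fact r_bounds)
  have A: "0 < A" using False g_bounds(1) by blast
  show thesis
  proof (rule that[of "c' / A" "C / c"])
    show "0 < c' / A" using r A by simp
    fix x assume x: "x \<in> M"
    have "c' / A \<le> r x / A" "r x / c \<le> C / c" "0 \<le> r x"
      using r(2,3)[OF x] A c_pos r_pos[OF x] by (auto simp: divide_right_mono)
    then show "c' / A \<le> \<Theta> (r x) x" "\<Theta> (r x) x \<le> C / c" using Theta_mvt[OF x, of 0 "r x"] by auto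
  qed
qed (use that[of 1 1] in auto)

lemma cont_Sigma: "continuous_map X euclideanreal (\<Sigma> j)"
proof -
  have "continuous_map X RX (\<lambda>x. (S (int j) x, x))"
    by (intro continuous_map_pairedI cont_S continuous_map_id[unfolded id_def])
  from continuous_map_compose[OF this Theta_cont] show ?thesis by (simp add: o_def \<Sigma>_def[abs_def])
qed

text \<open>Near the roof a small time error can change the number of crossings so far by one. Therefore
  closeness of two flow points is expressed relative to crossings \<open>q\<close>, \<open>q'\<close> that may lie slightly
  in the future, whence the lower bounds \<open>- e\<close>.\<close>

definition flow_close :: "real \<Rightarrow> nat \<Rightarrow> 'a set \<Rightarrow> 'a set \<Rightarrow> real \<Rightarrow> 'a \<Rightarrow> real \<Rightarrow> 'a \<Rightarrow> bool" where
  "flow_close e B L0 L1 u x u' x' \<longleftrightarrow> (\<exists>q q'.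
      \<bar>(\<Theta> u x - \<Sigma> q x) - (\<Theta> u' x' - \<Sigma> q' x')\<bar> < e \<and>
      - e < \<Theta> u x - \<Sigma> q x \<and> \<Theta> u x < \<Sigma> (Suc q) x \<and>
      - e < \<Theta> u' x' - \<Sigma> q' x' \<and> \<Theta> u' x' < \<Sigma> (Suc q') x' \<and>
      (\<forall>j\<le>B. \<bar>(\<Sigma> (q + j) x - \<Sigma> q x) - (\<Sigma> (q' + j) x' - \<Sigma> q' x')\<bar> < e) \<and>
      (\<forall>j\<le>B. \<not> (it (int (q + j)) x \<in> L0 \<and> it (int (q' + j)) x' \<in> L1) \<and>
             \<not> (it (int (q + j)) x \<in> L1 \<and> it (int (q' + j)) x' \<in> L0)))"

text \<open>All conditions are open in \<open>\<real> \<times> M\<close>, and the projection \<open>P\<close> to the suspension space is an open map.\<close>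

lemma flow_close_nbhd:
  assumes L: "closedin X L0" "closedin X L1" "L0 \<inter> L1 = {}"
    and e: "0 < e" and z: "z \<in> topspace Y"
  shows "\<exists>U. openin Y U \<and> z \<in> U \<and>
    (\<forall>u x u' x'. x \<in> M \<longrightarrow> x' \<in> M \<longrightarrow> 0 \<le> u \<longrightarrow> 0 \<le> u' \<longrightarrow> P u x \<in> U \<longrightarrow> P u' x' \<in> U \<longrightarrow>
       flow_close e B L0 L1 u x u' x')"
proof -
  obtain s0 y where y: "y \<in> M" "0 \<le> s0" "s0 < r y" "z = P s0 y"
  proof -
    obtain s x where "x \<in> M" "0 \<le> s" "s \<le> r x" "z = P s x" by (rule topspace_Y[OF z])
    then show thesis
      using that P_bracket[of x s] P_eq by (metis P_deck it_in)
  qed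
  define O1 where "O1 = {q \<in> topspace RX. \<bar>\<Theta> (fst q) (snd q) - \<Theta> s0 y\<bar> \<in> {..<e/2}}"
  define O2 where "O2 = {q \<in> topspace RX. r (snd q) - fst q \<in> {0<..}}"
  define O3 where "O3 j = {q \<in> topspace RX. \<bar>\<Sigma> j (snd q) - \<Sigma> j y\<bar> \<in> {..<e/2}}" for j
  define O4 where "O4 j = {q \<in> topspace RX. it (int j) (snd q) \<in> M - (if it (int j) y \<in> L0 then L1 else L0)}" for j
  define Z where "Z = O1 \<inter> O2 \<inter> (\<Inter>j\<le>B. O3 j \<inter> O4 j)"
  have "openin RX O1" unfolding O1_def
    by (rule openin_continuous_map_preimage[of _ euclideanreal])
      (auto intro!: continuous_map_real_abs continuous_map_diff Theta_cont)
  moreover have "openin RX O2" unfolding O2_def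
    by (rule openin_continuous_map_preimage[of _ euclideanreal])
      (auto intro!: continuous_map_diff continuous_map_fst continuous_map_compose[OF continuous_map_snd r_cont, unfolded o_def])
  moreover have "openin RX (O3 j)" for j unfolding O3_def
    by (rule openin_continuous_map_preimage[of _ euclideanreal])
      (auto intro!: continuous_map_real_abs continuous_map_diff continuous_map_compose[OF continuous_map_snd cont_Sigma, unfolded o_def])
  moreover have "openin RX (O4 j)" for j unfolding O4_def
    by (rule openin_continuous_map_preimage[of _ X])
      (use L in \<open>auto intro!: continuous_map_compose[OF continuous_map_snd cont_it, unfolded o_def]\<close>)
  ultimately have "openin RX Z" unfolding Z_def by (intro openin_Int openin_INT2) auto
  then have "openin Y ((\<lambda>q. P (fst q) (snd q)) ` Z)" by (rule P_open)
  moreover have "(s0, y) \<in> Z"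
    using y e L(3) it_in by (auto simp: Z_def O1_def O2_def O3_def O4_def)
  then have "z \<in> (\<lambda>q. P (fst q) (snd q)) ` Z" using y by force
  moreover have "flow_close e B L0 L1 u x u' x'"
    if x: "x \<in> M" "0 \<le> u" "P u x \<in> (\<lambda>q. P (fst q) (snd q)) ` Z"
      and x': "x' \<in> M" "0 \<le> u'" "P u' x' \<in> (\<lambda>q. P (fst q) (snd q)) ` Z" for u x u' x'
  proof -
    have key: "\<exists>q. (u - S (int q) x, it (int q) x) \<in> Z"
      if x: "x \<in> M" "0 \<le> u" and PZ: "P u x \<in> (\<lambda>q. P (fst q) (snd q)) ` Z" for u x
    proof -
      obtain a v where av: "(a, v) \<in> Z" "P u x = P a v" using PZ by auto
      have v: "v \<in> M" using av by (auto simp: Z_def O1_def)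
      obtain m where m: "v = it m x" "a = u - S m x" by (rule P_eqD[OF av(2) x(1) v])
      have "a < r v" using av(1) by (auto simp: Z_def O2_def)
      then have "u < S (m + 1) x" using m by (simp add: roof_sum_succ)
      then have "0 \<le> m" using S_mono[OF x(1), of "m + 1" 0] x(2) by (cases "0 \<le> m") auto
      then show ?thesis using m av(1) by (intro exI[of _ "nat m"]) simp
    qed
    obtain q where q: "(u - S (int q) x, it (int q) x) \<in> Z" using key[OF x] by blast
    obtain q' where q': "(u' - S (int q') x', it (int q') x') \<in> Z" using key[OF x'] by blast
    have ys: "0 \<le> \<Theta> s0 y" using Theta_le_iff[OF y(1), of 0 s0] y(2) by simp
    have Zd: "\<bar>(\<Theta> u x - \<Sigma> q x) - \<Theta> s0 y\<bar> < e / 2" "\<Theta> u x < \<Sigma> (Suc q) x"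
        "j \<le> B \<Longrightarrow> \<bar>(\<Sigma> (q + j) x - \<Sigma> q x) - \<Sigma> j y\<bar> < e / 2"
        "j \<le> B \<Longrightarrow> it (int (q + j)) x \<notin> (if it (int j) y \<in> L0 then L1 else L0)"
      if "(u - S (int q) x, it (int q) x) \<in> Z" "x \<in> M" for u x q j
    proof -
      show "\<bar>(\<Theta> u x - \<Sigma> q x) - \<Theta> s0 y\<bar> < e / 2"
        using that by (simp add: Z_def O1_def Theta_deck \<Sigma>_def)
      have "u - S (int q) x < r (it (int q) x)" using that by (simp add: Z_def O2_def)
      then have "\<Theta> (u - S (int q) x) (it (int q) x) < \<Theta> (r (it (int q) x)) (it (int q) x)"
        using Theta_less_iff[OF it_in[OF that(2)]] by simp
      then show "\<Theta> u x < \<Sigma> (Suc q) x"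
        using that(2) Sigma_Suc[OF that(2), of q] by (simp add: Theta_deck \<Sigma>_def)
      show "j \<le> B \<Longrightarrow> \<bar>(\<Sigma> (q + j) x - \<Sigma> q x) - \<Sigma> j y\<bar> < e / 2"
        using that Sigma_add[OF that(2), of q j] by (auto simp: Z_def O3_def)
      show "it (int (q + j)) x \<notin> (if it (int j) y \<in> L0 then L1 else L0)" if "j \<le> B"
      proof -
        have "(u - S (int q) x, it (int q) x) \<in> O4 j"
          using that \<open>(u - S (int q) x, it (int q) x) \<in> Z\<close> by (auto simp: Z_def)
        then show ?thesis
          using it_add[OF \<open>x \<in> M\<close>, of "int j" "int q"] by (simp add: O4_def add.commute)
      qed
    qed
    note Z1 = Zd[OF q x(1)] and Z2 = Zd[OF q' x'(1)]
    show ?thesis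
      unfolding flow_close_def
    proof (rule exI[of _ q], rule exI[of _ q'], intro conjI allI impI)
      show "\<bar>(\<Theta> u x - \<Sigma> q x) - (\<Theta> u' x' - \<Sigma> q' x')\<bar> < e"
        using Z1(1) Z2(1) by linarith
      show "- e < \<Theta> u x - \<Sigma> q x" "- e < \<Theta> u' x' - \<Sigma> q' x'"
        using Z1(1) Z2(1) ys e by linarith+
      show "\<Theta> u x < \<Sigma> (Suc q) x" "\<Theta> u' x' < \<Sigma> (Suc q') x'"
        using Z1(2) Z2(2) by auto
      fix j assume j: "j \<le> B"
      show "\<bar>(\<Sigma> (q + j) x - \<Sigma> q x) - (\<Sigma> (q' + j) x' - \<Sigma> q' x')\<bar> < e"
        using Z1(3)[OF j] Z2(3)[OF j] by linarith
      show "\<not> (it (int (q + j)) x \<in> L0 \<and> it (int (q' + j)) x' \<in> L1)"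
        "\<not> (it (int (q + j)) x \<in> L1 \<and> it (int (q' + j)) x' \<in> L0)"
        using Z1(4)[OF j] Z2(4)[OF j] by (simp_all split: if_splits)
    qed
  qed
  ultimately show ?thesis by (intro exI[of _ "(\<lambda>q. P (fst q) (snd q)) ` Z"] conjI allI impI)
qed

text \<open>A cover of the suspension space by such neighbourhoods keeps two flow lines that visit the
  same members at clock times \<open>0, \<dots>, n - 1\<close> in step.\<close>

lemma synchronising_cover:
  assumes L: "closedin X L0" "closedin X L1" "L0 \<inter> L1 = {}"
  obtains \<U> D where "finite \<U>" "open_cover Y \<U>" "0 < D"
    "\<And>n x x' l. x \<in> M \<Longrightarrow> x' \<in> M \<Longrightarrow>
       (\<And>i. i < n \<Longrightarrow> \<exists>U\<in>\<U>. P (\<sigma> (real i) x) x \<in> U \<and> P (\<sigma> (real i) x') x' \<in> U) \<Longrightarrow>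
       (real l + 1) * D \<le> real n - 1 \<Longrightarrow>
       \<not> (it (int l) x \<in> L0 \<and> it (int l) x' \<in> L1) \<and> \<not> (it (int l) x \<in> L1 \<and> it (int l) x' \<in> L0)"
proof -
  obtain R0 R1 where R: "0 < R0" "\<And>x. x \<in> M \<Longrightarrow> R0 \<le> \<Theta> (r x) x" "\<And>x. x \<in> M \<Longrightarrow> \<Theta> (r x) x \<le> R1"
    by (fact return_bounds)
  define D where "D = max R1 1"
  define e where "e = min (R0 / 3) (1 / 2)"
  have e: "0 < e" "3 * e \<le> R0" "e < 1" using R(1) by (auto simp: e_def)
  obtain B where B: "2 / R0 + 1 \<le> real B" using real_arch_simple by blast
  then have B: "2 \<le> (real B - 1) * R0" using R(1) by (simp add: field_simps)
  define good where "good U \<longleftrightarrow> openin Y U \<and>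
      (\<forall>u x u' x'. x \<in> M \<longrightarrow> x' \<in> M \<longrightarrow> 0 \<le> u \<longrightarrow> 0 \<le> u' \<longrightarrow> P u x \<in> U \<longrightarrow> P u' x' \<in> U \<longrightarrow>
        flow_close e B L0 L1 u x u' x')" for U
  have "\<exists>\<U>. finite \<U> \<and> \<U> \<subseteq> Collect good \<and> topspace Y \<subseteq> \<Union>\<U>"
  proof -
    have "topspace Y \<subseteq> \<Union>(Collect good)"
    proof
      fix z assume "z \<in> topspace Y"
      from flow_close_nbhd[OF L e(1) this, of B] obtain U where "good U" "z \<in> U"
        unfolding good_def by (elim exE conjE) blast
      then show "z \<in> \<Union>(Collect good)" by blast
    qed
    moreover have "compactin Y (topspace Y)" using compact_Y by (simp add: compact_space_def)
    moreover have "\<forall>U\<in>Collect good. openin Y U" by (simp add: good_def)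
    ultimately show ?thesis unfolding compactin_def by meson
  qed
  then obtain \<U> where \<U>: "finite \<U>" "\<And>U. U \<in> \<U> \<Longrightarrow> good U" "topspace Y \<subseteq> \<Union>\<U>"
    by auto
  show thesis
  proof (rule that[of \<U> D])
    show "finite \<U>" by fact
    show "open_cover Y \<U>" using \<U>(2,3) by (simp add: open_cover_def good_def)
    show "0 < D" by (simp add: D_def)
    fix n x x' l
    assume x: "x \<in> M" "x' \<in> M"
      and same: "\<And>i. i < n \<Longrightarrow> \<exists>U\<in>\<U>. P (\<sigma> (real i) x) x \<in> U \<and> P (\<sigma> (real i) x') x' \<in> U"
      and l: "(real l + 1) * D \<le> real n - 1"
    let ?apart = "\<lambda>l. \<not> (it (int l) x \<in> L0 \<and> it (int l) x' \<in> L1) \<and> \<not> (it (int l) x \<in> L1 \<and> it (int l) x' \<in> L0)"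
    show "?apart l"
    proof (rule synchronised_counts[where s="\<lambda>p. \<Sigma> p x" and s'="\<lambda>p. \<Sigma> p x'" and good="?apart" and ?R1.0=D and ?R0.0=R0
          and e=e and B=B and n=n])
      fix p
      show "R0 \<le> \<Sigma> (Suc p) x - \<Sigma> p x" "\<Sigma> (Suc p) x - \<Sigma> p x \<le> D" "R0 \<le> \<Sigma> (Suc p) x' - \<Sigma> p x'"
        using R(2,3)[OF it_in[OF x(1), of "int p"]] R(2,3)[OF it_in[OF x(2), of "int p"]]
        by (simp_all add: Sigma_Suc x D_def)
    next
      fix i assume "i < n"
      from same[OF this] obtain U where U: "U \<in> \<U>" "P (\<sigma> (real i) x) x \<in> U" "P (\<sigma> (real i) x') x' \<in> U" by blast
      have "0 \<le> \<sigma> (real i) x" "0 \<le> \<sigma> (real i) x'" using x sigma_nonneg by auto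
      then have "flow_close e B L0 L1 (\<sigma> (real i) x) x (\<sigma> (real i) x') x'"
        using \<U>(2)[OF U(1)] U(2,3) x unfolding good_def by blast
      then obtain q q' where q: "\<bar>(real i - \<Sigma> q x) - (real i - \<Sigma> q' x')\<bar> < e" 
          "- e < real i - \<Sigma> q x" "real i < \<Sigma> (Suc q) x"
          "- e < real i - \<Sigma> q' x'" "real i < \<Sigma> (Suc q') x'"
          "\<forall>j\<le>B. \<bar>(\<Sigma> (q + j) x - \<Sigma> q x) - (\<Sigma> (q' + j) x' - \<Sigma> q' x')\<bar> < e"
          "\<forall>j\<le>B. \<not> (it (int (q + j)) x \<in> L0 \<and> it (int (q' + j)) x' \<in> L1) \<and>
             \<not> (it (int (q + j)) x \<in> L1 \<and> it (int (q' + j)) x' \<in> L0)"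
        unfolding flow_close_def Theta_sigma[OF x(1)] Theta_sigma[OF x(2)] by blast
      show "\<exists>q q'. \<bar>\<Sigma> q x - \<Sigma> q' x'\<bar> < e \<and>
        \<Sigma> q x - e < real i \<and> real i < \<Sigma> (Suc q) x \<and> \<Sigma> q' x' - e < real i \<and> real i < \<Sigma> (Suc q') x' \<and>
        (\<forall>j\<le>B. \<bar>(\<Sigma> (q + j) x - \<Sigma> q x) - (\<Sigma> (q' + j) x' - \<Sigma> q' x')\<bar> < e) \<and>
        (q = q' \<longrightarrow> (\<forall>j\<le>B. ?apart (q + j)))"
      proof (rule exI[of _ q], rule exI[of _ q'], intro conjI)
        show "\<bar>\<Sigma> q x - \<Sigma> q' x'\<bar> < e" using q(1) by linarith
        show "\<Sigma> q x - e < real i" using q(2) by linarith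
        show "\<Sigma> q' x' - e < real i" using q(4) by linarith
        show "q = q' \<longrightarrow> (\<forall>j\<le>B. ?apart (q + j))" using q(7) by blast
      qed (use q in auto)
    qed (use e B l in auto)
  qed
qed

end

section \<open>Positive entropy from free symbols\<close>

lemma min_subcover_ge:
  assumes fin: "finite \<U>" and cov: "topspace Z \<subseteq> \<Union>\<U>" and E: "E \<subseteq> topspace Z"
    and sep: "\<And>U u v. U \<in> \<U> \<Longrightarrow> u \<in> E \<Longrightarrow> v \<in> E \<Longrightarrow> u \<in> U \<Longrightarrow> v \<in> U \<Longrightarrow> u = v"
  shows "card E \<le> min_subcover Z \<U>"
proof -
  let ?K = "{card \<V> |\<V>. \<V> \<subseteq> \<U> \<and> finite \<V> \<and> topspace Z \<subseteq> \<Union>\<V>}"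
  have "?K \<noteq> {}" using fin cov by blast
  then have "min_subcover Z \<U> \<in> ?K" unfolding min_subcover_def by (rule Inf_nat_def1)
  then obtain \<V> where \<V>: "\<V> \<subseteq> \<U>" "finite \<V>" "topspace Z \<subseteq> \<Union>\<V>" "min_subcover Z \<U> = card \<V>" by blast
  have "\<forall>u\<in>E. \<exists>V. V \<in> \<V> \<and> u \<in> V" using E \<V>(3) by blast
  then obtain h where h: "\<And>u. u \<in> E \<Longrightarrow> h u \<in> \<V> \<and> u \<in> h u" by metis
  have "inj_on h E"
    using h sep \<V>(1) by (metis inj_onI subsetD)
  moreover have "h ` E \<subseteq> \<V>" using h by blast
  ultimately show ?thesis using card_inj_on_le \<V>(2,4) by metis
qed

lemma finite_iterated_cover:
  assumes "finite \<U>"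
  shows "finite (iterated_cover Z T \<U> n)"
proof -
  have "iterated_cover Z T \<U> n \<subseteq>
      (\<lambda>A. {y \<in> topspace Z. \<forall>i<n. (T ^^ i) y \<in> A i}) ` (\<Pi>\<^sub>E i\<in>{..<n}. \<U>)"
  proof
    fix W assume "W \<in> iterated_cover Z T \<U> n"
    then obtain A where A: "W = {y \<in> topspace Z. \<forall>i<n. (T ^^ i) y \<in> A i}" "\<forall>i<n. A i \<in> \<U>"
      by (auto simp: iterated_cover_def)
    then show "W \<in> (\<lambda>A. {y \<in> topspace Z. \<forall>i<n. (T ^^ i) y \<in> A i}) ` (\<Pi>\<^sub>E i\<in>{..<n}. \<U>)"
      by (intro image_eqI[of _ _ "restrict A {..<n}"]) auto
  qed
  then show ?thesis by (rule finite_subset) (use assms in \<open>auto intro!: finite_PiE\<close>)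
qed

text \<open>Points that are told apart by their visits to the members of a cover lie in different members of the
  iterated cover, so their number bounds the size of its subcovers from below.\<close>

lemma topological_entropy_pos:
  assumes fin: "finite \<U>" and cov: "open_cover Z \<U>"
    and T: "\<And>z. z \<in> topspace Z \<Longrightarrow> T z \<in> topspace Z" and d: "0 < (\<delta> :: real)"
    and E: "\<And>n. \<exists>E\<subseteq>topspace Z. 2 powr (\<delta> * real n - C) \<le> real (card E) \<and>
       (\<forall>u\<in>E. \<forall>v\<in>E. (\<forall>i<n. \<exists>U\<in>\<U>. (T ^^ i) u \<in> U \<and> (T ^^ i) v \<in> U) \<longrightarrow> u = v)"
  shows "0 < topological_entropy Z T"
proof -
  let ?N = "\<lambda>n. min_subcover Z (iterated_cover Z T \<U> n)"
  have Ti: "(T ^^ i) z \<in> topspace Z" if "z \<in> topspace Z" for i z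
    using that T by (induction i) auto
  have N: "2 powr (\<delta> * real n - C) \<le> real (?N n)" for n
  proof -
    obtain F where *: "F \<subseteq> topspace Z \<and> 2 powr (\<delta> * real n - C) \<le> real (card F) \<and>
      (\<forall>u\<in>F. \<forall>v\<in>F. (\<forall>i<n. \<exists>U\<in>\<U>. (T ^^ i) u \<in> U \<and> (T ^^ i) v \<in> U) \<longrightarrow> u = v)"
      using E[of n] by (rule exE)
    note F = *[THEN conjunct1] *[THEN conjunct2, THEN conjunct1] *[THEN conjunct2, THEN conjunct2]
    have "card F \<le> ?N n"
    proof (rule min_subcover_ge[OF finite_iterated_cover[OF fin] _ F(1)])
      show "topspace Z \<subseteq> \<Union>(iterated_cover Z T \<U> n)"
      proof
        fix z assume z: "z \<in> topspace Z"
        have "\<forall>i. \<exists>U. U \<in> \<U> \<and> (T ^^ i) z \<in> U"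
        proof
          fix i
          have "(T ^^ i) z \<in> \<Union>\<U>" using Ti[OF z, of i] cov unfolding open_cover_def by (meson subsetD)
          then show "\<exists>U. U \<in> \<U> \<and> (T ^^ i) z \<in> U" by blast
        qed
        from choice[OF this] obtain A where A: "\<And>i. A i \<in> \<U> \<and> (T ^^ i) z \<in> A i" by blast
        have "{y \<in> topspace Z. \<forall>i<n. (T ^^ i) y \<in> A i} \<in> iterated_cover Z T \<U> n"
          unfolding iterated_cover_def using A by blast
        then show "z \<in> \<Union>(iterated_cover Z T \<U> n)"
          using z A by blast
      qed
      fix W u v assume W: "W \<in> iterated_cover Z T \<U> n" and uv: "u \<in> F" "v \<in> F" "u \<in> W" "v \<in> W"
      from W obtain A where "W = {y \<in> topspace Z. \<forall>i<n. (T ^^ i) y \<in> A i}" "\<forall>i<n. A i \<in> \<U>"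
        by (auto simp: iterated_cover_def)
      then have "\<forall>i<n. \<exists>U\<in>\<U>. (T ^^ i) u \<in> U \<and> (T ^^ i) v \<in> U" using uv by auto
      then show "u = v" using F(3) uv(1,2) by blast
    qed
    then show ?thesis using F(2) by linarith
  qed
  have lim: "(\<lambda>n. ereal ((\<delta> * real n - C) * ln 2 / real n)) \<longlonglongrightarrow> ereal (\<delta> * ln 2)"
  proof -
    have "(\<lambda>n. (\<delta> - C * (1 / real n)) * ln 2) \<longlonglongrightarrow> (\<delta> - C * 0) * ln 2"
      by (intro tendsto_intros lim_1_over_n)
    moreover have "\<forall>\<^sub>F n in sequentially. (\<delta> - C * (1 / real n)) * ln 2 = (\<delta> * real n - C) * ln 2 / real n"
      using eventually_gt_at_top[of 0] by eventually_elim (simp add: field_simps)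
    ultimately have "(\<lambda>n. (\<delta> * real n - C) * ln 2 / real n) \<longlonglongrightarrow> (\<delta> - C * 0) * ln 2"
      by (rule Lim_transform_eventually)
    then show ?thesis by simp
  qed
  have "0 < ereal (\<delta> * ln 2)" using d by simp
  also have "\<dots> = limsup (\<lambda>n. ereal ((\<delta> * real n - C) * ln 2 / real n))"
    using lim_imp_Limsup[OF _ lim] by simp
  also have "\<dots> \<le> limsup (\<lambda>n. ereal (ln (real (?N n)) / real n))"
  proof (intro Limsup_mono always_eventually allI)
    fix n
    have "ln (2 powr (\<delta> * real n - C)) \<le> ln (real (?N n))"
    proof -
      have "0 < 2 powr (\<delta> * real n - C)" by simp
      then show ?thesis using N[of n] by (simp only: ln_mono)
    qed
    then have "(\<delta> * real n - C) * ln 2 \<le> ln (real (?N n))" by (simp add: ln_powr)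
    then show "ereal ((\<delta> * real n - C) * ln 2 / real n) \<le> ereal (ln (real (?N n)) / real n)"
      by (simp add: divide_right_mono)
  qed
  also have "\<dots> \<le> topological_entropy Z T"
    unfolding topological_entropy_def using cov by (intro SUP_upper) simp
  finally show ?thesis .
qed

context time_change
begin

text \<open>The free symbols sit at the positions \<open>pos j\<close>, of at most linear growth, and the flow passes the
  position \<open>l\<close> before the clock time \<open>(l + 1) D + 1\<close>. So up to the time \<open>n\<close> about \<open>n / (K D)\<close> free symbols
  are seen.\<close>

lemma entropy_pos_of_itineraries:
  fixes T :: "(real \<times> 'a) set \<Rightarrow> (real \<times> 'a) set" and K :: nat
  assumes L: "closedin X L0" "closedin X L1" "L0 \<inter> L1 = {}"
    and T: "\<And>z. z \<in> topspace Y \<Longrightarrow> T z \<in> topspace Y"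
    and pt: "\<And>b. pt b \<in> M" "\<And>b i. (T ^^ i) (P 0 (pt b)) = P (\<sigma> (real i) (pt b)) (pt b)"
    and pos: "\<And>j. pos j \<le> K * Suc j" and K: "0 < K"
    and itinerary: "\<And>b j. it (int (pos j)) (pt b) \<in> (if b j then L1 else L0)"
  shows "0 < topological_entropy Y T"
proof -
  obtain \<U> D where \<U>: "finite \<U>" "open_cover Y \<U>" and D: "0 < D"
    and sync: "\<And>n x x' l. x \<in> M \<Longrightarrow> x' \<in> M \<Longrightarrow>
       (\<And>i. i < n \<Longrightarrow> \<exists>U\<in>\<U>. P (\<sigma> (real i) x) x \<in> U \<and> P (\<sigma> (real i) x') x' \<in> U) \<Longrightarrow>
       (real l + 1) * D \<le> real n - 1 \<Longrightarrow>
       \<not> (it (int l) x \<in> L0 \<and> it (int l) x' \<in> L1) \<and> \<not> (it (int l) x \<in> L1 \<and> it (int l) x' \<in> L0)"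
    by (fact synchronising_cover[OF L])
  define \<delta> where "\<delta> = 1 / (real K * D)"
  define C where "C = \<delta> + 1 / real K + 1"
  have d: "0 < \<delta>" using K D by (simp add: \<delta>_def)
  show ?thesis
  proof (rule topological_entropy_pos[OF \<U> T d, where C=C])
    fix n
    define l where "l = nat \<lfloor>((real n - 1) / D - 1) / real K\<rfloor>"
    let ?E = "(\<lambda>A. P 0 (pt (\<lambda>j. j \<in> A))) ` Pow {..<l}"
    have step: "A = A'" if A: "A \<in> Pow {..<l}" "A' \<in> Pow {..<l}"
      and same: "\<And>i. i < n \<Longrightarrow> \<exists>U\<in>\<U>. (T ^^ i) (P 0 (pt (\<lambda>j. j \<in> A))) \<in> U \<and> (T ^^ i) (P 0 (pt (\<lambda>j. j \<in> A'))) \<in> U"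
      for A A'
    proof -
      have "j \<in> A \<longleftrightarrow> j \<in> A'" if j: "j < l" for j
      proof -
        have "0 < l" using j by simp
        then have "0 \<le> \<lfloor>((real n - 1) / D - 1) / real K\<rfloor>" unfolding l_def by linarith
        then have "real l \<le> ((real n - 1) / D - 1) / real K"
          unfolding l_def by linarith
        then have "real K * real l + 1 \<le> (real n - 1) / D" using K by (simp add: field_simps)
        moreover have "real (pos j) \<le> real K * real l"
        proof -
          have "pos j \<le> K * l" using pos[of j] j by (meson Suc_leI le_trans mult_le_mono2)
          then show ?thesis by (metis of_nat_le_iff of_nat_mult)
        qed
        ultimately have "(real (pos j) + 1) \<le> (real n - 1) / D" by linarith
        then have "(real (pos j) + 1) * D \<le> real n - 1" using D by (simp add: pos_le_divide_eq)
        from sync[OF pt(1) pt(1) _ this, of "\<lambda>j. j \<in> A" "\<lambda>j. j \<in> A'"] same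
        have "\<not> (it (int (pos j)) (pt (\<lambda>j. j \<in> A)) \<in> L0 \<and> it (int (pos j)) (pt (\<lambda>j. j \<in> A')) \<in> L1) \<and>
            \<not> (it (int (pos j)) (pt (\<lambda>j. j \<in> A)) \<in> L1 \<and> it (int (pos j)) (pt (\<lambda>j. j \<in> A')) \<in> L0)"
          unfolding pt(2) by blast
        then show ?thesis
          using itinerary[of j "\<lambda>j. j \<in> A"] itinerary[of j "\<lambda>j. j \<in> A'"] by (auto split: if_splits)
      qed
      then show ?thesis using A by auto
    qed
    have Ti: "(T ^^ i) z \<in> topspace Y" if "z \<in> topspace Y" for i z
      using that T by (induction i) auto
    have sub: "?E \<subseteq> topspace Y" using P_in pt(1) by blast
    have "inj_on (\<lambda>A. P 0 (pt (\<lambda>j. j \<in> A))) (Pow {..<l})"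
    proof (rule inj_onI)
      fix A A' assume A: "A \<in> Pow {..<l}" "A' \<in> Pow {..<l}" "P 0 (pt (\<lambda>j. j \<in> A)) = P 0 (pt (\<lambda>j. j \<in> A'))"
      show "A = A'"
      proof (rule step[OF A(1,2)])
        fix i
        have "(T ^^ i) (P 0 (pt (\<lambda>j. j \<in> A'))) \<in> \<Union>\<U>"
          using Ti[OF P_in[OF pt(1)]] \<U>(2) unfolding open_cover_def by (meson subsetD)
        then show "\<exists>U\<in>\<U>. (T ^^ i) (P 0 (pt (\<lambda>j. j \<in> A))) \<in> U \<and> (T ^^ i) (P 0 (pt (\<lambda>j. j \<in> A'))) \<in> U"
          unfolding A(3) by blast
      qed
    qed
    then have "card ?E = 2 ^ l" by (simp add: card_image card_Pow)
    moreover have "2 powr (\<delta> * real n - C) \<le> 2 powr real l"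
    proof -
      have "\<delta> * real n - C = ((real n - 1) / D - 1) / real K - 1"
        using D K by (simp add: C_def \<delta>_def field_simps)
      also have "\<dots> \<le> real l" unfolding l_def by linarith
      finally show ?thesis by simp
    qed
    ultimately have "2 powr (\<delta> * real n - C) \<le> real (card ?E)" by (simp add: powr_realpow)
    moreover have "u = v" if uv: "u \<in> ?E" "v \<in> ?E" "\<forall>i<n. \<exists>U\<in>\<U>. (T ^^ i) u \<in> U \<and> (T ^^ i) v \<in> U" for u v
    proof -
      obtain A A' where "A \<in> Pow {..<l}" "A' \<in> Pow {..<l}" "u = P 0 (pt (\<lambda>j. j \<in> A))" "v = P 0 (pt (\<lambda>j. j \<in> A'))"
        using uv(1,2) by blast
      then show ?thesis using uv(3) step[of A A'] by simp
    qed
    ultimately show "\<exists>E\<subseteq>topspace Y. 2 powr (\<delta> * real n - C) \<le> real (card E) \<and>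
       (\<forall>u\<in>E. \<forall>v\<in>E. (\<forall>i<n. \<exists>U\<in>\<U>. (T ^^ i) u \<in> U \<and> (T ^^ i) v \<in> U) \<longrightarrow> u = v)"
      using sub by (intro exI[of _ ?E] conjI ballI impI)
  qed
qed

end

section \<open>A horseshoe that avoids the zeros of the brake\<close>

text \<open>The mechanical word of slope \<open>\<theta>\<close>.\<close>

definition rotation_word :: "real \<Rightarrow> nat \<Rightarrow> bool" where
  "rotation_word \<theta> j \<longleftrightarrow> \<lfloor>real (Suc j) * \<theta>\<rfloor> \<noteq> \<lfloor>real j * \<theta>\<rfloor>"

lemma rotation_word_balanced:
  assumes "0 < \<theta>" "\<theta> < 1"
  shows "\<bar>(\<Sum>j<l. of_bool (rotation_word \<theta> (m + j))) - real l * \<theta>\<bar> \<le> 1"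
proof -
  have step: "of_bool (rotation_word \<theta> j) = real_of_int \<lfloor>real (Suc j) * \<theta>\<rfloor> - real_of_int \<lfloor>real j * \<theta>\<rfloor>" for j
  proof -
    have "\<lfloor>real j * \<theta>\<rfloor> \<le> \<lfloor>real (Suc j) * \<theta>\<rfloor>"
      using assms by (intro floor_mono mult_right_mono) auto
    moreover have "\<lfloor>real (Suc j) * \<theta>\<rfloor> \<le> \<lfloor>real j * \<theta> + 1\<rfloor>"
      using assms by (intro floor_mono) (simp add: algebra_simps)
    ultimately have "\<lfloor>real (Suc j) * \<theta>\<rfloor> = \<lfloor>real j * \<theta>\<rfloor> \<or> \<lfloor>real (Suc j) * \<theta>\<rfloor> = \<lfloor>real j * \<theta>\<rfloor> + 1"
      by linarith
    then show ?thesis unfolding rotation_word_def by auto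
  qed
  have "(\<Sum>j<l. of_bool (rotation_word \<theta> (m + j))) = real_of_int \<lfloor>real (m + l) * \<theta>\<rfloor> - real_of_int \<lfloor>real m * \<theta>\<rfloor>"
    by (induction l) (simp_all add: step)
  moreover have "real (m + l) * \<theta> = real m * \<theta> + real l * \<theta>" by (simp add: algebra_simps)
  ultimately show ?thesis by linarith
qed

text \<open>Points whose symbols at the even times have frequency \<open>\<theta>\<close>, uniformly over all
  intervals of time. These sets are closed, invariant under \<open>G \<circ> G\<close> and disjoint for distinct
  \<open>\<theta>\<close>, and the symbols at the odd times are free.\<close>

definition balanced_points :: "'a topology \<Rightarrow> ('a \<Rightarrow> 'a) \<Rightarrow> 'a set \<Rightarrow> ('a \<Rightarrow> real) \<Rightarrow> real \<Rightarrow> 'a set" where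
  "balanced_points X G L \<eta> \<theta> = {x \<in> topspace X. (\<forall>i. (G ^^ i) x \<in> L) \<and>
     (\<forall>m l. \<bar>(\<Sum>j<l. \<eta> ((G ^^ (2 * (m + j))) x)) - real l * \<theta>\<bar> \<le> 1)}"

lemma closedin_balanced_points:
  assumes G: "continuous_map X X G" and L: "closedin X L" and \<eta>: "continuous_map X euclideanreal \<eta>"
  shows "closedin X (balanced_points X G L \<eta> \<theta>)"
proof -
  have 1: "closedin X {x \<in> topspace X. (G ^^ i) x \<in> L}" for i
    using continuous_map_funpow[OF G] L by (rule closedin_continuous_map_preimage)
  have c: "continuous_map X euclideanreal (\<lambda>x. \<eta> ((G ^^ i) x))" for i
    using continuous_map_compose[OF continuous_map_funpow[OF G] \<eta>] by (simp add: o_def)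
  have 2: "closedin X {x \<in> topspace X. \<bar>(\<Sum>j<l. \<eta> ((G ^^ (2 * (m + j))) x)) - real l * \<theta>\<bar> \<in> {..1}}" for m l
  proof (rule closedin_continuous_map_preimage[where Y=euclideanreal])
    show "continuous_map X euclideanreal (\<lambda>x. \<bar>(\<Sum>j<l. \<eta> ((G ^^ (2 * (m + j))) x)) - real l * \<theta>\<bar>)"
      by (intro continuous_map_real_abs continuous_map_diff continuous_map_sum c) auto
  qed simp
  have "balanced_points X G L \<eta> \<theta> = (\<Inter>i. {x \<in> topspace X. (G ^^ i) x \<in> L}) \<inter>
     (\<Inter>m. \<Inter>l. {x \<in> topspace X. \<bar>(\<Sum>j<l. \<eta> ((G ^^ (2 * (m + j))) x)) - real l * \<theta>\<bar> \<in> {..1}})"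
    by (auto simp: balanced_points_def)
  moreover have "closedin X \<dots>"
    using 1 2 by (intro closedin_Int closedin_INT) auto
  ultimately show ?thesis by simp
qed

lemma balanced_points_invariant:
  assumes G: "continuous_map X X G" and x: "x \<in> balanced_points X G L \<eta> \<theta>"
  shows "(G ^^ (2 * n)) x \<in> balanced_points X G L \<eta> \<theta>"
proof -
  have "(G ^^ (2 * n)) x \<in> topspace X"
    using continuous_map_funpow[OF G] x by (auto simp: balanced_points_def continuous_map_def)
  moreover have "(G ^^ i) ((G ^^ (2 * n)) x) \<in> L" for i
  proof -
    have "(G ^^ (i + 2 * n)) x \<in> L" using x unfolding balanced_points_def by blast
    then show ?thesis by (simp only: funpow_add o_apply)
  qed
  moreover have "\<bar>(\<Sum>j<l. \<eta> ((G ^^ (2 * (m + j))) ((G ^^ (2 * n)) x))) - real l * \<theta>\<bar> \<le> 1" for m l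
  proof -
    have "(G ^^ (2 * (m + j))) ((G ^^ (2 * n)) x) = (G ^^ (2 * ((m + n) + j))) x" for j
    proof -
      have "2 * ((m + n) + j) = 2 * (m + j) + 2 * n" by simp
      then show ?thesis by (simp only: funpow_add o_apply)
    qed
    then show ?thesis using x unfolding balanced_points_def by (simp only:) blast
  qed
  ultimately show ?thesis unfolding balanced_points_def by blast
qed

lemma balanced_points_disjoint:
  assumes "x \<in> balanced_points X G L \<eta> \<theta>" "x \<in> balanced_points X G L \<eta> \<theta>'"
  shows "\<theta> = \<theta>'"
proof (rule ccontr)
  assume "\<theta> \<noteq> \<theta>'"
  then obtain l where l: "2 < real l * \<bar>\<theta> - \<theta>'\<bar>"
    using reals_Archimedean3[of "\<bar>\<theta> - \<theta>'\<bar>"] by auto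
  let ?s = "\<Sum>j<l. \<eta> ((G ^^ (2 * (0 + j))) x)"
  have "\<bar>?s - real l * \<theta>\<bar> \<le> 1" "\<bar>?s - real l * \<theta>'\<bar> \<le> 1"
    using assms unfolding balanced_points_def by blast+
  then have "\<bar>real l * (\<theta> - \<theta>')\<bar> \<le> 2" by (simp add: algebra_simps)
  then show False using l by (simp add: abs_mult)
qed

lemma uncountable_family_avoids_countable:
  fixes K :: "real \<Rightarrow> 'a set"
  assumes N: "countable N" and disj: "\<And>x s t. x \<in> K s \<Longrightarrow> x \<in> K t \<Longrightarrow> s = t"
  obtains t where "0 < t" "t < 1" "K t \<inter> N = {}"
proof -
  define B where "B = {t. K t \<inter> N \<noteq> {}}"
  have "\<forall>t\<in>B. \<exists>x. x \<in> K t \<inter> N" by (auto simp: B_def)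
  then obtain h where h: "\<And>t. t \<in> B \<Longrightarrow> h t \<in> K t \<inter> N" by metis
  have "inj_on h B"
  proof (rule inj_onI)
    fix s t assume "s \<in> B" "t \<in> B" "h s = h t"
    then show "s = t" using h[of s] h[of t] disj[of "h s" s t] by simp
  qed
  moreover have "countable (h ` B)" using N h by (auto intro: countable_subset)
  ultimately have "countable B" using countable_image_inj_on by blast
  then have "\<not> {0<..<1::real} \<subseteq> B"
    using uncountable_open_interval[of 0 "1::real"] countable_subset by auto
  then show thesis using that by (auto simp: B_def)
qed

text \<open>Moving the base point by a multiple of \<open>N\<close> iterates shortens the time to one below the sum of \<open>N\<close> roofs.\<close>

lemma (in suspension) forward_orbit_compact:
  assumes N: "0 < (N :: nat)" and inv: "\<And>x i. x \<in> K \<Longrightarrow> it (int (N * i)) x \<in> K" and K: "K \<subseteq> M"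
  shows "\<exists>C. \<forall>x\<in>K. \<forall>v\<ge>0. P v x \<in> (\<lambda>q. P (fst q) (snd q)) ` ({0..C} \<times> K)"
proof -
  have "compact (S (int N) ` M)"
    using image_compactin[OF _ cont_S, of M "int N"] compact_X by (simp add: compact_space_def)
  then obtain C where C: "\<And>x. x \<in> M \<Longrightarrow> S (int N) x \<le> C"
    using compact_imp_bounded bounded_imp_bdd_above by (metis bdd_above.E imageI)
  have "P v x \<in> (\<lambda>q. P (fst q) (snd q)) ` ({0..C} \<times> K)" if x: "x \<in> K" and v: "0 \<le> v" for x v
  proof -
    have xM: "x \<in> M" using x K by blast
    obtain n where n: "S n x \<le> v" "v < S (n + 1) x" by (rule S_bracket[OF xM])
    have n0: "0 \<le> n"
    proof (rule ccontr)
      assume "\<not> 0 \<le> n"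
      then have "S (n + 1) x \<le> S 0 x" by (intro S_mono[OF xM]) simp
      then show False using n v by simp
    qed
    define i where "i = nat n div N"
    have i: "int (N * i) \<le> n" "n + 1 \<le> int (N * i) + int N"
    proof -
      have "N * i \<le> nat n" "nat n < N * i + N"
        using N by (simp_all add: i_def) (metis add.commute dividend_less_div_times mult.commute)
      then show "int (N * i) \<le> n" "n + 1 \<le> int (N * i) + int N" using n0 by linarith+
    qed
    let ?y = "it (int (N * i)) x" and ?u = "v - S (int (N * i)) x"
    have "S (int (N * i)) x \<le> S n x" "S (n + 1) x \<le> S (int N + int (N * i)) x"
      using i by (auto intro!: S_mono[OF xM])
    moreover have "S (int N) ?y = S (int N + int (N * i)) x - S (int (N * i)) x" by (rule S_add[OF xM])
    moreover have "S (int N) ?y \<le> C" by (rule C[OF it_in[OF xM]])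
    ultimately have "?u \<in> {0..C}" using n by simp
    moreover have "P v x = P ?u ?y" by (rule P_deck[OF xM, symmetric])
    ultimately show ?thesis using inv[OF x, of i] by (intro image_eqI[of _ _ "(?u, ?y)"]) auto
  qed
  then show ?thesis by blast
qed

text \<open>Only for countably many \<open>\<theta>\<close> does the set of balanced points meet an orbit that carries a zero of the
  brake. For one of the other \<open>\<theta>\<close> the brake is cut off at its minimum over the forward flow lines.\<close>

lemma horseshoe_imp_flow_entropy_pos:
  assumes cpt: "compact_space X" and haus: "Hausdorff_space X" and f: "f \<in> Homeo X"
    and k: "0 < k" and hs: "horseshoe X (f ^^ k) Q W p a m b"
    and r: "roof_function X r" and \<alpha>: "brake X f r \<alpha>"
  shows "0 < flow_entropy (susp_space X f r) (pseudo_singular_flow X f r \<alpha>)"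
proof -
  interpret suspension X f r using cpt f r by unfold_locales
  interpret H: horseshoe X "f ^^ k" Q W p a m b by (rule hs)
  define G where "G = f ^^ k"
  have fc: "continuous_map X X f"
    using f by (auto simp: Homeo_def homeomorphic_eq_everything_map)
  have G: "continuous_map X X G" unfolding G_def using fc by (rule continuous_map_funpow)
  have Git: "(G ^^ i) x = it (int (k * i)) x" for i x
    unfolding G_def funpow_mult it_nat by (simp add: mult.commute)
  define L0 L1 where "L0 = H.strip False" and "L1 = H.strip True"
  have L: "closedin X L0" "closedin X L1" "L0 \<inter> L1 = {}"
    using H.closedin_strip G H.strip_disjoint by (auto simp: L0_def L1_def G_def)
  obtain \<eta> where \<eta>: "continuous_map X (top_of_set {0..1::real}) \<eta>" "\<eta> ` L0 \<subseteq> {0}" "\<eta> ` L1 \<subseteq> {1}"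
  proof (rule Urysohn_lemma[of X L0 L1 0 "1::real"])
    show "normal_space X"
      using cpt haus compact_Hausdorff_or_regular_imp_normal_space by blast
  qed (use L in \<open>auto simp: disjnt_def\<close>)
  have \<eta>c: "continuous_map X euclideanreal \<eta>"
    using \<eta>(1) continuous_map_into_fulltopology by blast
  define K where "K = balanced_points X G (L0 \<union> L1) \<eta>"
  have "\<exists>pt. \<forall>b. pt b \<in> K \<theta> \<and> (\<forall>j. (G ^^ (2 * j + 1)) (pt b) \<in> (if b j then L1 else L0))"
    if \<theta>: "0 < \<theta>" "\<theta> < 1" for \<theta>
  proof (rule choice, rule allI)
    fix b :: "nat \<Rightarrow> bool"
    define \<omega> where "\<omega> i = (if even i then rotation_word \<theta> (i div 2) else b (i div 2))" for i
    obtain x where x: "x \<in> M" "\<And>i. (G ^^ i) x \<in> H.strip (\<omega> i)"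
      using H.itinerary_exists[OF _ cpt, of \<omega>] G unfolding G_def by blast
    have xL: "(G ^^ i) x \<in> (if \<omega> i then L1 else L0)" for i
      using x(2)[of i] by (cases "\<omega> i") (auto simp: L0_def L1_def)
    have \<eta>_eq: "\<eta> ((G ^^ (2 * j)) x) = of_bool (rotation_word \<theta> j)" for j
      using xL[of "2 * j"] \<eta>(2,3) by (auto simp: \<omega>_def split: if_splits)
    have "\<bar>(\<Sum>j<l. \<eta> ((G ^^ (2 * (m + j))) x)) - real l * \<theta>\<bar> \<le> 1" for m l
      using rotation_word_balanced[OF \<theta>] by (simp only: \<eta>_eq)
    moreover have "(G ^^ i) x \<in> L0 \<union> L1" for i using xL[of i] by (auto split: if_splits)
    ultimately have "x \<in> K \<theta>"
      using x(1) by (simp add: K_def balanced_points_def)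
    moreover have "(G ^^ (2 * j + 1)) x \<in> (if b j then L1 else L0)" for j
      using xL[of "2 * j + 1"] by (simp add: \<omega>_def)
    ultimately show "\<exists>x. x \<in> K \<theta> \<and> (\<forall>j. (G ^^ (2 * j + 1)) x \<in> (if b j then L1 else L0))" by blast
  qed
  note points = this
  define Z where "Z = {z \<in> topspace Y. \<alpha> z = 0}"
  have \<alpha>c: "continuous_map Y euclideanreal \<alpha>" and \<alpha>0: "\<And>z. z \<in> topspace Y \<Longrightarrow> 0 \<le> \<alpha> z" and Z: "countable Z"
    using \<alpha> by (auto simp: brake_def Z_def Let_def)
  have "\<forall>z\<in>Z. \<exists>y. y \<in> M \<and> (\<exists>u. z = P u y)"
    using topspace_Y unfolding Z_def by (metis (no_types, lifting) mem_Collect_eq)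
  then obtain y where y: "\<And>z. z \<in> Z \<Longrightarrow> y z \<in> M \<and> (\<exists>u. z = P u (y z))" by metis
  define N where "N = (\<Union>z\<in>Z. range (\<lambda>n. it n (y z)))"
  have "countable N" unfolding N_def using Z by auto
  then obtain \<theta> where \<theta>: "0 < \<theta>" "\<theta> < 1" and KN: "K \<theta> \<inter> N = {}"
    using uncountable_family_avoids_countable[of N K] balanced_points_disjoint unfolding K_def by metis
  have KM: "K \<theta> \<subseteq> M" by (auto simp: K_def balanced_points_def)
  have "\<alpha> (P u x) \<noteq> 0" if x: "x \<in> K \<theta>" for u x
  proof
    assume "\<alpha> (P u x) = 0"
    have xM: "x \<in> M" using x KM by blast
    then have z: "P u x \<in> Z" using P_in \<open>\<alpha> (P u x) = 0\<close> by (simp add: Z_def)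
    from y[OF z] obtain u' where "P u' (y (P u x)) = P u x" "y (P u x) \<in> M" by metis
    then obtain n where "x = it n (y (P u x))" using P_eqD xM by metis
    then have "x \<in> N" using z unfolding N_def by blast
    then show False using x KN by blast
  qed
  then have pos: "0 < \<alpha> (P u x)" if "x \<in> K \<theta>" for u x
    using that KM \<alpha>0[OF P_in, of x u] by (metis less_eq_real_def subsetD)
  have inv: "it (int (2 * k * i)) x \<in> K \<theta>" if "x \<in> K \<theta>" for x i
    using balanced_points_invariant[OF G, of x "L0 \<union> L1" \<eta> \<theta> i] that Git[of "2 * i" x]
    by (simp add: K_def mult.assoc mult.left_commute)
  have k2: "0 < 2 * k" using k by simp
  obtain C where C: "\<And>x v. x \<in> K \<theta> \<Longrightarrow> 0 \<le> v \<Longrightarrow> P v x \<in> (\<lambda>q. P (fst q) (snd q)) ` ({0..C} \<times> K \<theta>)"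
    using forward_orbit_compact[OF k2 inv KM] by blast
  define F where "F = (\<lambda>q. P (fst q) (snd q)) ` ({0..C} \<times> K \<theta>)"
  have "closedin X (K \<theta>)"
    unfolding K_def using L by (intro closedin_balanced_points G \<eta>c) auto
  then have "compactin X (K \<theta>)" using cpt closedin_compact_space by blast
  then have "compactin Y F" unfolding F_def by (rule compact_P_image)
  then have "compact (\<alpha> ` F)" using image_compactin \<alpha>c by fastforce
  obtain pt where pt: "\<And>b. pt b \<in> K \<theta>" "\<And>b j. (G ^^ (2 * j + 1)) (pt b) \<in> (if b j then L1 else L0)"
    using points[OF \<theta>] by blast
  have "P 0 (pt (\<lambda>_. True)) \<in> F" unfolding F_def by (rule C[OF pt(1)]) simp
  then have "\<alpha> ` F \<noteq> {}" by blast
  from compact_attains_inf[OF \<open>compact (\<alpha> ` F)\<close> this]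
  obtain c where "c \<in> \<alpha> ` F" and cF: "\<And>z. z \<in> F \<Longrightarrow> c \<le> \<alpha> z" by auto
  then have c: "0 < c" using pos unfolding F_def by auto
  have "compact (\<alpha> ` topspace Y)"
    using image_compactin[OF _ \<alpha>c, of "topspace Y"] compact_Y by (simp add: compact_space_def)
  then have "bdd_above (\<alpha> ` topspace Y)" by (intro bounded_imp_bdd_above compact_imp_bounded)
  then obtain A where A: "\<And>z. z \<in> topspace Y \<Longrightarrow> \<alpha> z \<le> A" by (auto simp: bdd_above_def)
  define \<beta> where "\<beta> z = max c (\<alpha> z)" for z
  interpret T: time_change X f r \<beta> c "max c A"
  proof unfold_locales
    show "continuous_map Y euclideanreal \<beta>"
      unfolding \<beta>_def using \<alpha>c by (intro continuous_map_real_max) auto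
    show "0 < c" by (rule c)
    show "c \<le> \<beta> z \<and> \<beta> z \<le> max c A" if "z \<in> topspace Y" for z
      using A[OF that] by (auto simp: \<beta>_def)
  qed
  have eq: "\<alpha> (P v x) = \<beta> (P v x)" if "x \<in> K \<theta>" "0 \<le> v" for x v
    using cF[of "P v x"] C[OF that] by (simp add: \<beta>_def F_def)
  have ptM: "pt b \<in> M" for b using pt(1) KM by blast
  have "0 < topological_entropy Y (pseudo_singular_flow X f r \<alpha> 1)"
  proof (rule T.entropy_pos_of_itineraries[OF L])
    show "pseudo_singular_flow X f r \<alpha> 1 z \<in> topspace Y" if z: "z \<in> topspace Y" for z
    proof -
      obtain s x where x: "x \<in> M" "z = P s x" by (rule topspace_Y[OF z])
      show ?thesis unfolding pseudo_singular_flow_def x(2) P_flow[OF x(1)] by (rule P_in[OF x(1)])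
    qed
    show "pt b \<in> M" for b by (rule ptM)
    show "((pseudo_singular_flow X f r \<alpha> 1) ^^ i) (P 0 (pt b)) = P (T.\<sigma> (real i) (pt b)) (pt b)" for b i
      by (rule T.pseudo_singular_iterate[OF ptM eq[OF pt(1)]])
    show "k * (2 * j + 1) \<le> (2 * k) * Suc j" for j by simp
    show "0 < 2 * k" using k by simp
    show "it (int (k * (2 * j + 1))) (pt b) \<in> (if b j then L1 else L0)" for b j
      using pt(2)[where b=b and j=j] unfolding Git .
  qed
  then show ?thesis by (simp add: flow_entropy_def)
qed

section \<open>Horseshoes survive small perturbations\<close>

locale metrized_compact_space = Metric_space "topspace X" d for X :: "'a topology" and d +
  assumes top: "mtopology = X" and cpt: "compact_space X"
begin

abbreviation "M \<equiv> topspace X"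

lemma openin_iff: "openin X U \<longleftrightarrow> U \<subseteq> M \<and> (\<forall>x\<in>U. \<exists>e>0. mball x e \<subseteq> U)"
  using openin_mtopology[of U] unfolding top by blast

lemma openin_mball_X: "openin X (mball x e)"
  using openin_mball[of x e] by (simp add: top)

text \<open>The induction follows the orbit of one point and uses continuity of \<open>f\<close> only there; compactness
  then gives a uniform \<open>e\<close> for a whole set.\<close>

lemma funpow_near_point:
  assumes f: "continuous_map X X f" and y: "y \<in> M" and U: "openin X U" and fy: "(f ^^ k) y \<in> U"
  shows "\<exists>e>0. \<forall>g x. (\<forall>z\<in>M. g z \<in> M \<and> d (f z) (g z) < e) \<longrightarrow> x \<in> M \<longrightarrow> d y x < e \<longrightarrow> (g ^^ k) x \<in> U"
  using y fy
proof (induction k arbitrary: y)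
  case 0
  then obtain e where "0 < e" "mball y e \<subseteq> U" using U openin_iff by auto
  then show ?case using 0 by (intro exI[of _ e]) (auto simp: in_mball)
next
  case (Suc k)
  have fy: "f y \<in> M" using f Suc.prems by (auto simp: continuous_map_def)
  moreover have "(f ^^ k) (f y) \<in> U" using Suc.prems(2) by (simp add: funpow_swap1)
  ultimately obtain e where e: "0 < e"
      "\<And>g x. (\<forall>z\<in>M. g z \<in> M \<and> d (f z) (g z) < e) \<Longrightarrow> x \<in> M \<Longrightarrow> d (f y) x < e \<Longrightarrow> (g ^^ k) x \<in> U"
    using Suc.IH[of "f y"] by metis
  have "openin X {x \<in> M. f x \<in> mball (f y) (e / 2)}"
    using f openin_mball_X by (rule openin_continuous_map_preimage)
  moreover have "y \<in> {x \<in> M. f x \<in> mball (f y) (e / 2)}" using Suc.prems fy e(1) by simp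
  ultimately obtain \<delta> where \<delta>: "0 < \<delta>" "mball y \<delta> \<subseteq> {x \<in> M. f x \<in> mball (f y) (e / 2)}"
    using openin_iff by meson
  show ?case
  proof (intro exI[of _ "min \<delta> (e / 2)"] conjI allI impI)
    show "0 < min \<delta> (e / 2)" using e \<delta> by simp
    fix g x assume g: "\<forall>z\<in>M. g z \<in> M \<and> d (f z) (g z) < min \<delta> (e / 2)" and x: "x \<in> M" "d y x < min \<delta> (e / 2)"
    have "x \<in> mball y \<delta>" using x Suc.prems(1) by (simp add: in_mball)
    then have fx: "f x \<in> M" "d (f y) (f x) < e / 2" using \<delta>(2) by (auto simp: in_mball)
    have gx: "g x \<in> M" "d (f x) (g x) < e / 2" using g x by auto
    have "d (f y) (g x) \<le> d (f y) (f x) + d (f x) (g x)" using fy fx gx by (intro triangle) auto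
    then have "d (f y) (g x) < e" using fx gx by linarith
    moreover have "\<forall>z\<in>M. g z \<in> M \<and> d (f z) (g z) < e" using g e(1) by fastforce
    ultimately have "(g ^^ k) (g x) \<in> U" using e(2)[of g "g x"] gx by blast
    then show "(g ^^ Suc k) x \<in> U" by (simp add: funpow_swap1)
  qed
qed

lemma funpow_near_compact:
  assumes f: "continuous_map X X f" and K: "closedin X K" and U: "openin X U" and fK: "\<And>x. x \<in> K \<Longrightarrow> (f ^^ k) x \<in> U"
  shows "\<exists>e>0. \<forall>g. (\<forall>z\<in>M. g z \<in> M \<and> d (f z) (g z) < e) \<longrightarrow> (\<forall>x\<in>K. (g ^^ k) x \<in> U)"
proof -
  have KM: "K \<subseteq> M" using K closedin_subset by blast
  define R where "R y e \<longleftrightarrow> (\<forall>g x. (\<forall>z\<in>M. g z \<in> M \<and> d (f z) (g z) < e) \<longrightarrow> x \<in> M \<longrightarrow> d y x < e \<longrightarrow> (g ^^ k) x \<in> U)" for y e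
  have "\<forall>y\<in>K. \<exists>e. 0 < e \<and> R y e"
  proof
    fix y assume y: "y \<in> K"
    then have "y \<in> M" using KM by blast
    from funpow_near_point[OF f this U fK[OF y]] show "\<exists>e. 0 < e \<and> R y e" unfolding R_def .
  qed
  from bchoice[OF this] obtain e where e: "\<And>y. y \<in> K \<Longrightarrow> 0 < e y" "\<And>y. y \<in> K \<Longrightarrow> R y (e y)" by blast
  have "compactin X K" using cpt K closedin_compact_space by blast
  moreover have "\<forall>V\<in>(\<lambda>y. mball y (e y)) ` K. openin X V" using openin_mball_X by blast
  moreover have "K \<subseteq> \<Union>((\<lambda>y. mball y (e y)) ` K)" using e(1) KM by auto
  ultimately have "\<exists>\<F>. finite \<F> \<and> \<F> \<subseteq> (\<lambda>y. mball y (e y)) ` K \<and> K \<subseteq> \<Union>\<F>"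
    unfolding compactin_def by meson
  then obtain \<F> where \<F>: "finite \<F>" "\<F> \<subseteq> (\<lambda>y. mball y (e y)) ` K" "K \<subseteq> \<Union>\<F>" by (elim exE conjE)
  from finite_subset_image[OF \<F>(1,2)] \<F>(3)
  obtain J where J: "finite J" "J \<subseteq> K" "K \<subseteq> (\<Union>y\<in>J. mball y (e y))" by auto
  define \<epsilon> where "\<epsilon> = Min (insert 1 (e ` J))"
  have "0 < \<epsilon>" using J e(1) by (auto simp: \<epsilon>_def)
  moreover have "(g ^^ k) x \<in> U" if g: "\<forall>z\<in>M. g z \<in> M \<and> d (f z) (g z) < \<epsilon>" and x: "x \<in> K" for g x
  proof -
    obtain y where y: "y \<in> J" "x \<in> mball y (e y)" using J(3) x by blast
    then have "\<epsilon> \<le> e y" unfolding \<epsilon>_def using J(1) by (intro Min_le) auto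
    have "\<forall>z\<in>M. g z \<in> M \<and> d (f z) (g z) < e y"
      by (intro ballI conjI) (use g \<open>\<epsilon> \<le> e y\<close> in \<open>blast, meson less_le_trans\<close>)
    moreover have "x \<in> M" "d y x < e y" "y \<in> K" using y J(2) by (auto simp: in_mball)
    ultimately show ?thesis using e(2)[of y] unfolding R_def by blast
  qed
  ultimately show ?thesis by blast
qed

lemma horseshoe_robust:
  assumes f: "continuous_map X X f" and h: "horseshoe X (f ^^ k) Q W p a m b"
  shows "\<exists>e>0. \<forall>g. (\<forall>z\<in>M. g z \<in> M \<and> d (f z) (g z) < e) \<longrightarrow> horseshoe X (g ^^ k) Q W p a m b"
proof -
  interpret H: horseshoe X "f ^^ k" Q W p a m b by (rule h)
  have QM: "Q \<subseteq> M" using H.closed_Q closedin_subset by blast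
  have lev: "closedin X {x \<in> Q. p x = c}" for c
  proof -
    have "closedin X {x \<in> M. p x \<in> {c}}" using H.height by (rule closedin_continuous_map_preimage) simp
    then have "closedin X (Q \<inter> {x \<in> M. p x \<in> {c}})" using H.closed_Q by blast
    moreover have "Q \<inter> {x \<in> M. p x \<in> {c}} = {x \<in> Q. p x = c}" using QM by auto
    ultimately show ?thesis by simp
  qed
  have below: "openin X {x \<in> M. p x \<in> {..<c}}" and above: "openin X {x \<in> M. p x \<in> {c<..}}" for c
    by (rule openin_continuous_map_preimage[OF H.height], simp)+
  have fM: "(f ^^ k) x \<in> M" if "x \<in> Q" for x
    using H.into_W[OF that] openin_subset[OF H.open_W] by blast
  note near = funpow_near_compact[OF f]
  obtain e1 where e1: "0 < e1" "\<And>g x. \<forall>z\<in>M. g z \<in> M \<and> d (f z) (g z) < e1 \<Longrightarrow> x \<in> Q \<Longrightarrow> (g ^^ k) x \<in> W"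
    using near[OF H.closed_Q H.open_W H.into_W] by blast
  have "(f ^^ k) x \<in> {x \<in> M. p x \<in> {..<a}}" if "x \<in> {x \<in> Q. p x = a}" for x
    using that fM H.at_bottom by auto
  from near[OF lev below this] obtain e2 where e2: "0 < e2"
    "\<And>g x. \<forall>z\<in>M. g z \<in> M \<and> d (f z) (g z) < e2 \<Longrightarrow> x \<in> {x \<in> Q. p x = a} \<Longrightarrow> (g ^^ k) x \<in> {x \<in> M. p x \<in> {..<a}}"
    by blast
  have "(f ^^ k) x \<in> {x \<in> M. p x \<in> {b<..}}" if "x \<in> {x \<in> Q. p x = m}" for x
    using that fM H.at_middle by auto
  from near[OF lev above this] obtain e3 where e3: "0 < e3"
    "\<And>g x. \<forall>z\<in>M. g z \<in> M \<and> d (f z) (g z) < e3 \<Longrightarrow> x \<in> {x \<in> Q. p x = m} \<Longrightarrow> (g ^^ k) x \<in> {x \<in> M. p x \<in> {b<..}}"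
    by blast
  have "(f ^^ k) x \<in> {x \<in> M. p x \<in> {..<a}}" if "x \<in> {x \<in> Q. p x = b}" for x
    using that fM H.at_top by auto
  from near[OF lev below this] obtain e4 where e4: "0 < e4"
    "\<And>g x. \<forall>z\<in>M. g z \<in> M \<and> d (f z) (g z) < e4 \<Longrightarrow> x \<in> {x \<in> Q. p x = b} \<Longrightarrow> (g ^^ k) x \<in> {x \<in> M. p x \<in> {..<a}}"
    by blast
  define e where "e = min (min e1 e2) (min e3 e4)"
  show ?thesis
  proof (intro exI[of _ e] conjI allI impI)
    show "0 < e" using e1 e2 e3 e4 by (simp add: e_def)
    fix g assume g: "\<forall>z\<in>M. g z \<in> M \<and> d (f z) (g z) < e"
    have g1: "\<forall>z\<in>M. g z \<in> M \<and> d (f z) (g z) < e1" and g2: "\<forall>z\<in>M. g z \<in> M \<and> d (f z) (g z) < e2"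
      and g3: "\<forall>z\<in>M. g z \<in> M \<and> d (f z) (g z) < e3" and g4: "\<forall>z\<in>M. g z \<in> M \<and> d (f z) (g z) < e4"
      using g by (auto simp: e_def)
    have into: "(g ^^ k) x \<in> W" if "x \<in> Q" for x
      by (rule e1(2)[OF g1 that])
    have bottom: "p ((g ^^ k) x) < a" if "x \<in> Q" "p x = a" for x
      using e2(2)[OF g2, of x] that by simp
    have middle: "b < p ((g ^^ k) x)" if "x \<in> Q" "p x = m" for x
      using e3(2)[OF g3, of x] that by simp
    have top: "p ((g ^^ k) x) < a" if "x \<in> Q" "p x = b" for x
      using e4(2)[OF g4, of x] that by simp
    show "horseshoe X (g ^^ k) Q W p a m b"
      by (rule horseshoe.intro[OF H.closed_Q H.open_W H.height H.levels H.Q_between H.band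
            into bottom middle top H.crossing])
  qed
qed

lemma Homeo_props:
  assumes "f \<in> Homeo X"
  shows Homeo_cont: "continuous_map X X f"
    and Homeo_in: "x \<in> M \<Longrightarrow> f x \<in> M"
    and Homeo_inj: "inj_on f M" and Homeo_image: "f ` M = M"
    and Homeo_inv_in: "x \<in> M \<Longrightarrow> inv_into M f x \<in> M"
    and Homeo_inv_right: "x \<in> M \<Longrightarrow> f (inv_into M f x) = x"
    and Homeo_inv_left: "x \<in> M \<Longrightarrow> inv_into M f (f x) = x"
proof -
  have *: "continuous_map X X f" "inj_on f M" "f ` M = M"
    using assms by (auto simp: Homeo_def homeomorphic_eq_everything_map)
  then show "continuous_map X X f" "inj_on f M" "f ` M = M" by auto
  show "x \<in> M \<Longrightarrow> f x \<in> M" using *(3) by blast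
  show "x \<in> M \<Longrightarrow> inv_into M f x \<in> M" using *(3) by (simp add: inv_into_into)
  show "x \<in> M \<Longrightarrow> f (inv_into M f x) = x" using *(3) by (simp add: f_inv_into_f)
  show "x \<in> M \<Longrightarrow> inv_into M f (f x) = x" using *(2) by simp
qed

lemma diameter_bound: obtains B where "\<And>x y. x \<in> M \<Longrightarrow> y \<in> M \<Longrightarrow> d x y \<le> B"
proof -
  have "mbounded M"
    using cpt top by (metis compactin_imp_mbounded compact_space_def)
  then show thesis using that by (metis mbounded_alt)
qed

lemma dist_le_C0_dist:
  assumes f: "f \<in> Homeo X" and g: "g \<in> Homeo X" and x: "x \<in> M"
  shows "d (f x) (g x) \<le> C0_dist X d f g"
proof -
  obtain B where B: "\<And>x y. x \<in> M \<Longrightarrow> y \<in> M \<Longrightarrow> d x y \<le> B" using diameter_bound by blast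
  have "d (f x) (g x) \<le> (SUP x\<in>M. d (f x) (g x))"
    using x by (intro cSUP_upper bdd_aboveI2[where M=B] B Homeo_in[OF f] Homeo_in[OF g])
  moreover have "d (inv_into M f x) (inv_into M g x) \<le> (SUP x\<in>M. d (inv_into M f x) (inv_into M g x))"
    using x by (intro cSUP_upper bdd_aboveI2[where M=B] B Homeo_inv_in[OF f] Homeo_inv_in[OF g])
  moreover have "0 \<le> d (inv_into M f x) (inv_into M g x)" by simp
  moreover have "C0_dist X d f g = (SUP x\<in>M. d (f x) (g x)) + (SUP x\<in>M. d (inv_into M f x) (inv_into M g x))"
  proof -
    have "M \<noteq> {}" using x by blast
    then show ?thesis unfolding C0_dist_def using f g by (simp only: if_True simp_thms)
  qed
  ultimately show ?thesis by linarith
qed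

lemma C0_dist_le:
  assumes "\<And>x. x \<in> M \<Longrightarrow> d (f x) (g x) \<le> e" "\<And>x. x \<in> M \<Longrightarrow> d (inv_into M f x) (inv_into M g x) \<le> e'" "0 \<le> e + e'"
  shows "C0_dist X d f g \<le> e + e'"
proof (cases "f \<in> Homeo X \<and> g \<in> Homeo X \<and> M \<noteq> {}")
  case True
  then have "(SUP x\<in>M. d (f x) (g x)) \<le> e" "(SUP x\<in>M. d (inv_into M f x) (inv_into M g x)) \<le> e'"
    using assms by (auto intro!: cSUP_least)
  then show ?thesis using True by (simp add: C0_dist_def)
qed (use assms in \<open>auto simp: C0_dist_def\<close>)

lemma C0_Metric_space: "Metric_space (Homeo X) (C0_dist X d)"
  using Metric_space_C0_dist[OF Metric_space_axioms top cpt] .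

definition horseshoe_maps :: "('a \<Rightarrow> 'a) set" where
  "horseshoe_maps = {f \<in> Homeo X. \<exists>k>0. \<exists>Q W p a m b. horseshoe X (f ^^ k) Q W p a m b}"

lemma openin_horseshoe_maps: "openin (C0_topology X d) horseshoe_maps"
proof -
  interpret C: Metric_space "Homeo X" "C0_dist X d" by (rule C0_Metric_space)
  show ?thesis
    unfolding C0_topology_def C.openin_mtopology
  proof (intro conjI ballI allI impI)
    fix f assume "f \<in> horseshoe_maps"
    then obtain k Q W p a m b where f: "f \<in> Homeo X" and k: "0 < k" and h: "horseshoe X (f ^^ k) Q W p a m b"
      by (auto simp: horseshoe_maps_def)
    obtain e where e: "0 < e"
      "\<And>g. \<forall>z\<in>M. g z \<in> M \<and> d (f z) (g z) < e \<Longrightarrow> horseshoe X (g ^^ k) Q W p a m b"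
      using horseshoe_robust[OF Homeo_cont[OF f] h] by blast
    have "C.mball f e \<subseteq> horseshoe_maps"
    proof
      fix g assume g: "g \<in> C.mball f e"
      then have gH: "g \<in> Homeo X" "C0_dist X d f g < e" by (auto simp: C.in_mball)
      have "\<forall>z\<in>M. g z \<in> M \<and> d (f z) (g z) < e"
      proof (intro ballI conjI)
        fix z assume z: "z \<in> M"
        show "g z \<in> M" using Homeo_in[OF gH(1) z] .
        show "d (f z) (g z) < e" using dist_le_C0_dist[OF f gH(1) z] gH(2) by linarith
      qed
      then have "horseshoe X (g ^^ k) Q W p a m b" by (rule e(2))
      then show "g \<in> horseshoe_maps" using gH k unfolding horseshoe_maps_def by blast
    qed
    then show "\<exists>r>0. C.mball f r \<subseteq> horseshoe_maps" using e(1) by blast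
  qed (auto simp: horseshoe_maps_def)
qed

end

section \<open>Folding an embedded box in the cube\<close>

text \<open>Points are sequences that vanish from \<open>n\<close> on, as in \<^term>\<open>Euclidean_space n\<close>, so that the dimension
  may be an arbitrary number.\<close>

definition cube :: "nat \<Rightarrow> (nat \<Rightarrow> real) set" where
  "cube n = {x. (\<forall>i<n. \<bar>x i\<bar> \<le> 1) \<and> (\<forall>i\<ge>n. x i = 0)}"

definition open_box :: "nat \<Rightarrow> real \<Rightarrow> (nat \<Rightarrow> real) set" where
  "open_box n \<kappa> = {x. (\<forall>i<n. \<bar>x i\<bar> < \<kappa>) \<and> (\<forall>i\<ge>n. x i = 0)}"

definition closed_box :: "nat \<Rightarrow> real \<Rightarrow> (nat \<Rightarrow> real) set" where
  "closed_box n \<kappa> = {x. (\<forall>i<n. \<bar>x i\<bar> \<le> \<kappa>) \<and> (\<forall>i\<ge>n. x i = 0)}"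

definition cube_homeos :: "nat \<Rightarrow> ((nat \<Rightarrow> real) \<Rightarrow> nat \<Rightarrow> real) set" where
  "cube_homeos n = {h. continuous_on (cube n) h \<and> bij_betw h (cube n) (cube n) \<and>
     (\<forall>x\<in>cube n. (\<exists>i<n. \<bar>x i\<bar> = 1) \<longrightarrow> h x = x)}"

lemma compact_cube: "compact (cube n)"
proof -
  have "compactin (product_topology (\<lambda>i. euclideanreal) UNIV) (\<Pi>\<^sub>E i\<in>UNIV. if i < n then {-1..1::real} else {0})"
    by (subst compactin_PiE) auto
  moreover have "(\<Pi>\<^sub>E i\<in>UNIV. if i < n then {-1..1::real} else {0}) = cube n"
    by (auto simp: cube_def PiE_iff abs_le_iff split: if_splits)
  ultimately show ?thesis by (simp add: euclidean_product_topology)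
qed

lemma continuous_on_coord [continuous_intros]: "continuous_on A (\<lambda>x::nat \<Rightarrow> real. x i)"
  by (rule continuous_on_subset[OF continuous_on_product_coordinates]) simp

lemma cube_homeos_id: "(\<lambda>x. x) \<in> cube_homeos n"
  by (auto simp: cube_homeos_def bij_betw_def)

lemma cube_homeos_in: "h \<in> cube_homeos n \<Longrightarrow> x \<in> cube n \<Longrightarrow> h x \<in> cube n"
  by (auto simp: cube_homeos_def bij_betw_def)

lemma cube_homeos_comp:
  assumes "g \<in> cube_homeos n" "h \<in> cube_homeos n"
  shows "(\<lambda>x. g (h x)) \<in> cube_homeos n"
proof -
  have "continuous_on (cube n) (\<lambda>x. g (h x))"
    by (rule continuous_on_compose2[of "cube n" g]) (use assms in \<open>auto simp: cube_homeos_def bij_betw_def\<close>)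
  moreover have "bij_betw (\<lambda>x. g (h x)) (cube n) (cube n)"
    using assms bij_betw_trans[of h "cube n" "cube n" g "cube n"] by (simp add: cube_homeos_def o_def)
  ultimately show ?thesis using assms by (auto simp: cube_homeos_def)
qed

lemma box_mono: "\<kappa> < 1 \<Longrightarrow> closed_box n \<kappa> \<subseteq> cube n" "open_box n \<kappa> \<subseteq> closed_box n \<kappa>"
  by (fastforce simp: closed_box_def open_box_def cube_def)+

text \<open>The piecewise linear function with break points \<open>\<plusminus>\<kappa>\<close>.\<close>

lemma squeeze_function:
  assumes k: "0 < \<kappa>" "\<kappa> < 1" and lh: "-1 < lo" "lo < hi" "hi < 1"
  obtains q :: "real \<Rightarrow> real" where "continuous_on UNIV q" "q (-1) = -1" "q 1 = 1"
    "\<And>s t. -1 \<le> s \<Longrightarrow> s < t \<Longrightarrow> t \<le> 1 \<Longrightarrow> q s < q t"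
    "\<And>s. \<bar>s\<bar> \<le> \<kappa> \<Longrightarrow> lo \<le> q s \<and> q s \<le> hi"
proof -
  define A where "A = (lo + 1) / (1 - \<kappa>)"
  define B where "B = (hi - lo) / (2 * \<kappa>)"
  define C where "C = (1 - hi) / (1 - \<kappa>)"
  have ABC: "0 < A" "0 < B" "0 < C" using assms by (auto simp: A_def B_def C_def)
  define q where "q s = -1 + A * (min s (-\<kappa>) + 1) + B * (max (-\<kappa>) (min s \<kappa>) + \<kappa>) + C * (max s \<kappa> - \<kappa>)" for s
  have e: "A * (1 - \<kappa>) = lo + 1" "B * (2 * \<kappa>) = hi - lo" "C * (1 - \<kappa>) = 1 - hi"
    using assms by (simp_all add: A_def B_def C_def)
  show thesis
  proof (rule that[of q])
    show "continuous_on UNIV q" unfolding q_def by (intro continuous_intros)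
    show "q (-1) = -1" using k by (simp add: q_def)
    have "q 1 = -1 + A * (1 - \<kappa>) + B * (2 * \<kappa>) + C * (1 - \<kappa>)" using k by (simp add: q_def)
    then show "q 1 = 1" by (simp add: e)
    show "q s < q t" if "-1 \<le> s" "s < t" "t \<le> 1" for s t
    proof -
      have 1: "A * (min s (-\<kappa>) + 1) \<le> A * (min t (-\<kappa>) + 1)"
        "B * (max (-\<kappa>) (min s \<kappa>) + \<kappa>) \<le> B * (max (-\<kappa>) (min t \<kappa>) + \<kappa>)"
        "C * (max s \<kappa> - \<kappa>) \<le> C * (max t \<kappa> - \<kappa>)"
        using ABC that by (auto intro!: mult_left_mono)
      consider "s < -\<kappa>" | "-\<kappa> \<le> s" "s < \<kappa>" | "\<kappa> \<le> s" by linarith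
      then show ?thesis
      proof cases
        case 1
        then have "A * (min s (-\<kappa>) + 1) < A * (min t (-\<kappa>) + 1)"
          using ABC that by (intro mult_strict_left_mono) auto
        then show ?thesis using \<open>B * _ \<le> _\<close> \<open>C * _ \<le> _\<close> unfolding q_def by linarith
      next
        case 2
        then have "B * (max (-\<kappa>) (min s \<kappa>) + \<kappa>) < B * (max (-\<kappa>) (min t \<kappa>) + \<kappa>)"
          using ABC that by (intro mult_strict_left_mono) auto
        then show ?thesis using \<open>A * _ \<le> _\<close> \<open>C * _ \<le> _\<close> unfolding q_def by linarith
      next
        case 3
        then have "C * (max s \<kappa> - \<kappa>) < C * (max t \<kappa> - \<kappa>)"
          using ABC that by (intro mult_strict_left_mono) auto
        then show ?thesis using \<open>A * _ \<le> _\<close> \<open>B * _ \<le> _\<close> unfolding q_def by linarith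
      qed
    qed
    show "lo \<le> q s \<and> q s \<le> hi" if "\<bar>s\<bar> \<le> \<kappa>" for s
    proof -
      have "min s (-\<kappa>) = -\<kappa>" "max (-\<kappa>) (min s \<kappa>) = s" "max s \<kappa> = \<kappa>" using that by auto
      then have "q s = -1 + A * (1 - \<kappa>) + B * (s + \<kappa>)" by (simp add: q_def)
      then have "q s = lo + B * (s + \<kappa>)" by (simp add: e)
      moreover have "0 \<le> B * (s + \<kappa>)" using ABC that by (intro mult_nonneg_nonneg) auto
      moreover have "B * (s + \<kappa>) \<le> B * (2 * \<kappa>)" using ABC that by (intro mult_left_mono) auto
      ultimately show ?thesis using e by linarith
    qed
  qed
qed

text \<open>Only the coordinate \<open>i\<close> changes, by a homeomorphism of \<open>[-1,1]\<close> that
  depends continuously on the other coordinates and is the identity where one of these is \<open>\<plusminus>1\<close>.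
  The function \<open>\<tau>\<close> says how strong the squeeze is.\<close>

lemma squeeze_coordinate:
  fixes \<tau> :: "(nat \<Rightarrow> real) \<Rightarrow> real"
  assumes i: "i < n" and k: "0 < \<kappa>" "\<kappa> < 1" and lh: "-\<kappa> < lo" "lo < hi" "hi < \<kappa>"
    and \<tau>: "continuous_on (cube n) \<tau>" "\<And>x. x \<in> cube n \<Longrightarrow> 0 \<le> \<tau> x \<and> \<tau> x \<le> 1"
    and indep: "\<And>x s. \<tau> (x(i := s)) = \<tau> x"
  obtains h where "h \<in> cube_homeos n" "\<And>x. x \<in> cube n \<Longrightarrow> \<exists>w. h x = x(i := w)"
    "\<And>x. x \<in> closed_box n \<kappa> \<Longrightarrow> \<exists>w. lo \<le> w \<and> w \<le> hi \<and> h x = x(i := (1 - \<tau> x) * x i + \<tau> x * w)"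
proof -
  define damp where "damp x = (\<Prod>j\<in>{..<n} - {i}. min 1 ((1 - \<bar>x j\<bar>) / (1 - \<kappa>)))" for x :: "nat \<Rightarrow> real"
  have damp01: "0 \<le> damp x" "damp x \<le> 1" if "x \<in> cube n" for x
    unfolding damp_def using that k
    by (auto intro!: prod_nonneg prod_le_1 simp: cube_def)
  have damp1: "damp x = 1" if "x \<in> closed_box n \<kappa>" for x
    unfolding damp_def
  proof (rule prod.neutral, rule ballI)
    fix j assume "j \<in> {..<n} - {i}"
    then have "1 - \<kappa> \<le> 1 - \<bar>x j\<bar>" using that by (simp add: closed_box_def)
    then show "min 1 ((1 - \<bar>x j\<bar>) / (1 - \<kappa>)) = 1" using k by simp
  qed
  have damp0: "damp x = 0" if "j < n" "j \<noteq> i" "\<bar>x j\<bar> = 1" for x j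
    unfolding damp_def by (rule prod_zero) (use that in \<open>auto intro!: bexI[of _ j]\<close>)
  have damp_indep: "damp (x(i := s)) = damp x" for x s
    unfolding damp_def by (rule prod.cong) auto
  have damp_cont: "continuous_on (cube n) damp"
    unfolding damp_def using k by (intro continuous_intros) auto
  have lo: "-1 < lo" and hi: "hi < 1" using k lh by auto
  obtain q :: "real \<Rightarrow> real" where q: "continuous_on UNIV q" "q (-1) = -1" "q 1 = 1"
    "\<And>s t. -1 \<le> s \<Longrightarrow> s < t \<Longrightarrow> t \<le> 1 \<Longrightarrow> q s < q t"
    "\<And>s. \<bar>s\<bar> \<le> \<kappa> \<Longrightarrow> lo \<le> q s \<and> q s \<le> hi"
    by (fact squeeze_function[OF k lo lh(2) hi])
  define t where "t x = damp x * \<tau> x" for x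
  have t01: "0 \<le> t x" "t x \<le> 1" if "x \<in> cube n" for x
    using damp01[OF that] \<tau>(2)[OF that] by (auto simp: t_def mult_le_one)
  have t_indep: "t (x(i := s)) = t x" for x s by (simp add: t_def damp_indep indep)
  have t_cont: "continuous_on (cube n) t" unfolding t_def by (intro continuous_intros damp_cont \<tau>)
  define e where "e x s = (1 - t x) * s + t x * q s" for x s
  have e_mono: "e x s < e x s'" if "x \<in> cube n" "-1 \<le> s" "s < s'" "s' \<le> 1" for x s s'
  proof (cases "t x = 0")
    case False
    then have "0 < t x" using t01[OF that(1)] by simp
    then have "t x * q s < t x * q s'" using q(4)[of s s'] that by simp
    moreover have "(1 - t x) * s \<le> (1 - t x) * s'" using t01[OF that(1)] that by (intro mult_left_mono) auto
    ultimately show ?thesis unfolding e_def by linarith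
  qed (use that in \<open>simp add: e_def\<close>)
  have e_ends: "e x (-1) = -1" "e x 1 = 1" for x by (simp_all add: e_def q algebra_simps)
  have e_range: "-1 \<le> e x s" "e x s \<le> 1" if "x \<in> cube n" "-1 \<le> s" "s \<le> 1" for x s
    using e_mono[OF that(1), of "-1" s] e_mono[OF that(1), of s 1] e_ends that
    by (cases "s = -1"; cases "s = 1"; simp)+
  have e_cont: "continuous_on UNIV (e x)" for x
    unfolding e_def by (intro continuous_intros q)
  define h where "h x = x(i := e x (x i))" for x
  have xi: "-1 \<le> x i" "x i \<le> 1" if "x \<in> cube n" for x
    using that i by (auto simp: cube_def abs_le_iff minus_le_iff)
  have upd: "x(i := s) \<in> cube n" if "x \<in> cube n" "-1 \<le> s" "s \<le> 1" for x s
    using that i by (auto simp: cube_def)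
  have e_indep: "e (x(i := s)) = e x" for x s by (simp add: e_def t_indep fun_eq_iff)
  have h_in: "h x \<in> cube n" if "x \<in> cube n" for x
    unfolding h_def using upd[OF that] e_range[OF that xi[OF that]] by blast
  have "inj_on h (cube n)"
  proof (rule inj_onI)
    fix x y assume x: "x \<in> cube n" and y: "y \<in> cube n" and eq: "h x = h y"
    have "y j = x j" if "j \<noteq> i" for j
      using fun_cong[OF eq, of j] that by (simp add: h_def)
    then have yx: "y = x(i := y i)" by auto
    then have "e y = e x" using e_indep by metis
    then have "e x (x i) = e x (y i)" using fun_cong[OF eq, of i] by (simp add: h_def)
    then have "x i = y i"
      using e_mono[OF x, of "x i" "y i"] e_mono[OF x, of "y i" "x i"] xi[OF x] xi[OF y]
      by (cases "x i" "y i" rule: linorder_cases) auto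
    then show "x = y" using yx by (metis fun_upd_triv)
  qed
  moreover have "h ` cube n = cube n"
  proof (intro equalityI subsetI)
    fix w assume w: "w \<in> cube n"
    have "continuous_on {-1..1} (e w)" using e_cont continuous_on_subset by blast
    then obtain s where s: "-1 \<le> s" "s \<le> 1" "e w s = w i"
      using IVT'[of "e w" "-1" "w i" 1] xi[OF w] e_ends by auto
    have "h (w(i := s)) = w" by (simp add: h_def e_indep s)
    then show "w \<in> h ` cube n" using upd[OF w s(1,2)] by (metis imageI)
  qed (use h_in in blast)
  moreover have "continuous_on (cube n) h"
  proof (rule continuous_on_coordinatewise_then_product)
    fix j
    have "continuous_on (cube n) (\<lambda>x. e x (x i))"
      unfolding e_def by (intro continuous_intros t_cont continuous_on_compose2[OF q(1)]) auto
    then show "continuous_on (cube n) (\<lambda>x. h x j)"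
      unfolding h_def by (cases "j = i") (auto intro: continuous_intros)
  qed
  moreover have "h x = x" if x: "x \<in> cube n" and j: "j < n" "\<bar>x j\<bar> = 1" for x j
  proof (cases "j = i")
    case True
    then have "\<bar>x i\<bar> = 1" using j by simp
    then have "x i = 1 \<or> x i = -1" by linarith
    then show ?thesis using e_ends by (auto simp: h_def fun_eq_iff)
  next
    case False
    then have "t x = 0" using damp0[of j x] j False by (simp add: t_def)
    then show ?thesis by (simp add: h_def e_def)
  qed
  ultimately have "h \<in> cube_homeos n" by (auto simp: cube_homeos_def bij_betw_def)
  moreover have "\<exists>w. lo \<le> w \<and> w \<le> hi \<and> h x = x(i := (1 - \<tau> x) * x i + \<tau> x * w)"
    if x: "x \<in> closed_box n \<kappa>" for x
  proof (intro exI[of _ "q (x i)"] conjI)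
    have "\<bar>x i\<bar> \<le> \<kappa>" using x i by (simp add: closed_box_def)
    then show "lo \<le> q (x i)" "q (x i) \<le> hi" using q(5) by auto
    show "h x = x(i := (1 - \<tau> x) * x i + \<tau> x * q (x i))"
      by (simp add: h_def e_def t_def damp1[OF x])
  qed
  ultimately show thesis using that[of h] by (auto simp: h_def)
qed

lemma squeeze_keeps_box:
  assumes x: "x \<in> open_box n \<kappa>" and i: "i < n" and w: "-\<kappa> < w" "w < \<kappa>" and t: "0 \<le> t" "t \<le> 1"
  shows "x(i := (1 - t) * x i + t * w) \<in> open_box n \<kappa>"
proof -
  have "\<bar>x i\<bar> < \<kappa>" "\<bar>w\<bar> < \<kappa>" using x i w by (auto simp: open_box_def)
  then have "(1 - t) * \<bar>x i\<bar> + t * \<bar>w\<bar> < \<kappa>" using t by (intro convex_bound_lt) auto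
  moreover have "\<bar>(1 - t) * x i + t * w\<bar> \<le> \<bar>(1 - t) * x i\<bar> + \<bar>t * w\<bar>" by (rule abs_triangle_ineq)
  moreover have "\<bar>(1 - t) * x i\<bar> = (1 - t) * \<bar>x i\<bar>" "\<bar>t * w\<bar> = t * \<bar>w\<bar>" using t by (simp_all add: abs_mult)
  ultimately show ?thesis using x i by (auto simp: open_box_def)
qed

text \<open>The coordinates are squeezed one after the other. Each squeeze keeps the box, so the next one still acts
  with full strength.\<close>

lemma squeeze_to_fibre:
  assumes k: "0 < \<kappa>" "\<kappa> < 1" and y: "y \<in> open_box n \<kappa>" and d: "0 < \<delta>"
  shows "\<exists>s\<in>cube_homeos n. (\<forall>x\<in>cube n. s x 0 = x 0) \<and>
     (\<forall>x\<in>closed_box n \<kappa>. \<forall>i. 0 < i \<and> i < n \<longrightarrow> \<bar>s x i - y i\<bar> \<le> \<delta>)"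
proof -
  have "\<exists>s\<in>cube_homeos n. (\<forall>x\<in>cube n. s x 0 = x 0) \<and>
     (\<forall>x\<in>closed_box n \<kappa>. s x \<in> closed_box n \<kappa> \<and> (\<forall>i. 0 < i \<and> i < m \<longrightarrow> \<bar>s x i - y i\<bar> \<le> \<delta>))"
    if "m \<le> n" for m
    using that
  proof (induction m)
    case 0
    then show ?case using cube_homeos_id by (intro bexI[of _ "\<lambda>x. x"]) auto
  next
    case (Suc m)
    then obtain s where s: "s \<in> cube_homeos n" "\<And>x. x \<in> cube n \<Longrightarrow> s x 0 = x 0"
        "\<And>x. x \<in> closed_box n \<kappa> \<Longrightarrow> s x \<in> closed_box n \<kappa>"
        "\<And>x i. x \<in> closed_box n \<kappa> \<Longrightarrow> 0 < i \<Longrightarrow> i < m \<Longrightarrow> \<bar>s x i - y i\<bar> \<le> \<delta>"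
      by auto
    show ?case
    proof (cases "m = 0")
      case True
      then show ?thesis using s by (intro bexI[of _ s]) auto
    next
      case False
      have mn: "m < n" using Suc.prems by simp
      have ym: "\<bar>y m\<bar> < \<kappa>" using y mn by (simp add: open_box_def)
      define \<epsilon> where "\<epsilon> = min \<delta> ((\<kappa> - \<bar>y m\<bar>) / 2)"
      have e: "0 < \<epsilon>" "\<epsilon> \<le> \<delta>" "\<bar>y m\<bar> + \<epsilon> < \<kappa>" using d ym by (auto simp: \<epsilon>_def min_def field_simps)
      have lo: "-\<kappa> < y m - \<epsilon>" and lh: "y m - \<epsilon> < y m + \<epsilon>" and hi: "y m + \<epsilon> < \<kappa>" using e by linarith+
      obtain h where h: "h \<in> cube_homeos n" "\<And>x. x \<in> cube n \<Longrightarrow> \<exists>w. h x = x(m := w)"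
        "\<And>x. x \<in> closed_box n \<kappa> \<Longrightarrow> \<exists>w. y m - \<epsilon> \<le> w \<and> w \<le> y m + \<epsilon> \<and> h x = x(m := (1 - 1) * x m + 1 * w)"
        by (rule squeeze_coordinate[OF mn k lo lh hi, of "\<lambda>_. 1"]) auto
      show ?thesis
      proof (intro bexI[of _ "\<lambda>x. h (s x)"] conjI ballI allI impI)
        show "(\<lambda>x. h (s x)) \<in> cube_homeos n" by (rule cube_homeos_comp[OF h(1) s(1)])
        show "h (s x) 0 = x 0" if x: "x \<in> cube n" for x
          using h(2)[OF cube_homeos_in[OF s(1) x]] s(2)[OF x] False by auto
        fix x assume x: "x \<in> closed_box n \<kappa>"
        obtain w where w: "y m - \<epsilon> \<le> w" "w \<le> y m + \<epsilon>" "h (s x) = (s x)(m := w)"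
          using h(3)[OF s(3)[OF x]] by auto
        show "h (s x) \<in> closed_box n \<kappa>"
          using w s(3)[OF x] e mn by (auto simp: closed_box_def)
        fix i assume "0 < i \<and> i < Suc m"
        then show "\<bar>h (s x) i - y i\<bar> \<le> \<delta>"
          using w e s(4)[OF x, of i] by (cases "i = m") auto
      qed
    qed
  qed
  from this[of n] show ?thesis by auto
qed

text \<open>If the second coordinates agree, then the points differ in another coordinate, and a squeeze of the second
  coordinate whose strength depends on that other one moves \<open>u'\<close> but not \<open>u\<close>.\<close>

lemma separate_second_coordinate:
  assumes n: "2 \<le> n" and k: "0 < \<kappa>" "\<kappa> < 1" and u: "u \<in> open_box n \<kappa>" "u' \<in> open_box n \<kappa>" "u \<noteq> u'"
  shows "\<exists>h\<in>cube_homeos n. (\<forall>x\<in>open_box n \<kappa>. h x \<in> open_box n \<kappa>) \<and> h u 1 \<noteq> h u' 1"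
proof (cases "u 1 = u' 1")
  case False
  then show ?thesis using cube_homeos_id by (intro bexI[of _ "\<lambda>x. x"]) auto
next
  case True
  obtain i where i: "u i \<noteq> u' i" using u(3) by blast
  then have i1: "i \<noteq> 1" using True by auto
  define v where "v = u 1"
  have v: "\<bar>v\<bar> < \<kappa>" using u(1) n by (simp add: v_def open_box_def)
  define lo hi where "lo = v + (\<kappa> - v) / 3" and "hi = v + 2 * (\<kappa> - v) / 3"
  have b: "-\<kappa> < lo" "lo < hi" "hi < \<kappa>" "v < lo" using v by (auto simp: lo_def hi_def abs_less_iff field_simps)
  define \<tau> where "\<tau> x = min 1 \<bar>x i - u i\<bar>" for x :: "nat \<Rightarrow> real"
  have n1: "1 < n" using n by simp
  have tc: "continuous_on (cube n) \<tau>" unfolding \<tau>_def by (intro continuous_intros)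
  have t01: "0 \<le> \<tau> x \<and> \<tau> x \<le> 1" for x by (simp add: \<tau>_def)
  have ti: "\<tau> (x(1 := s)) = \<tau> x" for x s using i1 by (simp add: \<tau>_def)
  obtain h where h1: "h \<in> cube_homeos n" "\<And>x. x \<in> cube n \<Longrightarrow> \<exists>w. h x = x(1 := w)"
    and h2: "\<And>x. x \<in> closed_box n \<kappa> \<Longrightarrow> \<exists>w. lo \<le> w \<and> w \<le> hi \<and> h x = x(1 := (1 - \<tau> x) * x 1 + \<tau> x * w)"
    by (fact squeeze_coordinate[OF n1 k b(1-3) tc t01 ti])
  note h = h1(1) h2
  have "h x \<in> open_box n \<kappa>" if x: "x \<in> open_box n \<kappa>" for x
  proof -
    have "x \<in> closed_box n \<kappa>" using x box_mono(2) by blast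
    from h(2)[OF this] obtain w where w: "lo \<le> w" "w \<le> hi" "h x = x(1 := (1 - \<tau> x) * x 1 + \<tau> x * w)" by blast
    then show ?thesis
      unfolding w(3) using b t01[of x] by (intro squeeze_keeps_box[OF x n1]) auto
  qed
  moreover have "h u 1 \<noteq> h u' 1"
  proof -
    have c: "u \<in> closed_box n \<kappa>" "u' \<in> closed_box n \<kappa>" using u box_mono(2) by blast+
    obtain w where "h u = u(1 := (1 - \<tau> u) * u 1 + \<tau> u * w)" using h(2)[OF c(1)] by blast
    then have 1: "h u 1 = v" by (simp add: \<tau>_def v_def)
    obtain w where w: "lo \<le> w" "h u' = u'(1 := (1 - \<tau> u') * u' 1 + \<tau> u' * w)" using h(2)[OF c(2)] by blast
    have "0 < \<tau> u'" using i by (simp add: \<tau>_def)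
    then have "0 < \<tau> u' * (w - v)" using w b by simp
    moreover have "h u' 1 = v + \<tau> u' * (w - v)" using w(2) True by (simp add: v_def algebra_simps)
    ultimately show ?thesis using 1 by linarith
  qed
  ultimately show ?thesis using h(1) by blast
qed

text \<open>The strengths of the pushes to the right and to the left depend on the second coordinate, which
  neither of them changes. So each of the three points feels one push only.\<close>

lemma fold_three_points:
  assumes n: "2 \<le> n" and k: "0 < \<kappa>" "\<kappa> < 1"
    and u: "ua \<in> open_box n \<kappa>" "um \<in> open_box n \<kappa>" "ub \<in> open_box n \<kappa>"
    and ne: "um 1 \<noteq> ua 1" "um 1 \<noteq> ub 1"
    and c: "-\<kappa> < c1" "c1 < \<kappa>" "-\<kappa> < c3" "c3 < \<kappa>"
  shows "\<exists>h\<in>cube_homeos n. (\<forall>x\<in>open_box n \<kappa>. h x \<in> open_box n \<kappa>) \<and> h ua 0 < c1 \<and> h ub 0 < c1 \<and> c3 < h um 0"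
proof -
  define D where "D = min \<bar>um 1 - ua 1\<bar> \<bar>um 1 - ub 1\<bar>"
  have D: "0 < D" "D \<le> \<bar>ua 1 - um 1\<bar>" "D \<le> \<bar>ub 1 - um 1\<bar>" using ne by (auto simp: D_def abs_minus_commute)
  define R L where "R x = max 0 (1 - \<bar>x 1 - um 1\<bar> / D)" and "L x = min 1 (\<bar>x 1 - um 1\<bar> / D)" for x :: "nat \<Rightarrow> real"
  have cont: "continuous_on (cube n) R" "continuous_on (cube n) L"
    unfolding R_def L_def using D by (intro continuous_intros; simp)+
  have R01: "0 \<le> R x \<and> R x \<le> 1" and L01: "0 \<le> L x \<and> L x \<le> 1" for x using D by (auto simp: R_def L_def)
  have Ri: "R (x(0 := s)) = R x" and Li: "L (x(0 := s)) = L x" for x s by (simp_all add: R_def L_def)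
  have n0: "0 < n" using n by simp
  have r: "-\<kappa> < c3 + (\<kappa> - c3) / 3" "c3 + (\<kappa> - c3) / 3 < c3 + 2 * (\<kappa> - c3) / 3" "c3 + 2 * (\<kappa> - c3) / 3 < \<kappa>"
    and l: "-\<kappa> < -\<kappa> + (c1 + \<kappa>) / 3" "-\<kappa> + (c1 + \<kappa>) / 3 < -\<kappa> + 2 * (c1 + \<kappa>) / 3" "-\<kappa> + 2 * (c1 + \<kappa>) / 3 < \<kappa>"
    and c': "c3 < c3 + (\<kappa> - c3) / 3" "-\<kappa> + 2 * (c1 + \<kappa>) / 3 < c1"
    using c by (simp_all add: field_simps)
  obtain hR where hR1: "hR \<in> cube_homeos n" "\<And>x. x \<in> cube n \<Longrightarrow> \<exists>w. hR x = x(0 := w)"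
    and hR2: "\<And>x. x \<in> closed_box n \<kappa> \<Longrightarrow> \<exists>w. c3 + (\<kappa> - c3) / 3 \<le> w \<and> w \<le> c3 + 2 * (\<kappa> - c3) / 3 \<and> hR x = x(0 := (1 - R x) * x 0 + R x * w)"
    by (fact squeeze_coordinate[OF n0 k r cont(1) R01 Ri])
  note hR = hR1(1) hR2
  obtain hL where hL1: "hL \<in> cube_homeos n" "\<And>x. x \<in> cube n \<Longrightarrow> \<exists>w. hL x = x(0 := w)"
    and hL2: "\<And>x. x \<in> closed_box n \<kappa> \<Longrightarrow> \<exists>w. -\<kappa> + (c1 + \<kappa>) / 3 \<le> w \<and> w \<le> -\<kappa> + 2 * (c1 + \<kappa>) / 3 \<and> hL x = x(0 := (1 - L x) * x 0 + L x * w)"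
    by (fact squeeze_coordinate[OF n0 k l cont(2) L01 Li])
  note hL = hL1(1) hL2
  have Rbox: "hR x \<in> open_box n \<kappa>" if x: "x \<in> open_box n \<kappa>" for x
  proof -
    have "x \<in> closed_box n \<kappa>" using x box_mono(2) by blast
    from hR(2)[OF this] obtain w where w: "c3 + (\<kappa> - c3) / 3 \<le> w" "w \<le> c3 + 2 * (\<kappa> - c3) / 3" "hR x = x(0 := (1 - R x) * x 0 + R x * w)" by blast
    have "-\<kappa> < w" "w < \<kappa>" using w r by linarith+
    then show ?thesis unfolding w(3) using R01[of x] by (intro squeeze_keeps_box[OF x n0]) auto
  qed
  have Lbox: "hL x \<in> open_box n \<kappa>" if x: "x \<in> open_box n \<kappa>" for x
  proof -
    have "x \<in> closed_box n \<kappa>" using x box_mono(2) by blast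
    from hL(2)[OF this] obtain w where w: "-\<kappa> + (c1 + \<kappa>) / 3 \<le> w" "w \<le> -\<kappa> + 2 * (c1 + \<kappa>) / 3" "hL x = x(0 := (1 - L x) * x 0 + L x * w)" by blast
    have "-\<kappa> < w" "w < \<kappa>" using w l by linarith+
    then show ?thesis unfolding w(3) using L01[of x] by (intro squeeze_keeps_box[OF x n0]) auto
  qed
  have left: "hL (hR x) 0 < c1" if x: "x \<in> open_box n \<kappa>" and far: "D \<le> \<bar>x 1 - um 1\<bar>" for x
  proof -
    have xc: "x \<in> closed_box n \<kappa>" using x box_mono(2) by blast
    have "1 \<le> \<bar>x 1 - um 1\<bar> / D" using far D by simp
    then have "R x = 0" "L x = 1" by (auto simp: R_def L_def)
    moreover obtain w where "hR x = x(0 := (1 - R x) * x 0 + R x * w)" using hR(2)[OF xc] by blast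
    ultimately have "hR x = x" by simp
    moreover obtain w where "w \<le> -\<kappa> + 2 * (c1 + \<kappa>) / 3" "hL x = x(0 := (1 - L x) * x 0 + L x * w)"
      using hL(2)[OF xc] by blast
    ultimately show ?thesis using \<open>L x = 1\<close> c' by simp
  qed
  have right: "c3 < hL (hR um) 0"
  proof -
    have xc: "um \<in> closed_box n \<kappa>" using u(2) box_mono(2) by blast
    have "R um = 1" by (simp add: R_def)
    moreover obtain w where w: "c3 + (\<kappa> - c3) / 3 \<le> w" "hR um = um(0 := (1 - R um) * um 0 + R um * w)" using hR(2)[OF xc] by blast
    ultimately have hum: "hR um = um(0 := w)" by simp
    then have "L (hR um) = 0" by (simp add: L_def)
    moreover have "hR um \<in> closed_box n \<kappa>" using Rbox[OF u(2)] box_mono(2) by blast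
    then obtain w' where "hL (hR um) = (hR um)(0 := (1 - L (hR um)) * hR um 0 + L (hR um) * w')"
      using hL(2) by blast
    ultimately have "hL (hR um) 0 = w" using hum by simp
    then show ?thesis using w c' by linarith
  qed
  show ?thesis
  proof (intro bexI[of _ "\<lambda>x. hL (hR x)"] conjI ballI)
    show "(\<lambda>x. hL (hR x)) \<in> cube_homeos n" by (rule cube_homeos_comp[OF hL(1) hR(1)])
    show "hL (hR x) \<in> open_box n \<kappa>" if "x \<in> open_box n \<kappa>" for x by (rule Lbox[OF Rbox[OF that]])
  qed (use left[OF u(1)] left[OF u(3)] right D in auto)
qed

lemma tube_around_segment:
  assumes n: "0 < n" and y: "y \<in> cube n" and U: "openin (top_of_set (cube n)) U"
    and seg: "\<And>t. c \<le> t \<Longrightarrow> t \<le> c' \<Longrightarrow> y(0 := t) \<in> U"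
  shows "\<exists>\<delta>>0. \<forall>x\<in>cube n. c \<le> x 0 \<longrightarrow> x 0 \<le> c' \<longrightarrow> (\<forall>i. 0 < i \<and> i < n \<longrightarrow> \<bar>x i - y i\<bar> \<le> \<delta>) \<longrightarrow> x \<in> U"
proof (rule ccontr)
  assume no: "\<not> ?thesis"
  define C where "C k = {x \<in> cube n - U. c \<le> x 0 \<and> x 0 \<le> c' \<and> (\<forall>i\<in>{0<..<n}. \<bar>x i - y i\<bar> \<le> 1 / real (Suc k))}" for k
  have "C k \<noteq> {}" for k
  proof -
    have "0 < 1 / real (Suc k)" by simp
    then obtain x where "x \<in> cube n" "c \<le> x 0" "x 0 \<le> c'" "\<forall>i. 0 < i \<and> i < n \<longrightarrow> \<bar>x i - y i\<bar> \<le> 1 / real (Suc k)" "x \<notin> U"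
      using no by blast
    then have "x \<in> C k" by (auto simp: C_def)
    then show ?thesis by blast
  qed
  moreover have "closedin (top_of_set (cube n)) (C k)" for k
  proof -
    have "closed {x :: nat \<Rightarrow> real. c \<le> x 0 \<and> x 0 \<le> c' \<and> (\<forall>i\<in>{0<..<n}. \<bar>x i - y i\<bar> \<le> 1 / real (Suc k))}"
    proof -
      have "{x :: nat \<Rightarrow> real. c \<le> x 0 \<and> x 0 \<le> c' \<and> (\<forall>i\<in>{0<..<n}. \<bar>x i - y i\<bar> \<le> 1 / real (Suc k))} =
          {x. c \<le> x 0} \<inter> {x. x 0 \<le> c'} \<inter> (\<Inter>i\<in>{0<..<n}. {x. \<bar>x i - y i\<bar> \<le> 1 / real (Suc k)})"
        by auto
      also have "closed \<dots>"
        by (intro closed_Int closed_INT ballI closed_Collect_le continuous_intros)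
      finally show ?thesis .
    qed
    then have c1: "closedin (top_of_set (cube n)) (cube n \<inter> {x. c \<le> x 0 \<and> x 0 \<le> c' \<and> (\<forall>i\<in>{0<..<n}. \<bar>x i - y i\<bar> \<le> 1 / real (Suc k))})"
      by (rule closedin_closed_Int)
    have c2: "closedin (top_of_set (cube n)) (cube n - U)" using U by (simp add: closedin_diff)
    have "closedin (top_of_set (cube n)) ((cube n - U) \<inter> (cube n \<inter> {x. c \<le> x 0 \<and> x 0 \<le> c' \<and> (\<forall>i\<in>{0<..<n}. \<bar>x i - y i\<bar> \<le> 1 / real (Suc k))}))"
      by (rule closedin_Int[OF c2 c1])
    moreover have "\<dots> = C k" by (auto simp: C_def)
    ultimately show ?thesis by simp
  qed
  moreover have "decseq C"
  proof (rule decseq_SucI, rule subsetI)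
    fix k x assume x: "x \<in> C (Suc k)"
    have "1 / real (Suc (Suc k)) \<le> 1 / real (Suc k)" by (simp add: frac_le)
    then have "\<bar>x i - y i\<bar> \<le> 1 / real (Suc k)" if "i \<in> {0<..<n}" for i
      using x that unfolding C_def by (auto intro: order_trans)
    then show "x \<in> C k" using x by (simp add: C_def)
  qed
  moreover have "compact_space (top_of_set (cube n))"
    using compact_cube by (simp add: compact_space_subtopology)
  ultimately obtain x where x: "\<And>k. x \<in> C k" using compact_space_imp_nest[of "top_of_set (cube n)" C] by blast
  have xc: "x \<in> cube n" "x \<notin> U" "c \<le> x 0" "x 0 \<le> c'" using x[of 0] by (auto simp: C_def)
  have "x i = y i" if "0 < i" for i
  proof (cases "i < n")
    case True
    then have le: "\<bar>x i - y i\<bar> \<le> 1 / real (Suc k)" for k using x[of k] that by (auto simp: C_def)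
    show ?thesis
    proof (rule ccontr)
      assume "x i \<noteq> y i"
      then have "0 < \<bar>x i - y i\<bar>" by simp
      then obtain k where "inverse (real (Suc k)) < \<bar>x i - y i\<bar>" using reals_Archimedean by blast
      then show False using le[of k] by (simp add: inverse_eq_divide)
    qed
  next
    case False
    then show ?thesis using xc(1) y by (simp add: cube_def)
  qed
  then have "x = y(0 := x 0)" by (auto simp: fun_eq_iff)
  then show False using seg[OF xc(3,4)] xc(2) by simp
qed

text \<open>Let \<open>F\<close> embed a neighbourhood of a point \<open>y\<close> into the cube. Nothing is known about the
  shape of its image, but a short segment through \<open>y\<close> has three points that a homeomorphism of the cube
  pushes, after \<open>F\<close>, beyond alternating ends of the segment. If the box is first squeezed to a
  thin neighbourhood of the segment, then it gets folded along with the three points.\<close>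

lemma fold_embedding:
  assumes n: "2 \<le> n" and k: "0 < \<kappa>" "\<kappa> < 1" and y: "y \<in> open_box n \<kappa>"
    and V: "openin (top_of_set (cube n)) V" "y \<in> V"
    and F: "continuous_on V F" "inj_on F V" and FV: "F ` V \<subseteq> open_box n \<kappa>"
  obtains s h c1 c2 c3 where "s \<in> cube_homeos n" "h \<in> cube_homeos n" "\<And>x. x \<in> cube n \<Longrightarrow> s x 0 = x 0"
    "-\<kappa> < c1" "c1 < c2" "c2 < c3" "c3 < \<kappa>"
    "\<And>x. x \<in> closed_box n \<kappa> \<Longrightarrow> c1 \<le> x 0 \<Longrightarrow> x 0 \<le> c3 \<Longrightarrow> s x \<in> V \<and> h (F (s x)) \<in> open_box n \<kappa>"
    "\<And>x. x \<in> closed_box n \<kappa> \<Longrightarrow> x 0 = c1 \<Longrightarrow> h (F (s x)) 0 < c1"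
    "\<And>x. x \<in> closed_box n \<kappa> \<Longrightarrow> x 0 = c2 \<Longrightarrow> c3 < h (F (s x)) 0"
    "\<And>x. x \<in> closed_box n \<kappa> \<Longrightarrow> x 0 = c3 \<Longrightarrow> h (F (s x)) 0 < c1"
proof -
  note F = F FV[unfolded image_subset_iff, rule_format]
  have n0: "0 < n" using n by simp
  have y0: "\<bar>y 0\<bar> < \<kappa>" using y n0 by (simp add: open_box_def)
  have boxc: "open_box n \<kappa> \<subseteq> cube n" using box_mono(1)[OF k(2), of n] box_mono(2)[of n \<kappa>] by blast
  have yc: "y \<in> cube n" using y boxc by blast
  have seg_box: "y(0 := t) \<in> open_box n \<kappa>" if "\<bar>t\<bar> < \<kappa>" for t using y n0 that by (auto simp: open_box_def)
  have seg_cont: "continuous_on UNIV (\<lambda>t. y(0 := t))"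
  proof (rule continuous_on_coordinatewise_then_product)
    show "continuous_on UNIV (\<lambda>t. (y(0 := t)) j)" for j by (cases "j = 0") (auto intro: continuous_intros)
  qed
  obtain V' where V': "open V'" "V = cube n \<inter> V'" using V(1) by (auto simp: openin_open)
  obtain \<epsilon> where e: "0 < \<epsilon>" "y 0 + \<epsilon> < \<kappa>" "\<And>t. y 0 \<le> t \<Longrightarrow> t \<le> y 0 + \<epsilon> \<Longrightarrow> y(0 := t) \<in> V"
  proof -
    have "open ((\<lambda>t. y(0 := t)) -` V')" using V'(1) seg_cont by (simp add: open_vimage)
    moreover have "y 0 \<in> (\<lambda>t. y(0 := t)) -` V'" using V(2) V'(2) by simp
    ultimately obtain e where e: "0 < e" "ball (y 0) e \<subseteq> (\<lambda>t. y(0 := t)) -` V'" using open_contains_ball by blast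
    define \<epsilon> where "\<epsilon> = min (e / 2) ((\<kappa> - y 0) / 2)"
    have "0 < \<epsilon>" using e(1) y0 by (simp add: \<epsilon>_def abs_less_iff)
    moreover have "\<epsilon> \<le> e / 2" unfolding \<epsilon>_def by (rule min.cobounded1)
    moreover have "\<epsilon> \<le> (\<kappa> - y 0) / 2" unfolding \<epsilon>_def by (rule min.cobounded2)
    ultimately have ee: "0 < \<epsilon>" "\<epsilon> \<le> e / 2" "\<epsilon> \<le> (\<kappa> - y 0) / 2" by auto
    show thesis
    proof (rule that[OF ee(1)])
      show "y 0 + \<epsilon> < \<kappa>" using ee y0 by (simp add: field_simps abs_less_iff)
      fix t assume t: "y 0 \<le> t" "t \<le> y 0 + \<epsilon>"
      then have "dist (y 0) t < e" using ee e(1) by (simp add: dist_real_def)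
      then have "y(0 := t) \<in> V'" using e(2) by auto
      moreover have "\<bar>t\<bar> < \<kappa>" using t ee y0 by (simp add: abs_less_iff field_simps)
      then have "y(0 := t) \<in> cube n" using seg_box boxc by blast
      ultimately show "y(0 := t) \<in> V" using V'(2) by simp
    qed
  qed
  define c1 c3 where "c1 = y 0" and "c3 = y 0 + \<epsilon>"
  have c13: "c1 < c3" "-\<kappa> < c1" "c1 < \<kappa>" "-\<kappa> < c3" "c3 < \<kappa>"
    using e y0 by (auto simp: c1_def c3_def abs_less_iff)
  have segV: "y(0 := t) \<in> V" if "c1 \<le> t" "t \<le> c3" for t using e(3) that by (simp add: c1_def c3_def)
  define u where "u t = F (y(0 := t))" for t
  have u_box: "u t \<in> open_box n \<kappa>" if "c1 \<le> t" "t \<le> c3" for t using F(3) segV that by (simp add: u_def)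
  have "y(0 := c1) \<noteq> y(0 := c3)" using c13 by (metis fun_upd_same less_irrefl)
  then have "u c1 \<noteq> u c3" using F(2) segV[of c1] segV[of c3] c13 by (auto simp: u_def dest: inj_onD)
  then obtain h1 where h1: "h1 \<in> cube_homeos n" "\<And>x. x \<in> open_box n \<kappa> \<Longrightarrow> h1 x \<in> open_box n \<kappa>" "h1 (u c1) 1 \<noteq> h1 (u c3) 1"
    using separate_second_coordinate[OF n k u_box[of c1] u_box[of c3]] c13 by auto
  have h1c: "continuous_on (cube n) h1" using h1(1) by (simp add: cube_homeos_def)
  have "continuous_on {c1..c3} (\<lambda>t. h1 (u t))"
    unfolding u_def
    by (intro continuous_on_compose2[OF h1c] continuous_on_compose2[OF F(1)] continuous_on_subset[OF seg_cont])
      (use segV F(3) boxc in auto)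
  then have vc: "continuous_on {c1..c3} (\<lambda>t. h1 (u t) 1)"
    by (rule continuous_on_compose2[OF continuous_on_coord[of UNIV]]) simp
  obtain c2 where c2: "c1 \<le> c2" "c2 \<le> c3" "h1 (u c2) 1 = (h1 (u c1) 1 + h1 (u c3) 1) / 2"
  proof (cases "h1 (u c1) 1 \<le> h1 (u c3) 1")
    case True
    then show thesis
      using IVT'[of "\<lambda>t. h1 (u t) 1" c1 "(h1 (u c1) 1 + h1 (u c3) 1) / 2" c3] vc c13 that by auto
  next
    case False
    then show thesis
      using IVT2'[of "\<lambda>t. h1 (u t) 1" c3 "(h1 (u c1) 1 + h1 (u c3) 1) / 2" c1] vc c13 that by auto
  qed
  have ne: "h1 (u c2) 1 \<noteq> h1 (u c1) 1" "h1 (u c2) 1 \<noteq> h1 (u c3) 1" using c2(3) h1(3) by (auto simp: field_simps)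
  then have c2': "c1 < c2" "c2 < c3" using c2 by (metis order_le_less)+
  obtain h2 where h2: "h2 \<in> cube_homeos n" "\<And>x. x \<in> open_box n \<kappa> \<Longrightarrow> h2 x \<in> open_box n \<kappa>"
      "h2 (h1 (u c1)) 0 < c1" "h2 (h1 (u c3)) 0 < c1" "c3 < h2 (h1 (u c2)) 0"
    using fold_three_points[OF n k h1(2)[OF u_box] h1(2)[OF u_box] h1(2)[OF u_box] ne c13(2-5)] c2 c13 by auto
  define h where "h x = h2 (h1 x)" for x
  have h: "h \<in> cube_homeos n" unfolding h_def by (rule cube_homeos_comp[OF h2(1) h1(1)])
  have h_box: "h x \<in> open_box n \<kappa>" if "x \<in> open_box n \<kappa>" for x unfolding h_def by (intro h2 h1 that)
  have hc: "continuous_on (cube n) h" using h by (simp add: cube_homeos_def)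
  have "continuous_on V (\<lambda>x. h (F x))"
    by (rule continuous_on_compose2[OF hc F(1)]) (use F(3) boxc in auto)
  then have hFc: "continuous_on V (\<lambda>x. h (F x) 0)"
    by (rule continuous_on_compose2[OF continuous_on_coord[of UNIV]]) simp
  have ope: "openin (top_of_set (cube n)) (V \<inter> (\<lambda>x. h (F x) 0) -` W)" if "open W" for W
    using continuous_openin_preimage_gen[OF hFc that] V(1) openin_trans by blast
  have tube: "\<exists>\<delta>>0. \<forall>x\<in>cube n. c \<le> x 0 \<longrightarrow> x 0 \<le> c' \<longrightarrow> (\<forall>i. 0 < i \<and> i < n \<longrightarrow> \<bar>x i - y i\<bar> \<le> \<delta>) \<longrightarrow> x \<in> U"
    if "openin (top_of_set (cube n)) U" "\<And>t. c \<le> t \<Longrightarrow> t \<le> c' \<Longrightarrow> y(0 := t) \<in> U" for U c c'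
    by (rule tube_around_segment[OF n0 yc that])
  have "y(0 := t) \<in> V \<inter> (\<lambda>x. h (F x) 0) -` {..<c1}" if "c1 \<le> t" "t \<le> c1" for t
    using that segV[of c1] h2(3) c13 by (simp add: h_def u_def)
  from tube[OF ope[OF open_lessThan] this] obtain \<delta>1 where d1: "0 < \<delta>1"
    "\<forall>x\<in>cube n. c1 \<le> x 0 \<longrightarrow> x 0 \<le> c1 \<longrightarrow> (\<forall>i. 0 < i \<and> i < n \<longrightarrow> \<bar>x i - y i\<bar> \<le> \<delta>1) \<longrightarrow> x \<in> V \<inter> (\<lambda>x. h (F x) 0) -` {..<c1}"
    by blast
  have "y(0 := t) \<in> V \<inter> (\<lambda>x. h (F x) 0) -` {c3<..}" if "c2 \<le> t" "t \<le> c2" for t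
    using that segV[of c2] h2(5) c2 by (simp add: h_def u_def)
  from tube[OF ope[OF open_greaterThan] this] obtain \<delta>2 where d2: "0 < \<delta>2"
    "\<forall>x\<in>cube n. c2 \<le> x 0 \<longrightarrow> x 0 \<le> c2 \<longrightarrow> (\<forall>i. 0 < i \<and> i < n \<longrightarrow> \<bar>x i - y i\<bar> \<le> \<delta>2) \<longrightarrow> x \<in> V \<inter> (\<lambda>x. h (F x) 0) -` {c3<..}"
    by blast
  have "y(0 := t) \<in> V \<inter> (\<lambda>x. h (F x) 0) -` {..<c1}" if "c3 \<le> t" "t \<le> c3" for t
    using that segV[of c3] h2(4) c13 by (simp add: h_def u_def)
  from tube[OF ope[OF open_lessThan] this] obtain \<delta>3 where d3: "0 < \<delta>3"
    "\<forall>x\<in>cube n. c3 \<le> x 0 \<longrightarrow> x 0 \<le> c3 \<longrightarrow> (\<forall>i. 0 < i \<and> i < n \<longrightarrow> \<bar>x i - y i\<bar> \<le> \<delta>3) \<longrightarrow> x \<in> V \<inter> (\<lambda>x. h (F x) 0) -` {..<c1}"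
    by blast
  from tube[OF V(1) segV] obtain \<delta>4 where d4: "0 < \<delta>4"
    "\<forall>x\<in>cube n. c1 \<le> x 0 \<longrightarrow> x 0 \<le> c3 \<longrightarrow> (\<forall>i. 0 < i \<and> i < n \<longrightarrow> \<bar>x i - y i\<bar> \<le> \<delta>4) \<longrightarrow> x \<in> V"
    by blast
  define \<delta> where "\<delta> = min (min \<delta>1 \<delta>2) (min \<delta>3 \<delta>4)"
  have d: "0 < \<delta>" "\<delta> \<le> \<delta>1" "\<delta> \<le> \<delta>2" "\<delta> \<le> \<delta>3" "\<delta> \<le> \<delta>4" using d1 d2 d3 d4 by (auto simp: \<delta>_def)
  obtain s where s: "s \<in> cube_homeos n" "\<And>x. x \<in> cube n \<Longrightarrow> s x 0 = x 0"
      "\<And>x i. x \<in> closed_box n \<kappa> \<Longrightarrow> 0 < i \<Longrightarrow> i < n \<Longrightarrow> \<bar>s x i - y i\<bar> \<le> \<delta>"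
    using squeeze_to_fibre[OF k y d(1)] by auto
  have sc: "s x \<in> cube n" "s x 0 = x 0" if "x \<in> closed_box n \<kappa>" for x
    using that box_mono(1)[OF k(2), of n] cube_homeos_in[OF s(1)] s(2) by blast+
  have sd: "\<forall>i. 0 < i \<and> i < n \<longrightarrow> \<bar>s x i - y i\<bar> \<le> \<delta>'" if "x \<in> closed_box n \<kappa>" "\<delta> \<le> \<delta>'" for x \<delta>'
    using s(3)[OF that(1)] that(2) by (meson order_trans)
  show thesis
  proof (rule that[OF s(1) h s(2) c13(2) c2' c13(5)])
    fix x assume x: "x \<in> closed_box n \<kappa>"
    show "s x \<in> V \<and> h (F (s x)) \<in> open_box n \<kappa>" if "c1 \<le> x 0" "x 0 \<le> c3"
    proof -
      have "s x \<in> V" using d4(2) sc[OF x] that sd[OF x d(5)] by metis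
      then show ?thesis using h_box F(3) by blast
    qed
    show "h (F (s x)) 0 < c1" if "x 0 = c1"
      using d1(2)[rule_format, OF sc(1)[OF x]] sc(2)[OF x] that sd[OF x d(2)] by simp
    show "c3 < h (F (s x)) 0" if "x 0 = c2"
      using d2(2)[rule_format, OF sc(1)[OF x]] sc(2)[OF x] that sd[OF x d(3)] by simp
    show "h (F (s x)) 0 < c1" if "x 0 = c3"
      using d3(2)[rule_format, OF sc(1)[OF x]] sc(2)[OF x] that sd[OF x d(4)] by simp
  qed
qed

section \<open>Density of horseshoes\<close>

text \<open>A parametrisation of a part of \<open>X\<close> by the cube whose interior is open in \<open>X\<close>. Homeomorphisms of the cube that
  fix its boundary then extend to \<open>X\<close> by the identity.\<close>

locale cube_chart =
  fixes X :: "'a topology" and n :: nat and \<iota> :: "(nat \<Rightarrow> real) \<Rightarrow> 'a"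
  assumes haus: "Hausdorff_space X" and cpt: "compact_space X"
    and \<iota>_cont: "continuous_map (top_of_set (cube n)) X \<iota>"
    and \<iota>_inj: "inj_on \<iota> (cube n)"
    and \<iota>_open: "open U \<Longrightarrow> openin X (\<iota> ` (U \<inter> open_box n 1))"
begin

definition "C = \<iota> ` cube n"

definition "coord = inv_into (cube n) \<iota>"

definition extend :: "((nat \<Rightarrow> real) \<Rightarrow> nat \<Rightarrow> real) \<Rightarrow> 'a \<Rightarrow> 'a" where
  "extend h w = (if w \<in> C then \<iota> (h (coord w)) else w)"

lemma \<iota>_in: "x \<in> cube n \<Longrightarrow> \<iota> x \<in> topspace X"
  using \<iota>_cont by (auto simp: continuous_map_def)

lemma C_sub: "C \<subseteq> topspace X" using \<iota>_in by (auto simp: C_def)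

lemma coord_\<iota> [simp]: "x \<in> cube n \<Longrightarrow> coord (\<iota> x) = x"
  by (simp add: coord_def \<iota>_inj)

lemma coord_C: "w \<in> C \<Longrightarrow> coord w \<in> cube n" "w \<in> C \<Longrightarrow> \<iota> (coord w) = w"
  by (auto simp: C_def coord_def inv_into_into f_inv_into_f)

lemma closedin_image:
  assumes "closedin (top_of_set (cube n)) K"
  shows "closedin X (\<iota> ` K)"
proof -
  have "compact_space (top_of_set (cube n))" using compact_cube by (simp add: compact_space_subtopology)
  then have "compactin (top_of_set (cube n)) K" using assms closedin_compact_space by blast
  then have "compactin X (\<iota> ` K)" using \<iota>_cont by (rule image_compactin)
  then show ?thesis using haus compactin_imp_closedin by blast
qed

lemma closedin_C: "closedin X C"
  unfolding C_def by (rule closedin_image) simp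

lemma coord_cont: "continuous_map (subtopology X C) (top_of_set (cube n)) coord"
  unfolding continuous_map_closedin
proof (intro conjI allI impI ballI)
  show "coord \<in> topspace (subtopology X C) \<rightarrow> topspace (top_of_set (cube n))"
    using coord_C by auto
  fix K assume K: "closedin (top_of_set (cube n)) K"
  then have "K \<subseteq> cube n" using closedin_imp_subset by blast
  then have "{x \<in> topspace (subtopology X C). coord x \<in> K} = \<iota> ` K"
    using coord_C C_sub \<iota>_in by (force simp: C_def)
  moreover have "\<iota> ` K \<subseteq> C" using \<open>K \<subseteq> cube n\<close> by (auto simp: C_def)
  ultimately show "closedin (subtopology X C) {x \<in> topspace (subtopology X C). coord x \<in> K}"
    using closedin_image[OF K] closedin_subset_topspace by metis
qed

lemma extend_\<iota>: "x \<in> cube n \<Longrightarrow> extend h (\<iota> x) = \<iota> (h x)"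
  by (simp add: extend_def C_def)

lemma extend_outside: "w \<notin> C \<Longrightarrow> extend h w = w"
  by (simp add: extend_def)

lemma extend_C: "h \<in> cube_homeos n \<Longrightarrow> w \<in> C \<Longrightarrow> extend h w \<in> C"
  using coord_C cube_homeos_in by (auto simp: extend_def C_def)

lemma extend_homeomorphic:
  assumes h: "h \<in> cube_homeos n"
  shows "homeomorphic_map X X (extend h)"
proof -
  have hc: "continuous_on (cube n) h" and hb: "bij_betw h (cube n) (cube n)"
    and hid: "\<And>x. x \<in> cube n \<Longrightarrow> \<exists>i<n. \<bar>x i\<bar> = 1 \<Longrightarrow> h x = x"
    using h by (auto simp: cube_homeos_def)
  define T where "T b = (if b then C else topspace X - \<iota> ` open_box n 1)" for b
  have "openin X (\<iota> ` open_box n 1)" using \<iota>_open[of UNIV] by simp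
  then have closed: "closedin X (T b)" for b using closedin_C by (auto simp: T_def)
  have hm: "continuous_map (top_of_set (cube n)) (top_of_set (cube n)) h"
    using hc cube_homeos_in[OF h] by (auto simp: continuous_map_in_subtopology)
  have cont: "continuous_map X X (extend h)"
  proof (rule pasting_lemma_closed[where I=UNIV and T=T and f="\<lambda>b w. if b then \<iota> (h (coord w)) else w"])
    show "continuous_map (subtopology X (T b)) X (\<lambda>w. if b then \<iota> (h (coord w)) else w)" for b
    proof (cases b)
      case True
      have "continuous_map (subtopology X C) X (\<iota> \<circ> (h \<circ> coord))"
        by (intro continuous_map_compose[OF _ \<iota>_cont] continuous_map_compose[OF coord_cont hm])
      then show ?thesis using True by (simp add: T_def o_def)
    qed (simp add: continuous_map_from_subtopology)
    show "(if b then \<iota> (h (coord w)) else w) = (if b' then \<iota> (h (coord w)) else w)"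
      if w: "w \<in> topspace X \<inter> T b \<inter> T b'" for b b' w
    proof (cases "b = b'")
      case False
      then have wC: "w \<in> C" "w \<notin> \<iota> ` open_box n 1" using w by (auto simp: T_def split: if_splits)
      then have "coord w \<notin> open_box n 1" "coord w \<in> cube n" using coord_C[OF wC(1)] by (metis imageI, blast)
      then have "\<exists>i<n. \<bar>coord w i\<bar> = 1" by (force simp: open_box_def cube_def)
      then have "\<iota> (h (coord w)) = w" using hid \<open>coord w \<in> cube n\<close> coord_C[OF wC(1)] by metis
      then show ?thesis by simp
    qed simp
    show "\<exists>b. b \<in> UNIV \<and> w \<in> T b \<and> extend h w = (if b then \<iota> (h (coord w)) else w)" if w: "w \<in> topspace X" for w
    proof (cases "w \<in> C")
      case True
      then show ?thesis by (intro exI[of _ True]) (simp add: T_def extend_def)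
    next
      case False
      have "open_box n 1 \<subseteq> cube n" by (auto simp: open_box_def cube_def less_imp_le)
      then have "w \<notin> \<iota> ` open_box n 1" using False by (auto simp: C_def)
      then show ?thesis using w False by (intro exI[of _ False]) (simp add: T_def extend_def)
    qed
  qed (use closed in auto)
  have onC: "bij_betw (extend h) C C"
  proof -
    have "bij_betw coord C (cube n)" unfolding coord_def C_def by (rule bij_betw_inv_into) (simp add: bij_betw_def \<iota>_inj)
    moreover have "bij_betw \<iota> (cube n) C" by (simp add: bij_betw_def \<iota>_inj C_def)
    ultimately have "bij_betw (\<iota> \<circ> (h \<circ> coord)) C C" using hb by (intro bij_betw_trans)
    then show ?thesis by (rule bij_betw_cong[THEN iffD1, rotated]) (simp add: extend_def)
  qed
  have "bij_betw (extend h) (topspace X - C) (topspace X - C)"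
    by (rule bij_betw_cong[THEN iffD1, OF _ bij_betw_id[unfolded id_def]]) (simp add: extend_def)
  then have "bij_betw (extend h) (C \<union> (topspace X - C)) (C \<union> (topspace X - C))"
    using onC by (intro bij_betw_combine) auto
  moreover have "C \<union> (topspace X - C) = topspace X" using C_sub by blast
  ultimately have "bij_betw (extend h) (topspace X) (topspace X)" by simp
  then show ?thesis
    using continuous_imp_homeomorphic_map[OF cont cpt haus] by (auto simp: bij_betw_def)
qed

lemma openin_extend_image:
  assumes h: "h \<in> cube_homeos n" and "openin (top_of_set (cube n)) U" "U \<subseteq> open_box n 1"
  shows "openin X (\<iota> ` (h ` U))"
proof -
  obtain U' where U': "open U'" "U = cube n \<inter> U'" using assms(2) by (auto simp: openin_open)
  have "U = U' \<inter> open_box n 1" using U' assms(3) by (auto simp: open_box_def cube_def less_imp_le)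
  then have "openin X (\<iota> ` U)" using \<iota>_open[OF U'(1)] by simp
  then have "openin X (extend h ` (\<iota> ` U))"
    using extend_homeomorphic[OF h] homeomorphic_imp_open_map by (meson open_map_def)
  moreover have "extend h ` (\<iota> ` U) = \<iota> ` (h ` U)"
    using U'(2) extend_\<iota> by (force simp: image_image)
  ultimately show ?thesis by simp
qed

end

lemma open_pre_box: "open {x :: nat \<Rightarrow> real. \<forall>i<n. \<bar>x i\<bar> < \<kappa>}"
proof -
  have "{x :: nat \<Rightarrow> real. \<forall>i<n. \<bar>x i\<bar> < \<kappa>} = (\<Inter>i\<in>{..<n}. {x. \<bar>x i\<bar> < \<kappa>})" by auto
  also have "open \<dots>" by (intro open_INT ballI open_Collect_less continuous_intros) auto
  finally show ?thesis .
qed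

lemma affine_coord_cont: "continuous_on A (\<lambda>(x :: nat \<Rightarrow> real) i. q i + R * x i)"
  by (intro continuous_on_coordinatewise_then_product continuous_intros)

lemma manifold_chart:
  assumes X: "topological_manifold n X" and cpt: "compact_space X" and p: "p \<in> U" and U: "openin X U"
  obtains \<iota> where "cube_chart X n \<iota>" "\<iota> ` cube n \<subseteq> U" "p \<in> \<iota> ` open_box n 1"
proof -
  let ?E = "Euclidean_space n"
  let ?Z = "{x :: nat \<Rightarrow> real. \<forall>i\<ge>n. x i = 0}"
  have E: "?E = top_of_set ?Z" by (simp add: Euclidean_space_def euclidean_product_topology)
  have "p \<in> topspace X" using p U openin_subset by blast
  then obtain A V where A: "openin X A" "p \<in> A" and V: "openin ?E V"
      and hs: "subtopology X A homeomorphic_space subtopology ?E V"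
    using X unfolding topological_manifold_def by blast
  then obtain e e' where ee: "homeomorphic_maps (subtopology X A) (subtopology ?E V) e e'"
    unfolding homeomorphic_space_def by blast
  have A_top: "topspace (subtopology X A) = A" and V_top: "topspace (subtopology ?E V) = V"
    using A V openin_subset by (auto simp: topspace_subtopology_subset)
  have e_in: "e x \<in> V" if "x \<in> A" for x
    using ee that A_top V_top by (auto simp: homeomorphic_maps_def continuous_map_def)
  have e'_in: "e' v \<in> A" if "v \<in> V" for v
    using ee that A_top V_top by (auto simp: homeomorphic_maps_def continuous_map_def)
  have e'e: "e' (e x) = x" if "x \<in> A" for x using ee that A_top by (auto simp: homeomorphic_maps_def)
  have ee': "e (e' v) = v" if "v \<in> V" for v using ee that V_top by (auto simp: homeomorphic_maps_def)
  have e'c: "continuous_map (subtopology ?E V) X e'"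
    using ee by (auto simp: homeomorphic_maps_def continuous_map_in_subtopology)
  have e'o: "open_map (subtopology ?E V) (subtopology X A) e'"
    using ee homeomorphic_maps_sym homeomorphic_maps_map homeomorphic_imp_open_map by metis
  define q where "q = e p"
  have q: "q \<in> V" "e' q = p" using e_in e'e A by (auto simp: q_def)
  define B where "B = {v \<in> V. e' v \<in> U}"
  have "openin (subtopology ?E V) B"
    using openin_continuous_map_preimage[OF e'c U] by (simp only: V_top B_def)
  then have "openin ?E B" using V by (meson openin_trans_full)
  then obtain B' where B': "open B'" "B = ?Z \<inter> B'" by (auto simp: E openin_open)
  have qB: "q \<in> B" using q p by (simp add: B_def)
  then have qZ: "q i = 0" if "i \<ge> n" for i using that B' by auto
  define W where "W = ((\<lambda>z i. q i + fst z * snd z i) -` B' :: (real \<times> (nat \<Rightarrow> real)) set)"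
  have W: "open W"
    unfolding W_def
  proof (rule open_vimage[OF B'(1)])
    show "continuous_on UNIV (\<lambda>(z :: real \<times> (nat \<Rightarrow> real)) i. q i + fst z * snd z i)"
    proof (rule continuous_on_coordinatewise_then_product)
      fix i
      have "continuous_on UNIV (\<lambda>z :: real \<times> (nat \<Rightarrow> real). snd z i)"
        by (rule continuous_on_compose2[OF continuous_on_coord[of UNIV i] continuous_on_snd[OF continuous_on_id]]) simp
      then show "continuous_on UNIV (\<lambda>z :: real \<times> (nat \<Rightarrow> real). q i + fst z * snd z i)"
        by (intro continuous_on_add continuous_on_mult continuous_on_const continuous_on_fst continuous_on_id)
    qed
  qed
  have sub: "{0} \<times> cube n \<subseteq> W" using qB B' by (auto simp: W_def)
  obtain N where *: "0 \<in> N \<and> open N \<and> N \<times> cube n \<subseteq> W"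
    using Elementary_Topology.tube_lemma[OF compact_cube W sub] by (rule exE)
  then have N: "0 \<in> N" "open N" "N \<times> cube n \<subseteq> W" by auto
  obtain e0 where "0 < e0" "ball 0 e0 \<subseteq> N" using N(1,2) open_contains_ball by blast
  define R where "R = e0 / 2"
  have R: "0 < R" "R \<in> N" using \<open>0 < e0\<close> \<open>ball 0 e0 \<subseteq> N\<close> by (auto simp: R_def subset_iff dist_real_def)
  define l where "l x = (\<lambda>i. q i + R * x i)" for x :: "nat \<Rightarrow> real"
  have lB: "l x \<in> B" if "x \<in> cube n" for x
  proof -
    have "(R, x) \<in> W" using N(3) R(2) that by blast
    moreover have "l x \<in> ?Z" using that qZ by (auto simp: l_def cube_def)
    ultimately show ?thesis using B' by (simp add: l_def W_def)
  qed
  have BV: "B \<subseteq> V" by (auto simp: B_def)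
  have box: "open_box n 1 \<subseteq> cube n" by (auto simp: open_box_def cube_def less_imp_le)
  define \<iota> where "\<iota> x = e' (l x)" for x
  show thesis
  proof (rule that[of \<iota>])
    show "cube_chart X n \<iota>"
    proof (rule cube_chart.intro)
      show "Hausdorff_space X" using X by (simp add: topological_manifold_def)
      show "compact_space X" by (rule cpt)
      have "continuous_map (top_of_set (cube n)) (subtopology ?E V) l"
        unfolding E subtopology_subtopology
        using lB BV B' by (auto simp: continuous_map_in_subtopology l_def affine_coord_cont)
      from continuous_map_compose[OF this e'c] show "continuous_map (top_of_set (cube n)) X \<iota>"
        by (simp add: \<iota>_def[abs_def] o_def)
      show "inj_on \<iota> (cube n)"
      proof (rule inj_onI)
        fix x x' assume x: "x \<in> cube n" "x' \<in> cube n" "\<iota> x = \<iota> x'"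
        then have "l x = l x'" using ee' lB BV by (metis \<iota>_def subsetD)
        then show "x = x'" using R(1) by (auto simp: l_def fun_eq_iff)
      qed
      fix A0 :: "(nat \<Rightarrow> real) set" assume A0: "open A0"
      let ?l' = "\<lambda>v i. (- q i / R) + (1 / R) * v i"
      have "open (?l' -` (A0 \<inter> {x. \<forall>i<n. \<bar>x i\<bar> < 1}))"
        using A0 open_pre_box by (intro open_vimage affine_coord_cont) auto
      moreover have "l ` (A0 \<inter> open_box n 1) = ?Z \<inter> ?l' -` (A0 \<inter> {x. \<forall>i<n. \<bar>x i\<bar> < 1})"
      proof (intro equalityI subsetI)
        fix v assume "v \<in> l ` (A0 \<inter> open_box n 1)"
        then obtain x where x: "x \<in> A0" "x \<in> open_box n 1" "v = l x" by blast
        have eq: "?l' v = x" using R(1) by (auto simp: x(3) l_def fun_eq_iff field_simps)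
        have "?l' v \<in> A0 \<inter> {x. \<forall>i<n. \<bar>x i\<bar> < 1}"
          unfolding eq using x by (simp add: open_box_def)
        then have mem: "v \<in> ?l' -` (A0 \<inter> {x. \<forall>i<n. \<bar>x i\<bar> < 1})" by (simp only: vimage_eq)
        have vZ: "v \<in> ?Z" using lB[of x] x box B' by auto
        from vZ mem show "v \<in> ?Z \<inter> ?l' -` (A0 \<inter> {x. \<forall>i<n. \<bar>x i\<bar> < 1})" by (rule IntI)
      next
        fix v assume v: "v \<in> ?Z \<inter> ?l' -` (A0 \<inter> {x. \<forall>i<n. \<bar>x i\<bar> < 1})"
        have e: "v = l (?l' v)" using R(1) by (auto simp: l_def fun_eq_iff field_simps)
        have vZ: "v \<in> ?Z" and "?l' v \<in> A0" "\<forall>i<n. \<bar>?l' v i\<bar> < 1" using v by simp_all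
        moreover have "?l' v i = 0" if "i \<ge> n" for i using vZ qZ[OF that] that by simp
        ultimately have m: "?l' v \<in> A0 \<inter> open_box n 1" by (simp add: open_box_def)
        show "v \<in> l ` (A0 \<inter> open_box n 1)" by (rule image_eqI[of v l "?l' v", OF e m])
      qed
      ultimately have "openin ?E (l ` (A0 \<inter> open_box n 1))" unfolding E by (auto simp: openin_open)
      moreover have "l ` (A0 \<inter> open_box n 1) \<subseteq> V" using lB BV box by blast
      ultimately have "openin (subtopology ?E V) (l ` (A0 \<inter> open_box n 1))"
        by (simp add: openin_open_subtopology[OF V])
      then have "openin (subtopology X A) (e' ` (l ` (A0 \<inter> open_box n 1)))"
        using e'o by (simp add: open_map_def)
      then have "openin X (e' ` (l ` (A0 \<inter> open_box n 1)))" by (simp add: openin_open_subtopology[OF A(1)])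
      then show "openin X (\<iota> ` (A0 \<inter> open_box n 1))" by (simp add: image_image \<iota>_def[abs_def])
    qed
    show "\<iota> ` cube n \<subseteq> U" using lB by (auto simp: \<iota>_def B_def)
    have e: "p = \<iota> (\<lambda>_. 0)" using q by (simp add: \<iota>_def l_def)
    have m: "(\<lambda>_. 0) \<in> open_box n 1" by (simp add: open_box_def)
    show "p \<in> \<iota> ` open_box n 1" by (rule image_eqI[of p \<iota> "\<lambda>_. 0", OF e m])
  qed
qed

lemma cube_chart_rescale:
  assumes "cube_chart X n \<iota>" and \<rho>: "0 < \<rho>" "\<rho> < 1"
  shows "cube_chart X n (\<lambda>x. \<iota> (\<lambda>i. \<rho> * x i))"
proof -
  interpret cube_chart X n \<iota> by fact
  let ?l = "\<lambda>(x :: nat \<Rightarrow> real) i. 0 + \<rho> * x i"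
  have l_cube: "?l x \<in> cube n" if "x \<in> cube n" for x
    using that \<rho> by (auto simp: cube_def abs_mult mult_le_one)
  show ?thesis
  proof (rule cube_chart.intro)
    show "Hausdorff_space X" "compact_space X" by (fact haus, fact cpt)
    have "continuous_map (top_of_set (cube n)) (top_of_set (cube n)) ?l"
      unfolding continuous_map_in_subtopology using l_cube affine_coord_cont[of _ "\<lambda>_. 0" \<rho>] by auto
    from continuous_map_compose[OF this \<iota>_cont]
    show "continuous_map (top_of_set (cube n)) X (\<lambda>x. \<iota> (\<lambda>i. \<rho> * x i))" by (simp add: o_def)
    show "inj_on (\<lambda>x. \<iota> (\<lambda>i. \<rho> * x i)) (cube n)"
    proof (rule inj_onI)
      fix x y assume "x \<in> cube n" "y \<in> cube n" "\<iota> (\<lambda>i. \<rho> * x i) = \<iota> (\<lambda>i. \<rho> * y i)"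
      then have "?l x = ?l y" using l_cube \<iota>_inj by (auto dest: inj_onD)
      then show "x = y" using \<rho>(1) by (auto simp: fun_eq_iff)
    qed
    fix U :: "(nat \<Rightarrow> real) set" assume U: "open U"
    let ?l' = "\<lambda>(v :: nat \<Rightarrow> real) i. 0 + (1 / \<rho>) * v i"
    have "open (?l' -` (U \<inter> {x. \<forall>i<n. \<bar>x i\<bar> < 1}))"
      using U open_pre_box by (intro open_vimage affine_coord_cont) auto
    then have "openin X (\<iota> ` (?l' -` (U \<inter> {x. \<forall>i<n. \<bar>x i\<bar> < 1}) \<inter> open_box n 1))" by (rule \<iota>_open)
    moreover have "?l' -` (U \<inter> {x. \<forall>i<n. \<bar>x i\<bar> < 1}) \<inter> open_box n 1 = ?l ` (U \<inter> open_box n 1)"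
    proof (intro equalityI subsetI)
      fix v assume v: "v \<in> ?l' -` (U \<inter> {x. \<forall>i<n. \<bar>x i\<bar> < 1}) \<inter> open_box n 1"
      have e: "v = ?l (?l' v)" using \<rho>(1) by (auto simp: fun_eq_iff)
      have m: "?l' v \<in> U \<inter> open_box n 1" using v by (simp add: open_box_def)
      show "v \<in> ?l ` (U \<inter> open_box n 1)" by (rule image_eqI[of v ?l "?l' v", OF e m])
    next
      fix v assume "v \<in> ?l ` (U \<inter> open_box n 1)"
      then obtain x where x: "x \<in> U" "x \<in> open_box n 1" "v = ?l x" by blast
      have eq: "?l' v = x" using \<rho>(1) by (auto simp: x(3) fun_eq_iff)
      have "?l' v \<in> U \<inter> {x. \<forall>i<n. \<bar>x i\<bar> < 1}"
        unfolding eq using x by (simp add: open_box_def)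
      then have mem: "v \<in> ?l' -` (U \<inter> {x. \<forall>i<n. \<bar>x i\<bar> < 1})" by (simp only: vimage_eq)
      have vb: "v \<in> open_box n 1"
      proof -
        have "\<rho> * \<bar>x i\<bar> < 1" if "i < n" for i
        proof -
          have "\<bar>x i\<bar> < 1" using x(2) that by (simp add: open_box_def)
          then have "\<rho> * \<bar>x i\<bar> \<le> \<rho> * 1" using \<rho> by (intro mult_left_mono) auto
          then show ?thesis using \<rho> by linarith
        qed
        then show ?thesis using x(2) \<rho>(1) by (simp add: x(3) open_box_def abs_mult)
      qed
      from mem vb show "v \<in> ?l' -` (U \<inter> {x. \<forall>i<n. \<bar>x i\<bar> < 1}) \<inter> open_box n 1" by (rule IntI)
    qed
    ultimately show "openin X ((\<lambda>x. \<iota> (\<lambda>i. \<rho> * x i)) ` (U \<inter> open_box n 1))"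
      by (simp add: image_image)
  qed
qed

text \<open>If an orbit returns to the cube for the first time at time \<open>k\<close>, then
  changing the map inside the cube only changes the \<open>k\<close>-th iterate near the starting point in
  the last step.\<close>

lemma (in cube_chart) first_return_horseshoe:
  assumes n: "2 \<le> n" and f: "homeomorphic_map X X f" and \<kappa>: "0 < \<kappa>" "\<kappa> < 1" and k: "0 < k"
    and y: "y \<in> open_box n \<kappa>" and ret: "(f ^^ k) (\<iota> y) \<in> \<iota> ` open_box n \<kappa>"
    and first: "\<And>l. 0 < l \<Longrightarrow> l < k \<Longrightarrow> (f ^^ l) (\<iota> y) \<notin> C"
  obtains H Q W p a m b where "H \<in> cube_homeos n"
    "\<And>g. (\<And>w. w \<in> topspace X \<Longrightarrow> g w = extend H (f w)) \<Longrightarrow> horseshoe X (g ^^ k) Q W p a m b"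
proof -
  have fc: "continuous_map X X f" and f_inj: "inj_on f (topspace X)"
    using f by (auto simp: homeomorphic_eq_everything_map)
  have fl_in: "(f ^^ l) x \<in> topspace X" if "x \<in> topspace X" for l x
    using continuous_map_funpow[OF fc, of l] that by (auto simp: continuous_map_def)
  have fk_inj: "inj_on (f ^^ l) (topspace X)" for l
  proof (induction l)
    case (Suc l)
    show ?case
    proof (rule inj_onI)
      fix u v assume uv: "u \<in> topspace X" "v \<in> topspace X" "(f ^^ Suc l) u = (f ^^ Suc l) v"
      then have "(f ^^ l) u = (f ^^ l) v" using f_inj fl_in by (auto dest: inj_onD)
      then show "u = v" using Suc uv by (auto dest: inj_onD)
    qed
  qed simp
  have boxc: "closed_box n \<kappa> \<subseteq> cube n" "open_box n \<kappa> \<subseteq> closed_box n \<kappa>" "open_box n \<kappa> \<subseteq> open_box n 1"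
    using box_mono(1)[OF \<kappa>(2), of n] box_mono(2)[of n \<kappa>] \<kappa> by (auto simp: open_box_def)
  have box_eq: "open_box n \<kappa> = {x. \<forall>i<n. \<bar>x i\<bar> < \<kappa>} \<inter> open_box n 1"
    using \<kappa>(2) by (auto simp: open_box_def)
  have box_open: "openin (top_of_set (cube n)) (open_box n \<kappa>)"
  proof -
    have "open_box n \<kappa> = cube n \<inter> {x. \<forall>i<n. \<bar>x i\<bar> < \<kappa>}"
      using boxc by (auto simp: open_box_def cube_def)
    then show ?thesis by (simp only: openin_open_Int[OF open_pre_box])
  qed
  have O: "openin X (\<iota> ` open_box n \<kappa>)" unfolding box_eq by (rule \<iota>_open[OF open_pre_box])
  define V where "V = {x \<in> cube n. \<forall>l\<in>{0<..<k}. (f ^^ l) (\<iota> x) \<in> topspace X - C} \<inter> {x \<in> cube n. (f ^^ k) (\<iota> x) \<in> \<iota> ` open_box n \<kappa>}"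
  have fi: "continuous_map (top_of_set (cube n)) X (\<lambda>x. (f ^^ l) (\<iota> x))" for l
    using continuous_map_compose[OF \<iota>_cont continuous_map_funpow[OF fc]] by (simp add: o_def)
  have V_open: "openin (top_of_set (cube n)) V"
  proof -
    have 1: "openin (top_of_set (cube n)) {x \<in> cube n. (f ^^ l) (\<iota> x) \<in> A}" if "openin X A" for l A
      using openin_continuous_map_preimage[OF fi that] by simp
    have "{x \<in> cube n. \<forall>l\<in>{0<..<k}. (f ^^ l) (\<iota> x) \<in> topspace X - C} =
        (\<Inter>l\<in>{0<..<k}. {x \<in> cube n. (f ^^ l) (\<iota> x) \<in> topspace X - C}) \<inter> topspace (top_of_set (cube n))" by auto
    moreover have "openin (top_of_set (cube n)) ((\<Inter>l\<in>{0<..<k}. {x \<in> cube n. (f ^^ l) (\<iota> x) \<in> topspace X - C}) \<inter> topspace (top_of_set (cube n)))"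
    proof (rule openin_INT)
      have "openin X (topspace X - C)" using closedin_C by blast
      then show "openin (top_of_set (cube n)) {x \<in> cube n. (f ^^ l) (\<iota> x) \<in> topspace X - C}" for l by (rule 1)
    qed simp
    ultimately have "openin (top_of_set (cube n)) {x \<in> cube n. \<forall>l\<in>{0<..<k}. (f ^^ l) (\<iota> x) \<in> topspace X - C}" by (simp only:)
    then show ?thesis unfolding V_def by (intro openin_Int 1 O)
  qed
  have yV: "y \<in> V"
    using y boxc first ret fl_in \<iota>_in by (auto simp: V_def)
  define F where "F x = coord ((f ^^ k) (\<iota> x))" for x
  have VC: "V \<subseteq> cube n" by (auto simp: V_def)
  have fV: "(f ^^ k) (\<iota> x) \<in> C" if "x \<in> V" for x using that boxc by (auto simp: V_def C_def)
  have F_cont: "continuous_on V F"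
  proof -
    have "continuous_map (top_of_set V) (subtopology X C) (\<lambda>x. (f ^^ k) (\<iota> x))"
      by (rule continuous_map_into_subtopology[OF continuous_map_from_subtopology_mono[OF fi VC]]) (use fV in auto)
    from continuous_map_compose[OF this coord_cont] show ?thesis
      by (auto simp: F_def[abs_def] o_def continuous_map_in_subtopology)
  qed
  have F_inj: "inj_on F V"
  proof (rule inj_onI)
    fix u v assume uv: "u \<in> V" "v \<in> V" "F u = F v"
    have "(f ^^ k) (\<iota> x) = \<iota> (F x)" if "x \<in> V" for x using coord_C(2)[OF fV[OF that]] by (simp add: F_def)
    then have "(f ^^ k) (\<iota> u) = (f ^^ k) (\<iota> v)" using uv by simp
    then have "\<iota> u = \<iota> v" using fk_inj[of k] \<iota>_in uv VC by (auto dest: inj_onD)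
    then show "u = v" using \<iota>_inj uv VC by (auto dest: inj_onD)
  qed
  have F_box: "F ` V \<subseteq> open_box n \<kappa>"
    using boxc coord_\<iota> by (auto simp: V_def F_def)
  obtain s h c1 c2 c3 where s: "s \<in> cube_homeos n" and h: "h \<in> cube_homeos n" and s0: "\<And>x. x \<in> cube n \<Longrightarrow> s x 0 = x 0"
    and c: "-\<kappa> < c1" "c1 < c2" "c2 < c3" "c3 < \<kappa>"
    and sV: "\<And>x. x \<in> closed_box n \<kappa> \<Longrightarrow> c1 \<le> x 0 \<Longrightarrow> x 0 \<le> c3 \<Longrightarrow> s x \<in> V \<and> h (F (s x)) \<in> open_box n \<kappa>"
    and f1: "\<And>x. x \<in> closed_box n \<kappa> \<Longrightarrow> x 0 = c1 \<Longrightarrow> h (F (s x)) 0 < c1"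
    and f2: "\<And>x. x \<in> closed_box n \<kappa> \<Longrightarrow> x 0 = c2 \<Longrightarrow> c3 < h (F (s x)) 0"
    and f3: "\<And>x. x \<in> closed_box n \<kappa> \<Longrightarrow> x 0 = c3 \<Longrightarrow> h (F (s x)) 0 < c1"
    by (fact fold_embedding[OF n \<kappa> y V_open yV F_cont F_inj F_box])
  define H where "H x = s (h x)" for x
  have H: "H \<in> cube_homeos n" unfolding H_def by (rule cube_homeos_comp[OF s h])
  define Q0 where "Q0 = {x \<in> closed_box n \<kappa>. c1 \<le> x 0 \<and> x 0 \<le> c3}"
  have Q0c: "Q0 \<subseteq> cube n" using boxc by (auto simp: Q0_def)
  have s_in: "s x \<in> cube n" if "x \<in> cube n" for x by (rule cube_homeos_in[OF s that])
  have sc: "continuous_map (top_of_set (cube n)) (top_of_set (cube n)) s"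
    using s s_in by (auto simp: continuous_map_in_subtopology cube_homeos_def)
  have \<iota>s: "continuous_map (top_of_set (cube n)) X (\<lambda>x. \<iota> (s x))"
    using continuous_map_compose[OF sc \<iota>_cont] by (simp add: o_def)
  define Q W where "Q = (\<lambda>x. \<iota> (s x)) ` Q0" and "W = (\<lambda>x. \<iota> (s x)) ` open_box n \<kappa>"
  have coord0: "continuous_map (subtopology X C) euclideanreal (\<lambda>w. coord w 0)"
  proof -
    have "continuous_map (top_of_set (cube n)) euclideanreal (\<lambda>x. x 0)" by (simp add: continuous_on_coord)
    from continuous_map_compose[OF coord_cont this] show ?thesis by (simp add: o_def)
  qed
  have coord0_bound: "(\<lambda>w. coord w 0) ` C \<subseteq> {-1..1}"
    using coord_C(1) n by (force simp: cube_def abs_le_iff)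
  have le: "-1 \<le> (1 :: real)" by simp
  have "normal_space X" using cpt haus compact_Hausdorff_or_regular_imp_normal_space by blast
  from Tietze_extension_closed_real_interval[OF this closedin_C coord0 coord0_bound le]
  obtain p where p: "continuous_map X euclideanreal p" "\<And>w. w \<in> C \<Longrightarrow> p w = coord w 0" by metis
  have p\<iota>: "p (\<iota> x) = x 0" if "x \<in> cube n" for x using p(2)[of "\<iota> x"] that by (simp add: C_def)
  have p\<iota>s: "p (\<iota> (s x)) = x 0" if "x \<in> cube n" for x using p\<iota>[OF s_in[OF that]] s0[OF that] by simp
  have "horseshoe X (g ^^ k) Q W p c1 c2 c3" if g: "\<And>w. w \<in> topspace X \<Longrightarrow> g w = extend H (f w)" for g
  proof -
    have gk: "(g ^^ k) (\<iota> x) = \<iota> (H (F x))" if x: "x \<in> V" for x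
    proof -
      have xX: "\<iota> x \<in> topspace X" using x VC \<iota>_in by blast
      have "(g ^^ l) (\<iota> x) = (f ^^ l) (\<iota> x)" if "l < k" for l
        using that
      proof (induction l)
        case (Suc l)
        then have "(g ^^ Suc l) (\<iota> x) = extend H ((f ^^ Suc l) (\<iota> x))"
          using g[OF fl_in[OF xX, of l]] by simp
        moreover have "(f ^^ Suc l) (\<iota> x) \<notin> C"
        proof -
          have "Suc l \<in> {0<..<k}" using Suc.prems by simp
          then have "(f ^^ Suc l) (\<iota> x) \<in> topspace X - C" using x unfolding V_def by blast
          then show ?thesis by blast
        qed
        ultimately show ?case by (simp add: extend_outside)
      qed simp
      then have "(g ^^ (k - 1)) (\<iota> x) = (f ^^ (k - 1)) (\<iota> x)" using k by simp
      moreover have "g ^^ k = g \<circ> (g ^^ (k - 1))" "f ^^ k = f \<circ> (f ^^ (k - 1))"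
        using k funpow.simps(2)[of "k - 1" g] funpow.simps(2)[of "k - 1" f] by simp_all
      ultimately have "(g ^^ k) (\<iota> x) = extend H ((f ^^ k) (\<iota> x))"
        using g[OF fl_in[OF xX, of "k - 1"]] by simp
      then show ?thesis using fV[OF x] by (simp add: extend_def F_def)
    qed
    have img: "(g ^^ k) (\<iota> (s x)) = \<iota> (s (h (F (s x))))" "h (F (s x)) \<in> open_box n \<kappa>" if "x \<in> Q0" for x
      using sV[of x] that gk[of "s x"] by (auto simp: Q0_def H_def)
    have pimg: "p ((g ^^ k) (\<iota> (s x))) = h (F (s x)) 0" if "x \<in> Q0" for x
      unfolding img(1)[OF that] by (rule p\<iota>s) (use img(2)[OF that] boxc in blast)
    show ?thesis
    proof (rule horseshoe.intro)
      show "closedin X Q"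
      proof -
        have "closed {x :: nat \<Rightarrow> real. (\<forall>i<n. \<bar>x i\<bar> \<le> \<kappa>) \<and> c1 \<le> x 0 \<and> x 0 \<le> c3}"
        proof -
          have "{x :: nat \<Rightarrow> real. (\<forall>i<n. \<bar>x i\<bar> \<le> \<kappa>) \<and> c1 \<le> x 0 \<and> x 0 \<le> c3} =
            (\<Inter>i\<in>{..<n}. {x. \<bar>x i\<bar> \<le> \<kappa>}) \<inter> {x. c1 \<le> x 0} \<inter> {x. x 0 \<le> c3}" by auto
          also have "closed \<dots>" by (intro closed_Int closed_INT ballI closed_Collect_le continuous_intros)
          finally show ?thesis .
        qed
        then have "closedin (top_of_set (cube n)) (cube n \<inter> {x. (\<forall>i<n. \<bar>x i\<bar> \<le> \<kappa>) \<and> c1 \<le> x 0 \<and> x 0 \<le> c3})"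
          by (rule closedin_closed_Int)
        moreover have "cube n \<inter> {x. (\<forall>i<n. \<bar>x i\<bar> \<le> \<kappa>) \<and> c1 \<le> x 0 \<and> x 0 \<le> c3} = Q0"
          using boxc by (auto simp: Q0_def closed_box_def cube_def)
        ultimately have "closedin (top_of_set (cube n)) Q0" by simp
        moreover have "compact_space (top_of_set (cube n))" using compact_cube by (simp add: compact_space_subtopology)
        ultimately have "compactin (top_of_set (cube n)) Q0" using closedin_compact_space by blast
        then have "compactin X Q" unfolding Q_def using \<iota>s by (rule image_compactin)
        then show ?thesis using haus compactin_imp_closedin by blast
      qed
      show "openin X W"
        using openin_extend_image[OF s box_open boxc(3)] by (simp add: W_def image_image)
      show "continuous_map X euclideanreal p" by (rule p(1))
      show "c1 < c2" "c2 < c3" by (rule c)+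
      show "c1 \<le> p w \<and> p w \<le> c3" if "w \<in> Q" for w
      proof -
        obtain x where "x \<in> Q0" "w = \<iota> (s x)" using \<open>w \<in> Q\<close> unfolding Q_def by blast
        then show ?thesis using p\<iota>s[of x] Q0c by (auto simp: Q0_def)
      qed
      show "w \<in> Q" if "w \<in> W" "c1 \<le> p w" "p w \<le> c3" for w
      proof -
        obtain x where x: "x \<in> open_box n \<kappa>" "w = \<iota> (s x)" using \<open>w \<in> W\<close> unfolding W_def by blast
        then have "p w = x 0" using p\<iota>s boxc by blast
        then have "x \<in> Q0" using that x boxc by (auto simp: Q0_def)
        then show ?thesis using x(2) unfolding Q_def by blast
      qed
      show "(g ^^ k) w \<in> W" if "w \<in> Q" for w
      proof -
        obtain x where x: "x \<in> Q0" "w = \<iota> (s x)" using \<open>w \<in> Q\<close> unfolding Q_def by blast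
        show ?thesis unfolding x(2) img(1)[OF x(1)] W_def using img(2)[OF x(1)] by blast
      qed
      show "p ((g ^^ k) w) < c1" if "w \<in> Q" "p w = c1" for w
      proof -
        obtain x where x: "x \<in> Q0" "w = \<iota> (s x)" using \<open>w \<in> Q\<close> unfolding Q_def by blast
        then have "x 0 = c1" using that(2) p\<iota>s Q0c by auto
        then show ?thesis unfolding x(2) pimg[OF x(1)] using f1 x(1) by (simp add: Q0_def)
      qed
      show "c3 < p ((g ^^ k) w)" if "w \<in> Q" "p w = c2" for w
      proof -
        obtain x where x: "x \<in> Q0" "w = \<iota> (s x)" using \<open>w \<in> Q\<close> unfolding Q_def by blast
        then have "x 0 = c2" using that(2) p\<iota>s Q0c by auto
        then show ?thesis unfolding x(2) pimg[OF x(1)] using f2 x(1) by (simp add: Q0_def)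
      qed
      show "p ((g ^^ k) w) < c1" if "w \<in> Q" "p w = c3" for w
      proof -
        obtain x where x: "x \<in> Q0" "w = \<iota> (s x)" using \<open>w \<in> Q\<close> unfolding Q_def by blast
        then have "x 0 = c3" using that(2) p\<iota>s Q0c by auto
        then show ?thesis unfolding x(2) pimg[OF x(1)] using f3 x(1) by (simp add: Q0_def)
      qed
      show "\<exists>\<gamma>. continuous_map (top_of_set {0..1::real}) X \<gamma> \<and> \<gamma> ` {0..1} \<subseteq> Q \<and> p (\<gamma> 0) = c1 \<and> p (\<gamma> 1) = c3"
      proof -
        define \<gamma>0 where "\<gamma>0 t = (\<lambda>i :: nat. if i = 0 then c1 + t * (c3 - c1) else 0)" for t :: real
        have \<gamma>Q: "\<gamma>0 t \<in> Q0" if t: "0 \<le> t" "t \<le> 1" for t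
        proof -
          have "t * (c3 - c1) \<le> 1 * (c3 - c1)" "0 \<le> t * (c3 - c1)"
            using t c by (auto intro!: mult_right_mono mult_nonneg_nonneg)
          then have "c1 \<le> \<gamma>0 t 0 \<and> \<gamma>0 t 0 \<le> c3" by (simp add: \<gamma>0_def)
          moreover have g0: "\<gamma>0 t i = 0" if "i \<noteq> 0" for i using that by (simp add: \<gamma>0_def)
          moreover have "\<bar>\<gamma>0 t i\<bar> \<le> \<kappa>" for i
            using calculation(1) c \<kappa> g0[of i] by (cases "i = 0") auto
          ultimately show ?thesis using n by (simp add: Q0_def closed_box_def)
        qed
        have "continuous_on {0..1} \<gamma>0"
        proof (rule continuous_on_coordinatewise_then_product)
          show "continuous_on {0..1} (\<lambda>t. \<gamma>0 t i)" for i
            unfolding \<gamma>0_def by (cases "i = 0") (auto intro!: continuous_intros)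
        qed
        then have "continuous_map (top_of_set {0..1}) (top_of_set (cube n)) \<gamma>0"
          using \<gamma>Q Q0c by (auto simp: continuous_map_in_subtopology)
        from continuous_map_compose[OF this \<iota>s]
        have "continuous_map (top_of_set {0..1}) X (\<lambda>t. \<iota> (s (\<gamma>0 t)))" by (simp add: o_def)
        moreover have "(\<lambda>t. \<iota> (s (\<gamma>0 t))) ` {0..1} \<subseteq> Q" using \<gamma>Q by (auto simp: Q_def)
        moreover have "p (\<iota> (s (\<gamma>0 0))) = c1" "p (\<iota> (s (\<gamma>0 1))) = c3"
          using p\<iota>s[of "\<gamma>0 0"] p\<iota>s[of "\<gamma>0 1"] \<gamma>Q[of 0] \<gamma>Q[of 1] Q0c by (auto simp: \<gamma>0_def subset_iff)
        ultimately show ?thesis by (intro exI[of _ "\<lambda>t. \<iota> (s (\<gamma>0 t))"] conjI)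
      qed
    qed
  qed
  with H show thesis by (rule that)
qed

lemma (in metrized_compact_space) Homeo_inv_cont:
  assumes "f \<in> Homeo X"
  shows "continuous_map X X (inv_into M f)"
proof -
  obtain g where g: "homeomorphic_maps X X f g"
    using assms by (auto simp: Homeo_def homeomorphic_map_maps)
  have "g y = inv_into M f y" if "y \<in> M" for y
  proof -
    have "g y \<in> M" "f (g y) = y"
      using g that by (auto simp: homeomorphic_maps_def continuous_map_def)
    then show ?thesis using Homeo_inv_left[OF assms, of "g y"] by simp
  qed
  moreover have "continuous_map X X g" using g by (simp add: homeomorphic_maps_def)
  ultimately show ?thesis using continuous_map_eq by blast
qed

text \<open>By compactness some orbit comes back arbitrarily close to a point \<open>p\<close>, hence to a small cube
  around \<open>p\<close>, where the map can be perturbed.\<close>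

lemma (in metrized_compact_space) horseshoe_maps_dense:
  assumes mf: "topological_manifold n X" and n: "2 \<le> n" and ne: "M \<noteq> {}"
    and f: "f \<in> Homeo X" and e: "0 < e"
  shows "\<exists>g\<in>horseshoe_maps. C0_dist X d f g < e"
proof -
  have fc: "continuous_map X X f" by (rule Homeo_cont[OF f])
  have fh: "homeomorphic_map X X f" using f by (simp add: Homeo_def)
  let ?fi = "inv_into M f"
  obtain x0 where x0: "x0 \<in> M" using ne by blast
  define orb where "orb i = (f ^^ i) x0" for i
  have orb_in: "orb i \<in> M" for i
    using continuous_map_funpow[OF fc, of i] x0 by (auto simp: orb_def continuous_map_def)
  have orb_add: "orb (i + j) = (f ^^ j) (orb i)" for i j
    by (simp add: orb_def funpow_add add.commute[of i j])
  have "compactin mtopology M" using cpt by (simp add: top compact_space_def)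
  then obtain p \<rho> where p: "p \<in> M" and \<rho>: "strict_mono \<rho>" and lim: "limitin mtopology (orb \<circ> \<rho>) p sequentially"
    unfolding compactin_sequentially using orb_in by (meson image_subsetI)
  define U where "U = mball p (e / 5) \<inter> {x \<in> M. ?fi x \<in> mball (?fi p) (e / 5)}"
  have "openin X U"
    unfolding U_def by (intro openin_Int openin_mball_X openin_continuous_map_preimage[OF Homeo_inv_cont[OF f] openin_mball_X])
  moreover have "p \<in> U" using p e Homeo_inv_in[OF f p] by (simp add: U_def)
  ultimately obtain \<iota> where \<iota>: "cube_chart X n \<iota>" "\<iota> ` cube n \<subseteq> U" "p \<in> \<iota> ` open_box n 1"
    using manifold_chart[OF mf cpt] by blast
  interpret big: cube_chart X n \<iota> by (rule \<iota>(1))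
  let ?N = "\<iota> ` open_box n 1"
  have N: "openin X ?N" using big.\<iota>_open[of UNIV] by simp
  then have "\<forall>\<^sub>F j in sequentially. orb (\<rho> j) \<in> ?N"
    using lim \<iota>(3) unfolding limitin_def top o_def by blast
  then obtain j0 where j0: "\<And>j. j0 \<le> j \<Longrightarrow> orb (\<rho> j) \<in> ?N" unfolding eventually_sequentially by blast
  define i where "i = \<rho> j0"
  define k where "k = (LEAST k. 0 < k \<and> orb (i + k) \<in> ?N)"
  have "\<rho> j0 < \<rho> (Suc j0)" using \<rho> by (simp add: strict_mono_def)
  then have "0 < \<rho> (Suc j0) - i \<and> orb (i + (\<rho> (Suc j0) - i)) \<in> ?N" using j0[of "Suc j0"] by (simp add: i_def)
  then have k: "0 < k" "orb (i + k) \<in> ?N" unfolding k_def by (metis (mono_tags, lifting) LeastI)+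
  have first: "orb (i + l) \<notin> ?N" if "0 < l" "l < k" for l
    using not_less_Least[of l "\<lambda>k. 0 < k \<and> orb (i + k) \<in> ?N"] that unfolding k_def by blast
  obtain y where y: "y \<in> open_box n 1" "orb i = \<iota> y" using j0[of j0] by (auto simp: i_def)
  obtain z where z: "z \<in> open_box n 1" "orb (i + k) = \<iota> z" using k(2) by blast
  \<comment> \<open>A slightly smaller cube contains both visits in its interior but meets the orbit
    segment between them nowhere.\<close>
  define \<kappa>0 where "\<kappa>0 = Max (insert (1/2) ((\<lambda>j. max \<bar>y j\<bar> \<bar>z j\<bar>) ` {..<n}))"
  have \<kappa>0: "\<bar>y j\<bar> \<le> \<kappa>0 \<and> \<bar>z j\<bar> \<le> \<kappa>0" if "j < n" for j
  proof -
    have "max \<bar>y j\<bar> \<bar>z j\<bar> \<le> \<kappa>0" unfolding \<kappa>0_def using that by (intro Max_ge) auto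
    then show ?thesis by simp
  qed
  have \<kappa>0_pos: "1 / 2 \<le> \<kappa>0" unfolding \<kappa>0_def by (intro Max_ge) auto
  have \<kappa>0_1: "\<kappa>0 < 1" unfolding \<kappa>0_def using y(1) z(1) by (subst Max_less_iff) (auto simp: open_box_def)
  define \<kappa>1 where "\<kappa>1 = (2 * \<kappa>0 + 1) / 3"
  define R where "R = (\<kappa>0 + 2) / 3"
  have R: "0 < R" "R < 1" "\<kappa>1 < R" "0 < \<kappa>1" "\<kappa>0 < \<kappa>1" using \<kappa>0_1 \<kappa>0_pos by (auto simp: R_def \<kappa>1_def)
  define \<kappa> where "\<kappa> = \<kappa>1 / R"
  have \<kappa>: "0 < \<kappa>" "\<kappa> < 1" using R by (auto simp: \<kappa>_def)
  define \<iota>' where "\<iota>' x = \<iota> (\<lambda>i. R * x i)" for x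
  interpret small: cube_chart X n \<iota>'
    unfolding \<iota>'_def by (rule cube_chart_rescale[OF \<iota>(1) R(1,2)])
  have small_big: "\<iota>' x \<in> ?N" if "x \<in> cube n" for x
  proof -
    have "R * \<bar>x i\<bar> < 1" if "i < n" for i
    proof -
      have "\<bar>x i\<bar> \<le> 1" using \<open>x \<in> cube n\<close> that by (simp add: cube_def)
      then have "R * \<bar>x i\<bar> \<le> R * 1" using R(1) by (intro mult_left_mono) auto
      then show ?thesis using R(2) by linarith
    qed
    then have "(\<lambda>i. R * x i) \<in> open_box n 1" using that R(1) by (simp add: open_box_def cube_def abs_mult)
    then show ?thesis by (simp add: \<iota>'_def)
  qed
  have shrink: "(\<lambda>i. v i / R) \<in> open_box n \<kappa>" "\<iota>' (\<lambda>i. v i / R) = \<iota> v"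
    if v: "v \<in> open_box n 1" "\<And>j. j < n \<Longrightarrow> \<bar>v j\<bar> \<le> \<kappa>0" for v
  proof -
    have "\<bar>v j\<bar> / R < \<kappa>1 / R" if "j < n" for j
    proof -
      have "\<bar>v j\<bar> < \<kappa>1" using v(2)[OF that] R(5) by linarith
      then show ?thesis using R(1) by (rule divide_strict_right_mono)
    qed
    then show "(\<lambda>i. v i / R) \<in> open_box n \<kappa>" using v(1) R(1) by (simp add: open_box_def \<kappa>_def)
    show "\<iota>' (\<lambda>i. v i / R) = \<iota> v" using R(1) by (simp add: \<iota>'_def)
  qed
  define y' where "y' = (\<lambda>i. y i / R)"
  have y': "y' \<in> open_box n \<kappa>" "\<iota>' y' = orb i"
    using shrink[OF y(1)] \<kappa>0 y(2) by (auto simp: y'_def)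
  have ret: "(f ^^ k) (\<iota>' y') \<in> \<iota>' ` open_box n \<kappa>"
  proof (rule image_eqI[of _ \<iota>' "\<lambda>i. z i / R"])
    show "(f ^^ k) (\<iota>' y') = \<iota>' (\<lambda>i. z i / R)"
      using shrink(2)[OF z(1)] \<kappa>0 z(2) by (simp add: y'(2) orb_add)
    show "(\<lambda>i. z i / R) \<in> open_box n \<kappa>" using shrink(1)[OF z(1)] \<kappa>0 by simp
  qed
  have away: "(f ^^ l) (\<iota>' y') \<notin> small.C" if l: "0 < l" "l < k" for l
  proof
    assume "(f ^^ l) (\<iota>' y') \<in> small.C"
    then have "orb (i + l) \<in> ?N" using small_big by (auto simp: small.C_def y'(2) orb_add)
    then show False using first[OF l] by simp
  qed
  have "\<exists>H\<in>cube_homeos n. \<exists>Q W p a m b. \<forall>g. (\<forall>w\<in>M. g w = small.extend H (f w)) \<longrightarrow> horseshoe X (g ^^ k) Q W p a m b"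
  proof (rule small.first_return_horseshoe[OF n fh \<kappa> k(1) y'(1) ret away])
    fix H Q W p a m b
    assume "H \<in> cube_homeos n" "\<And>g. (\<And>w. w \<in> M \<Longrightarrow> g w = small.extend H (f w)) \<Longrightarrow> horseshoe X (g ^^ k) Q W p a m b"
    then show ?thesis by blast
  qed
  then obtain H Q W p' a m b where H: "H \<in> cube_homeos n"
    and hs: "\<forall>g. (\<forall>w\<in>M. g w = small.extend H (f w)) \<longrightarrow> horseshoe X (g ^^ k) Q W p' a m b"
    by (elim bexE exE)
  let ?H = "small.extend H"
  define g where "g = restrict (\<lambda>w. ?H (f w)) M"
  have gM: "g w = ?H (f w)" if "w \<in> M" for w using that by (simp add: g_def)
  have Hh: "homeomorphic_map X X ?H" by (rule small.extend_homeomorphic[OF H])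
  then have HM: "?H ` M = M" by (simp add: homeomorphic_eq_everything_map)
  have gH: "g \<in> Homeo X"
  proof -
    have "homeomorphic_map X X (?H \<circ> f)" using fh Hh by (rule homeomorphic_map_compose)
    then have "homeomorphic_map X X g" by (rule homeomorphic_map_eq) (simp add: gM)
    then show ?thesis by (simp add: Homeo_def g_def)
  qed
  have "horseshoe X (g ^^ k) Q W p' a m b" using hs gM by blast
  then have "g \<in> horseshoe_maps" using gH k(1) unfolding horseshoe_maps_def by blast
  moreover have "C0_dist X d f g \<le> 2 * e / 5 + 2 * e / 5"
  proof (rule C0_dist_le)
    have CU: "small.C \<subseteq> U"
    proof
      fix w assume "w \<in> small.C"
      then have "w \<in> ?N" using small_big by (auto simp: small.C_def)
      moreover have "open_box n 1 \<subseteq> cube n" by (auto simp: open_box_def cube_def less_imp_le)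
      ultimately show "w \<in> U" using \<iota>(2) by blast
    qed
    have near: "d u v \<le> 2 * e / 5" if "u \<in> mball q (e / 5)" "v \<in> mball q (e / 5)" for u v q
      using that triangle[of u q v] commute[of u q] by (simp add: in_mball)
    have move: "w = ?H w \<or> (w \<in> small.C \<and> ?H w \<in> small.C)" for w
      using small.extend_C[OF H, of w] small.extend_outside[of w H] by metis
    fix x assume x: "x \<in> M"
    have fx: "f x \<in> M" by (rule Homeo_in[OF f x])
    show "d (f x) (g x) \<le> 2 * e / 5"
      using move[of "f x"]
    proof
      assume "f x = ?H (f x)"
      then show ?thesis using fx e gM[OF x] by simp
    next
      assume "f x \<in> small.C \<and> ?H (f x) \<in> small.C"
      then have "f x \<in> mball p (e / 5)" "?H (f x) \<in> mball p (e / 5)" using CU by (auto simp: U_def)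
      then show ?thesis unfolding gM[OF x] by (rule near)
    qed
    obtain v where v: "v \<in> M" "x = ?H v" using x HM by (metis imageE)
    have u: "?fi v \<in> M" by (rule Homeo_inv_in[OF f v(1)])
    have "g (?fi v) = x" using gM[OF u] Homeo_inv_right[OF f v(1)] v(2) by simp
    then have gi: "inv_into M g x = ?fi v" using Homeo_inv_left[OF gH u] by simp
    show "d (?fi x) (inv_into M g x) \<le> 2 * e / 5"
      using move[of v]
    proof
      assume "v = ?H v"
      then show ?thesis using u e gi v by simp
    next
      assume "v \<in> small.C \<and> ?H v \<in> small.C"
      then have "?fi v \<in> mball (?fi p) (e / 5)" "?fi x \<in> mball (?fi p) (e / 5)" using CU v(2) by (auto simp: U_def)
      then show ?thesis unfolding gi using near by blast
    qed
  qed (use e in simp)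
  ultimately show ?thesis using e by (intro bexI[of _ g]) auto
qed


section \<open>The residual set\<close>

theorem theorem1p2:
  fixes X :: "'a topology" and d :: "'a \<Rightarrow> 'a \<Rightarrow> real" and n :: nat
  assumes "topological_manifold n X" and "n \<ge> 2" and "compact_space X"
    and "Metric_space (topspace X) d" and "Metric_space.mtopology (topspace X) d = X"
  shows "\<exists>R \<subseteq> Homeo X. residual_in (C0_topology X d) R \<and>
    (\<forall>f\<in>R. \<forall>r \<alpha>. roof_function X r \<longrightarrow> brake X f r \<alpha> \<longrightarrow>
       flow_entropy (susp_space X f r) (pseudo_singular_flow X f r \<alpha>) > 0)"
proof -
  interpret D: Metric_space "topspace X" d by (rule assms(4))
  interpret metrized_compact_space X d by unfold_locales (fact assms(5), fact assms(3))
  interpret C: Metric_space "Homeo X" "C0_dist X d" by (rule C0_Metric_space)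
  have top: "topspace (C0_topology X d) = Homeo X" by (simp add: C0_topology_def)
  show ?thesis
  proof (cases "M = {}")
    case True
    \<comment> \<open>Over the empty manifold there is no brake, since it would have a zero.\<close>
    have no: "\<not> brake X f r \<alpha>" for f r \<alpha>
      using True by (auto simp: brake_def Let_def topspace_susp_space under_roof_def)
    have "residual_in (C0_topology X d) (Homeo X)"
      unfolding residual_in_def
      by (intro exI[of _ "\<lambda>_. Homeo X"]) (use top in \<open>auto simp: openin_topspace[of "C0_topology X d", unfolded top] closure_of_topspace[of "C0_topology X d", unfolded top]\<close>)
    then show ?thesis using no by blast
  next
    case False
    have "C0_topology X d closure_of horseshoe_maps = Homeo X"
    proof
      show "C0_topology X d closure_of horseshoe_maps \<subseteq> Homeo X"
        using closure_of_subset_topspace[of "C0_topology X d"] top by metis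
      show "Homeo X \<subseteq> C0_topology X d closure_of horseshoe_maps"
      proof
        fix f assume f: "f \<in> Homeo X"
        have "\<exists>g\<in>horseshoe_maps. g \<in> C.mball f e" if e: "0 < e" for e
        proof -
          obtain g where g: "g \<in> horseshoe_maps" "C0_dist X d f g < e"
            using horseshoe_maps_dense[OF assms(1,2) False f e] by blast
          then show ?thesis using f by (intro bexI[of _ g]) (auto simp: C.in_mball horseshoe_maps_def)
        qed
        then show "f \<in> C0_topology X d closure_of horseshoe_maps"
          using f by (simp add: C0_topology_def C.metric_closure_of)
      qed
    qed
    then have "residual_in (C0_topology X d) horseshoe_maps"
      unfolding residual_in_def using openin_horseshoe_maps top
      by (intro exI[of _ "\<lambda>_. horseshoe_maps"]) simp
    moreover have "0 < flow_entropy (susp_space X f r) (pseudo_singular_flow X f r \<alpha>)"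
      if f: "f \<in> horseshoe_maps" and r: "roof_function X r" and \<alpha>: "brake X f r \<alpha>" for f r \<alpha>
    proof -
      obtain k Q W p a m b where k: "0 < k" and h: "horseshoe X (f ^^ k) Q W p a m b" and fH: "f \<in> Homeo X"
        using f unfolding horseshoe_maps_def by blast
      have "Hausdorff_space X" using assms(1) by (simp add: topological_manifold_def)
      from horseshoe_imp_flow_entropy_pos[OF assms(3) this fH k h r \<alpha>] show ?thesis .
    qed
    moreover have "horseshoe_maps \<subseteq> Homeo X" by (auto simp: horseshoe_maps_def)
    ultimately show ?thesis by blast
  qed
qed

end
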